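(* For any $q>1$ and any positive integer $k$, the equation $$-\Delta_{g_{FS}}u+\lambda u=\lambda u^q$$ on $(\mathbf{CP}^2,g_{FS})$ has at least $k$ different positive $SO(3)$-invariant solutions if $\lambda\in\left(\frac{16k(k+1)}{q-1},\frac{16(k+1)(k+2)}{q-1}\right]$.
   Context: $g_{FS}$ is the Fubini–Study metric on $\mathbf{CP}^2$, normalized so that the Hopf fibration $\mathbb S^5\to\mathbf{CP}^2$ from the round sphere of curvature one is a Riemannian submersion. $\Delta_{g_{FS}}$ is the Laplace–Beltrami operator, with the sign convention that $-\Delta_{g_{FS}}$ is nonnegative. $SO(3)$ acts isometrically on $\mathbf{CP}^2$ via the inclusion $SO(3)\subset U(3)$ as real matrices acting on $\mathbb C^3$; this is a cohomogeneity one action. *)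

theory Defs
  imports "HOL-Analysis.Analysis"
begin

section \<open>The complex projective plane\<close>

definition same_line :: "complex^3 \<Rightarrow> complex^3 \<Rightarrow> bool" where
  "same_line z w \<longleftrightarrow> z \<noteq> 0 \<and> w \<noteq> 0 \<and> (\<exists>c. w = c *s z)"

lemma part_equivp_same_line: "part_equivp same_line"
proof (rule part_equivpI)
  show "\<exists>z. same_line z z"
    by (rule exI[of _ "axis 1 1"]) (auto simp: same_line_def axis_eq_0_iff intro: exI[of _ 1])
  show "symp same_line"
  proof (rule sympI)
    fix z w assume "same_line z w"
    then obtain c where c: "z \<noteq> 0" "w \<noteq> 0" "w = c *s z"
      by (auto simp: same_line_def)
    then have "c \<noteq> 0" by auto
    then have "z = inverse c *s w" using c by (simp add: vector_smult_assoc)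
    then show "same_line w z" using c unfolding same_line_def by blast
  qed
  show "transp same_line"
    by (rule transpI) (auto simp: same_line_def vector_smult_assoc)
qed

text \<open>
  \<open>abs_cp2 z\<close> is the point \<open>[z]\<close> of the projective plane; its value is meaningful only for
  nonzero \<open>z\<close>.  Restricted to vectors of norm one it is the Hopf fibration.
\<close>
quotient_type cp2 = "complex^3" / partial: same_line
  by (rule part_equivp_same_line)

lemma abs_cp2_eqI: "same_line z w \<Longrightarrow> abs_cp2 z = abs_cp2 w"
  using Quotient_rel_abs[OF Quotient_cp2] .

text \<open>
  Real coordinates on the affine chart where the \<open>j\<close>-th homogeneous coordinate does not vanish.
  Indices of type \<open>3\<close> are taken modulo 3, so \<open>j\<close>, \<open>j + 1\<close>, \<open>j + 2\<close> are the three coordinates.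
\<close>
definition affine_vec :: "3 \<Rightarrow> real^4 \<Rightarrow> complex^3" where
  "affine_vec j x = (\<chi> i. if i = j then 1
                          else if i = j + 1 then Complex (x $ 1) (x $ 2)
                          else Complex (x $ 3) (x $ 4))"

definition affine_param :: "3 \<Rightarrow> real^4 \<Rightarrow> cp2" where
  "affine_param j x = abs_cp2 (affine_vec j x)"

lemma affine_vec_nonzero: "affine_vec j x \<noteq> 0"
  by (auto simp: affine_vec_def vec_eq_iff intro!: exI[of _ j])

lemma affine_params_cover: "\<exists>j x. p = affine_param j x"
proof -
  have "Quotient same_line abs_cp2 rep_cp2 cr_cp2"
    by (rule Quotient_cp2)
  then obtain z where z: "same_line z z" "p = abs_cp2 z"
    by (metis Quotient_rep_reflp Quotient_abs_rep)
  then obtain j where j: "z $ j \<noteq> 0"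
    by (auto simp: same_line_def vec_eq_iff)
  define a where "a = z $ (j + 1) / z $ j"
  define b where "b = z $ (j + 2) / z $ j"
  define x :: "real^4" where
    "x = (\<chi> i. if i = 1 then Re a else if i = 2 then Im a else if i = 3 then Re b else Im b)"
  have x: "Complex (x $ 1) (x $ 2) = a" "Complex (x $ 3) (x $ 4) = b"
    by (simp_all add: x_def)
  have cases3: "i = j \<or> i = j + 1 \<or> i = j + 2" for i :: 3
    using exhaust_3[of i] exhaust_3[of j] by auto
  have dist: "j + 1 \<noteq> j" "j + 2 \<noteq> j" "j + 2 \<noteq> j + 1"
    by simp_all
  have "affine_vec j x = inverse (z $ j) *s z"
    unfolding vec_eq_iff
  proof
    fix i show "affine_vec j x $ i = (inverse (z $ j) *s z) $ i"
      using cases3[of i] j dist by (auto simp: affine_vec_def x a_def b_def field_simps)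
  qed
  then have "same_line z (affine_vec j x)"
    using z affine_vec_nonzero by (auto simp: same_line_def)
  then have "p = affine_param j x"
    using z abs_cp2_eqI by (simp add: affine_param_def)
  then show ?thesis by blast
qed


section \<open>Calculus in coordinates\<close>

definition partial_deriv :: "'n::finite \<Rightarrow> (real^'n \<Rightarrow> 'b::real_normed_vector) \<Rightarrow> real^'n \<Rightarrow> 'b" where
  "partial_deriv i f x = frechet_derivative f (at x) (axis i 1)"

definition C2 :: "(real^'n::finite \<Rightarrow> real) \<Rightarrow> bool" where
  "C2 f \<longleftrightarrow> (\<forall>x. f differentiable (at x)) \<and>
            (\<forall>i x. partial_deriv i f differentiable (at x)) \<and>
            (\<forall>i j. continuous_on UNIV (partial_deriv i (partial_deriv j f)))"

definition laplace_beltrami :: "(real^'n::finite \<Rightarrow> real^'n^'n) \<Rightarrow> (real^'n \<Rightarrow> real) \<Rightarrow> real^'n \<Rightarrow> real" where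
  "laplace_beltrami g f x =
     (\<Sum>i\<in>UNIV. partial_deriv i
        (\<lambda>y. sqrt (det (g y)) * (\<Sum>j\<in>UNIV. matrix_inv (g y) $ i $ j * partial_deriv j f y)) x)
     / sqrt (det (g x))"


section \<open>The Fubini--Study metric\<close>

text \<open>A local section of the Hopf fibration over the \<open>j\<close>-th affine chart.\<close>
definition hopf_section :: "3 \<Rightarrow> real^4 \<Rightarrow> complex^3" where
  "hopf_section j x = affine_vec j x /\<^sub>R norm (affine_vec j x)"

lemma norm_hopf_section: "norm (hopf_section j x) = 1"
  by (simp add: hopf_section_def affine_vec_nonzero)

lemma hopf_section_lifts: "abs_cp2 (hopf_section j x) = affine_param j x"
proof -
  let ?z = "affine_vec j x"
  have "hopf_section j x = complex_of_real (inverse (norm ?z)) *s ?z"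
    unfolding hopf_section_def vec_eq_iff vector_scaleR_component vector_smult_component
    by (simp add: scaleR_conv_of_real[where 'a=complex])
  then have "same_line ?z (hopf_section j x)"
    using affine_vec_nonzero[of j x] by (auto simp: same_line_def hopf_section_def)
  then show ?thesis
    unfolding affine_param_def by (metis abs_cp2_eqI)
qed

text \<open>
  The inner product of \<open>complex^3\<close> is the real part of the Hermitian product, i.e. the Euclidean one.
  For a unit vector \<open>s\<close>, the fibre of the Hopf fibration through \<open>s\<close> has unit tangent vector
  \<open>\<i> *s s\<close>, and a tangent vector of the sphere is horizontal iff it is orthogonal to it.
\<close>
definition horizontal_part :: "complex^3 \<Rightarrow> complex^3 \<Rightarrow> complex^3" where
  "horizontal_part s v = v - (v \<bullet> (\<i> *s s)) *\<^sub>R (\<i> *s s)"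

text \<open>
  The metric making the Hopf fibration of the unit sphere a Riemannian submersion: the inner product
  of two coordinate vectors is that of their horizontal lifts, and the horizontal lift of the
  \<open>a\<close>-th coordinate vector at \<open>hopf_section j x\<close> is the horizontal part of the \<open>a\<close>-th partial
  derivative of the section.
\<close>
definition fubini_study :: "3 \<Rightarrow> real^4 \<Rightarrow> real^4^4" where
  "fubini_study j x = (\<chi> a b.
     horizontal_part (hopf_section j x) (partial_deriv a (hopf_section j) x) \<bullet>
     horizontal_part (hopf_section j x) (partial_deriv b (hopf_section j) x))"


section \<open>The equation and the symmetry\<close>

text \<open>
  Classical solutions of \<open>- \<Delta> u + \<lambda> u = \<lambda> u\<^sup>q\<close> (for positive \<open>u\<close>), written in the affine atlas:
  regularity and the equation are required in all three charts, which cover the projective plane.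
\<close>
definition yamabe_type_solution :: "real \<Rightarrow> real \<Rightarrow> (cp2 \<Rightarrow> real) \<Rightarrow> bool" where
  "yamabe_type_solution q lam u \<longleftrightarrow>
     (\<forall>j. C2 (u \<circ> affine_param j) \<and>
        (\<forall>x. - laplace_beltrami (fubini_study j) (u \<circ> affine_param j) x
               + lam * u (affine_param j x)
             = lam * u (affine_param j x) powr q))"

definition SO3_invariant :: "(cp2 \<Rightarrow> real) \<Rightarrow> bool" where
  "SO3_invariant u \<longleftrightarrow>
     (\<forall>A :: real^3^3. rotation_matrix A \<longrightarrow>
        (\<forall>z. z \<noteq> 0 \<longrightarrow> u (abs_cp2 (map_matrix complex_of_real A *v z)) = u (abs_cp2 z)))"

end

theory Submission
  imports Defs
begin

text \<open>
  A function of the ratio \<open>h [z] = \<bar>z\<^sub>1\<^sup>2 + z\<^sub>2\<^sup>2 + z\<^sub>3\<^sup>2\<bar>\<^sup>2 / \<bar>z\<bar>\<^sup>4 \<in> [0, 1]\<close> is invariant under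
  \<open>SO(3)\<close>, and for the Fubini--Study metric \<open>\<Delta> (U \<circ> h) = 16 (h (1 - h) U')' \<circ> h\<close>
  (\<open>laplace_beltrami_ratio\<close>).  With \<open>\<mu> = \<lambda> / 16\<close> it therefore suffices to find positive solutions,
  twice continuously differentiable up to the endpoints, of
  \<open>(x (1 - x) u')' = - \<mu> (u\<^sup>q - u)\<close> on \<open>[0, 1]\<close>.
  This equation is symmetric under \<open>x \<mapsto> 1 - x\<close>, and symmetric solutions are already numerous enough:
  they correspond to the solutions on \<open>[0, 1/2]\<close>, regular at the singular endpoint \<open>0\<close>, with
  \<open>u' (1/2) = 0\<close>.

  For each initial value \<open>u 0 = a\<close> there is exactly one regular solution, and it depends
  Lipschitz-continuously on \<open>a\<close> (\<open>legendre_ivp\<close>, \<open>legendre_stability\<close>).  For \<open>a \<noteq> 1\<close> the curve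
  \<open>((u - 1) / (a - 1), x (1 - x) u' / (a - 1))\<close> starts at \<open>(1, 0)\<close> and never meets the origin, so it
  has a continuous polar angle, starting at \<open>0\<close>.  Its value \<open>\<Phi> a\<close> at \<open>x = 1/2\<close> is continuous in \<open>a\<close>,
  and \<open>u' (1/2) = 0\<close> if and only if \<open>\<Phi> a\<close> is a multiple of \<open>\<pi>\<close>.

  Near \<open>a = 1\<close> the equation is close to its linearization, the Legendre equation with parameter
  \<open>\<mu> (q - 1)\<close>.  Let \<open>m = k div 2\<close>.  The hypothesis gives \<open>\<mu> (q - 1) > k (k + 1) \<ge> 2 m (2 m + 1)\<close>, and
  comparison with the even Legendre polynomials of degrees \<open>0, 2, \<dots>, 2 m\<close> shows \<open>\<Phi> a < - m \<pi>\<close>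
  (\<open>sturm_comparison\<close>, \<open>even_legendre_angle\<close>).  For small \<open>a > 0\<close> the solution increases on
  \<open>[0, 1/2]\<close>, and for large \<open>a\<close> it decreases (\<open>large_start_decreasing\<close>); in both cases
  \<open>\<Phi> a > - \<pi>\<close>.  By the intermediate value theorem \<open>\<Phi>\<close> takes each of the values
  \<open>- \<pi>, \<dots>, - m \<pi>\<close> on both sides of \<open>1\<close>.  Together with the constant solution \<open>1\<close> this gives
  \<open>2 m + 1 \<ge> k\<close> solutions, told apart by their values at \<open>0\<close>.

  To make the initial value problem globally solvable, \<open>u\<^sup>q - u\<close> is replaced by a function that vanishes
  for \<open>u \<le> 0\<close> and is constant beyond a large bound.  The solutions found are positive, because a
  nonpositive minimum would be a rest point, and they stay below the bound because
  \<open>u\<^sup>q - u \<ge> - 1\<close>; hence they solve the original equation.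
\<close>

section \<open>Twice continuously differentiable functions\<close>

lemma partial_deriv_eq: "(f has_derivative f') (at x) \<Longrightarrow> partial_deriv i f x = f' (axis i 1)"
  unfolding partial_deriv_def using frechet_derivative_at by metis

lemma partial_deriv_mult:
  fixes f g :: "real^'n::finite \<Rightarrow> real"
  assumes "f differentiable (at x)" "g differentiable (at x)"
  shows "partial_deriv i (\<lambda>y. f y * g y) x = f x * partial_deriv i g x + partial_deriv i f x * g x"
proof -
  have "(f has_derivative frechet_derivative f (at x)) (at x)"
    "(g has_derivative frechet_derivative g (at x)) (at x)"
    using assms frechet_derivative_works by blast+
  from has_derivative_mult[OF this] show ?thesis
    by (subst partial_deriv_eq) (auto simp: partial_deriv_def)
qed

lemma partial_deriv_add:
  fixes f g :: "real^'n::finite \<Rightarrow> real"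
  assumes "f differentiable (at x)" "g differentiable (at x)"
  shows "partial_deriv i (\<lambda>y. f y + g y) x = partial_deriv i f x + partial_deriv i g x"
proof -
  have "(f has_derivative frechet_derivative f (at x)) (at x)"
    "(g has_derivative frechet_derivative g (at x)) (at x)"
    using assms frechet_derivative_works by blast+
  from has_derivative_add[OF this] show ?thesis
    by (subst partial_deriv_eq) (auto simp: partial_deriv_def)
qed

lemma has_derivative_compose_real_within:
  fixes f :: "real^'n::finite \<Rightarrow> real"
  assumes "f differentiable (at x)" "range f \<subseteq> S"
    and "(U has_real_derivative U') (at (f x) within S)"
  shows "((\<lambda>y. U (f y)) has_derivative (\<lambda>h. U' * frechet_derivative f (at x) h)) (at x)"
proof -
  have f: "(f has_derivative frechet_derivative f (at x)) (at x)"
    using assms(1) frechet_derivative_works by blast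
  have "(U has_derivative (*) U') (at (f x) within range f)"
    using assms(2,3) has_derivative_subset unfolding has_field_derivative_def by blast
  from has_derivative_in_compose[OF f this] show ?thesis by simp
qed

lemma partial_deriv_compose:
  fixes f :: "real^'n::finite \<Rightarrow> real"
  assumes "f differentiable (at x)" "range f \<subseteq> S"
    and "(U has_real_derivative U') (at (f x) within S)"
  shows "partial_deriv i (\<lambda>y. U (f y)) x = U' * partial_deriv i f x"
  using partial_deriv_eq[OF has_derivative_compose_real_within[OF assms]]
  by (simp add: partial_deriv_def)

lemma C2_D:
  assumes "C2 f"
  shows "f differentiable (at x)" "partial_deriv i f differentiable (at x)"
    "continuous_on A (partial_deriv i (partial_deriv j f))"
    "continuous_on A (partial_deriv i f)" "continuous_on A f"
proof -
  show d: "f differentiable (at x)" "partial_deriv i f differentiable (at x)" for x i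
    using assms by (auto simp: C2_def)
  have "continuous_on UNIV (partial_deriv i (partial_deriv j f))"
    using assms by (simp add: C2_def)
  then show "continuous_on A (partial_deriv i (partial_deriv j f))"
    by (rule continuous_on_subset) simp
  show "continuous_on A (partial_deriv i f)"
    by (rule continuous_at_imp_continuous_on) (use d(2) differentiable_imp_continuous_within in blast)
  show "continuous_on A f"
    by (rule continuous_at_imp_continuous_on) (use d(1) differentiable_imp_continuous_within in blast)
qed

text \<open>
  The outer function is differentiated only within the set containing the values of \<open>f\<close>.  So it may
  live on the closed interval \<open>[0, 1]\<close>, although the inner function attains the endpoints.
\<close>
lemma C2_compose:
  fixes f :: "real^'n::finite \<Rightarrow> real"
  assumes f: "C2 f" and rng: "range f \<subseteq> S"
    and U: "\<And>y. y \<in> S \<Longrightarrow> (U has_real_derivative U' y) (at y within S)"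
    and U1: "\<And>y. y \<in> S \<Longrightarrow> (U' has_real_derivative U'' y) (at y within S)"
    and U2: "continuous_on S U''"
  shows "C2 (\<lambda>x. U (f x))"
proof -
  note df = C2_D[OF f]
  have S: "f x \<in> S" for x using rng by auto
  have p1: "partial_deriv i (\<lambda>x. U (f x)) = (\<lambda>x. U' (f x) * partial_deriv i f x)" for i
    by (rule ext, rule partial_deriv_compose[OF df(1) rng U[OF S]])
  have d1: "(\<lambda>x. U' (f x)) differentiable (at x)" for x
    unfolding differentiable_def using has_derivative_compose_real_within[OF df(1) rng U1[OF S]] by blast
  have p2: "partial_deriv i (partial_deriv j (\<lambda>x. U (f x))) =
     (\<lambda>x. U' (f x) * partial_deriv i (partial_deriv j f) x
        + (U'' (f x) * partial_deriv i f x) * partial_deriv j f x)" for i j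
    unfolding p1
    by (rule ext) (simp only: partial_deriv_mult[OF d1 df(2)] partial_deriv_compose[OF df(1) rng U1[OF S]])
  have cU': "continuous_on S U'"
    unfolding continuous_on_eq_continuous_within using DERIV_continuous[OF U1] by blast
  have c: "continuous_on UNIV (\<lambda>x. U' (f x))" "continuous_on UNIV (\<lambda>x. U'' (f x))"
    by (rule continuous_on_compose2[OF cU' df(5) rng], rule continuous_on_compose2[OF U2 df(5) rng])
  show ?thesis
    unfolding C2_def
  proof (intro conjI allI)
    show "(\<lambda>x. U (f x)) differentiable at x" for x
      unfolding differentiable_def using has_derivative_compose_real_within[OF df(1) rng U[OF S]] by blast
    show "partial_deriv i (\<lambda>x. U (f x)) differentiable at x" for i x
      unfolding p1 by (intro differentiable_mult d1 df)
    show "continuous_on UNIV (partial_deriv i (partial_deriv j (\<lambda>x. U (f x))))" for i j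
      unfolding p2 by (intro continuous_on_add continuous_on_mult c C2_D(3,4)[OF f])
  qed
qed

lemma C2_mult:
  fixes f g :: "real^'n::finite \<Rightarrow> real"
  assumes f: "C2 f" and g: "C2 g"
  shows "C2 (\<lambda>x. f x * g x)"
proof -
  note df = C2_D[OF f] and dg = C2_D[OF g]
  have p1: "partial_deriv i (\<lambda>x. f x * g x) = (\<lambda>x. f x * partial_deriv i g x + partial_deriv i f x * g x)" for i
    by (rule ext, rule partial_deriv_mult[OF df(1) dg(1)])
  have p2: "partial_deriv i (partial_deriv j (\<lambda>x. f x * g x)) =
     (\<lambda>x. (f x * partial_deriv i (partial_deriv j g) x + partial_deriv i f x * partial_deriv j g x)
        + (partial_deriv j f x * partial_deriv i g x + partial_deriv i (partial_deriv j f) x * g x))" for i j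
    unfolding p1
    by (rule ext, subst partial_deriv_add; (intro differentiable_mult df dg)?)
       (simp add: partial_deriv_mult df dg)
  show ?thesis
    unfolding C2_def
  proof (intro conjI allI)
    show "(\<lambda>x. f x * g x) differentiable at x" for x by (intro differentiable_mult df dg)
    show "partial_deriv i (\<lambda>x. f x * g x) differentiable at x" for i x
      unfolding p1 by (intro differentiable_mult differentiable_add df dg)
    show "continuous_on UNIV (partial_deriv i (partial_deriv j (\<lambda>x. f x * g x)))" for i j
      unfolding p2 by (intro continuous_on_add continuous_on_mult C2_D(3,4,5)[OF f] C2_D(3,4,5)[OF g])
  qed
qed

lemma C2_add:
  fixes f g :: "real^'n::finite \<Rightarrow> real"
  assumes f: "C2 f" and g: "C2 g"
  shows "C2 (\<lambda>x. f x + g x)"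
proof -
  note df = C2_D[OF f] and dg = C2_D[OF g]
  have p1: "partial_deriv i (\<lambda>x. f x + g x) = (\<lambda>x. partial_deriv i f x + partial_deriv i g x)" for i
    by (rule ext, rule partial_deriv_add[OF df(1) dg(1)])
  have p2: "partial_deriv i (partial_deriv j (\<lambda>x. f x + g x)) =
     (\<lambda>x. partial_deriv i (partial_deriv j f) x + partial_deriv i (partial_deriv j g) x)" for i j
    unfolding p1 by (rule ext, rule partial_deriv_add; intro df dg)
  show ?thesis
    unfolding C2_def
  proof (intro conjI allI)
    show "(\<lambda>x. f x + g x) differentiable at x" for x by (intro differentiable_add df dg)
    show "partial_deriv i (\<lambda>x. f x + g x) differentiable at x" for i x
      unfolding p1 by (intro differentiable_add df dg)
    show "continuous_on UNIV (partial_deriv i (partial_deriv j (\<lambda>x. f x + g x)))" for i j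
      unfolding p2 by (intro continuous_on_add continuous_on_mult C2_D(3,4,5)[OF f] C2_D(3,4,5)[OF g])
  qed
qed

lemma partial_deriv_const: "partial_deriv i (\<lambda>x. c :: real) = (\<lambda>x. 0)"
  by (rule ext, subst partial_deriv_eq[OF has_derivative_const]) simp

lemma C2_const: "C2 (\<lambda>x::real^'n::finite. c)"
  by (simp add: C2_def partial_deriv_const)

lemma C2_nth: "C2 (\<lambda>x::real^'n::finite. x $ k)"
proof -
  have "partial_deriv i (\<lambda>x::real^'n. x $ k) = (\<lambda>x. axis i 1 $ k)" for i
    by (rule ext, rule partial_deriv_eq, rule bounded_linear_imp_has_derivative,
        rule bounded_linear_vec_nth)
  then show ?thesis
    by (auto simp: C2_def partial_deriv_const
        intro: bounded_linear_imp_differentiable bounded_linear_vec_nth)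
qed

section \<open>The Fubini--Study metric in an affine chart\<close>

definition rho :: "real^4 \<Rightarrow> real" where
  "rho x = 1 + x \<bullet> x"

text \<open>
  Multiplication by \<open>\<i>\<close> on \<open>\<complex>\<^sup>2 = \<real>\<^sup>4\<close>; up to scale this is the component of the coordinate
  vectors along the Hopf fibre.
\<close>
definition mult_i :: "real^4 \<Rightarrow> real^4" where
  "mult_i x = (\<chi> i. if i = 1 then - x $ 2 else if i = 2 then x $ 1 else if i = 3 then - x $ 4 else x $ 3)"

text \<open>
  The constant partial derivatives of \<open>affine_vec j\<close>.
\<close>
definition chart_frame :: "3 \<Rightarrow> 4 \<Rightarrow> complex^3" where
  "chart_frame j a = (if a = 1 then axis (j + 1) 1 else if a = 2 then axis (j + 1) \<i>
                      else if a = 3 then axis (j + 2) 1 else axis (j + 2) \<i>)"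

lemma rho_pos: "rho x > 0"
  by (simp add: rho_def add_pos_nonneg)

lemma rho_expand: "rho x = 1 + (x$1)^2 + (x$2)^2 + (x$3)^2 + (x$4)^2"
  by (simp add: rho_def inner_vec_def sum_4 power2_eq_square)

lemma affine_vec_frame: "affine_vec j x = axis j 1 + (\<Sum>a\<in>UNIV. x $ a *\<^sub>R chart_frame j a)"
proof -
  have cases3: "i = j \<or> i = j + 1 \<or> i = j + 2" for i :: 3
    using exhaust_3[of i] exhaust_3[of j] by auto
  have dist: "j + 1 \<noteq> j" "j + 2 \<noteq> j" "j + 2 \<noteq> j + 1"
    by simp_all
  show ?thesis
    unfolding vec_eq_iff
  proof
    fix i show "affine_vec j x $ i = (axis j 1 + (\<Sum>a\<in>UNIV. x $ a *\<^sub>R chart_frame j a)) $ i"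
      using cases3[of i] dist
      by (auto simp: affine_vec_def chart_frame_def sum_4 axis_def complex_eq_iff)
  qed
qed

lemma inner_chart_frame:
  "chart_frame j a \<bullet> chart_frame j b = (if a = b then 1 else 0)"
  using exhaust_4[of a] exhaust_4[of b]
  by (auto simp: chart_frame_def inner_axis_axis)

lemma inner_i_chart_frame:
  "chart_frame j a \<bullet> (\<i> *s affine_vec j x) = mult_i x $ a"
  "chart_frame j a \<bullet> affine_vec j x = x $ a"
  using exhaust_4[of a] 
  by (auto simp: chart_frame_def inner_axis' affine_vec_def mult_i_def)

lemma affine_vec_inner: "affine_vec j x \<bullet> affine_vec j x = rho x"
proof -
  have 1: "axis j 1 \<bullet> affine_vec j x = 1"
    by (auto simp: inner_axis' affine_vec_def)
  have "affine_vec j x \<bullet> affine_vec j x = axis j 1 \<bullet> affine_vec j x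
     + (\<Sum>a\<in>UNIV. x $ a * (chart_frame j a \<bullet> affine_vec j x))"
    by (subst (1) affine_vec_frame) (simp add: inner_left_distrib inner_sum_left)
  then show ?thesis
    by (simp add: 1 inner_i_chart_frame rho_def inner_vec_def[of x])
qed

lemma norm_affine_vec: "norm (affine_vec j x) = sqrt (rho x)"
  by (simp add: norm_eq_sqrt_inner affine_vec_inner)

lemma hopf_section_partial:
  "partial_deriv a (hopf_section j) x =
     (1 / sqrt (rho x)) *\<^sub>R chart_frame j a - (x $ a / (rho x * sqrt (rho x))) *\<^sub>R affine_vec j x"
proof -
  have 1: "hopf_section j = (\<lambda>x. (1 / sqrt (rho x)) *\<^sub>R (axis j 1 + (\<Sum>a\<in>UNIV. x $ a *\<^sub>R chart_frame j a)))"
    by (rule ext) (simp add: hopf_section_def norm_affine_vec divide_inverse flip: affine_vec_frame)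
  have nth: "((\<lambda>x. x $ k) has_derivative (\<lambda>h. h $ k)) (at x)" for k and x :: "real^4"
    by (rule bounded_linear_imp_has_derivative, rule bounded_linear_vec_nth)
  have r: "rho x \<noteq> 0" "rho x > 0" "sqrt (rho x) \<noteq> 0" using rho_pos[of x] by auto
  have "(rho has_derivative (\<lambda>h. 2 * (x \<bullet> h))) (at x)"
    unfolding rho_def[abs_def] by (auto intro!: derivative_eq_intros simp: inner_commute)
  then have 2: "((\<lambda>x. 1 / sqrt (rho x)) has_derivative (\<lambda>h. - (x \<bullet> h) / (rho x * sqrt (rho x)))) (at x)"
    using r by (auto intro!: derivative_eq_intros simp: field_simps)
  have 3: "((\<lambda>x. axis j 1 + (\<Sum>a\<in>UNIV. x $ a *\<^sub>R chart_frame j a)) has_derivative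
      (\<lambda>h. \<Sum>a\<in>UNIV. h $ a *\<^sub>R chart_frame j a)) (at x)"
    by (auto intro!: derivative_eq_intros nth)
  have 4: "(\<Sum>b\<in>UNIV. (axis a 1 :: real^4) $ b *\<^sub>R chart_frame j b) = chart_frame j a"
    by (simp add: axis_def if_distrib[of "\<lambda>c. c *\<^sub>R _"] cong: if_cong)
  show ?thesis
    unfolding 1
    by (subst partial_deriv_eq[OF has_derivative_scaleR[OF 2 3]])
       (simp add: 4 inner_axis flip: affine_vec_frame)
qed

lemma inner_i_self: "(z::complex^'n::finite) \<bullet> (\<i> *s z) = 0"
  by (simp add: inner_vec_def inner_complex_def)

lemma inner_i_i: "(\<i> *s z::complex^'n::finite) \<bullet> (\<i> *s w) = z \<bullet> w"
  by (simp add: inner_vec_def inner_complex_def algebra_simps)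

lemma i_smult_scaleR: "\<i> *s (c *\<^sub>R z) = c *\<^sub>R (\<i> *s z :: complex^'n::finite)"
  by (simp add: vec_eq_iff)

lemma inner_horizontal_part:
  assumes "norm s = 1"
  shows "horizontal_part s v \<bullet> horizontal_part s w = v \<bullet> w - (v \<bullet> (\<i> *s s)) * (w \<bullet> (\<i> *s s))"
proof -
  have "(\<i> *s s) \<bullet> (\<i> *s s) = 1"
    using assms by (simp add: inner_i_i norm_eq_1)
  then show ?thesis
    by (simp add: horizontal_part_def inner_diff_left inner_diff_right inner_commute)
qed

text \<open>
  The term in \<open>x\<close> comes from normalizing the affine vector, the term in \<open>mult_i x\<close> from removing the
  vertical component.  The result is independent of the chart.
\<close>
lemma fubini_study_eq:
  "fubini_study j x $ a $ b =
     ((if a = b then rho x else 0) - x $ a * x $ b - mult_i x $ a * mult_i x $ b) / (rho x)^2"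
proof -
  have r: "rho x > 0" "sqrt (rho x) \<noteq> 0" "sqrt (rho x) * sqrt (rho x) = rho x" "sqrt (rho x) * (sqrt (rho x) * c) = rho x * c" for c
    using rho_pos[of x] by (auto simp flip: mult.assoc)
  have s: "hopf_section j x = (1 / sqrt (rho x)) *\<^sub>R affine_vec j x"
    by (simp add: hopf_section_def norm_affine_vec divide_inverse)
  have v: "partial_deriv a (hopf_section j) x \<bullet> (\<i> *s hopf_section j x) = mult_i x $ a / rho x" for a
    unfolding hopf_section_partial s i_smult_scaleR using r
    by (simp add: inner_diff_left inner_i_self inner_i_chart_frame field_simps)
  have h: "partial_deriv a (hopf_section j) x \<bullet> partial_deriv b (hopf_section j) x
     = (if a = b then 1 else 0) / rho x - x $ a * x $ b / (rho x)^2"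
    unfolding hopf_section_partial using r
    by (simp add: inner_diff_left inner_diff_right inner_i_chart_frame inner_chart_frame
         affine_vec_inner inner_commute[of "affine_vec j x"] field_simps power2_eq_square)
  show ?thesis
    unfolding fubini_study_def
    using r by (simp add: inner_horizontal_part[OF norm_hopf_section] v h)
       (simp add: field_simps power2_eq_square)
qed

lemma det_4:
  "det (A::'a::comm_ring_1^4^4) =
    A$1$1 * (A$2$2 * A$3$3 * A$4$4 + A$2$3 * A$3$4 * A$4$2 + A$2$4 * A$3$2 * A$4$3
            - A$2$2 * A$3$4 * A$4$3 - A$2$3 * A$3$2 * A$4$4 - A$2$4 * A$3$3 * A$4$2)
  - A$1$2 * (A$2$1 * A$3$3 * A$4$4 + A$2$3 * A$3$4 * A$4$1 + A$2$4 * A$3$1 * A$4$3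
            - A$2$1 * A$3$4 * A$4$3 - A$2$3 * A$3$1 * A$4$4 - A$2$4 * A$3$3 * A$4$1)
  + A$1$3 * (A$2$1 * A$3$2 * A$4$4 + A$2$2 * A$3$4 * A$4$1 + A$2$4 * A$3$1 * A$4$2
            - A$2$1 * A$3$4 * A$4$2 - A$2$2 * A$3$1 * A$4$4 - A$2$4 * A$3$2 * A$4$1)
  - A$1$4 * (A$2$1 * A$3$2 * A$4$3 + A$2$2 * A$3$3 * A$4$1 + A$2$3 * A$3$1 * A$4$2
            - A$2$1 * A$3$3 * A$4$2 - A$2$2 * A$3$1 * A$4$3 - A$2$3 * A$3$2 * A$4$1)"
proof -
  have f1: "finite {2::4, 3, 4}" "1 \<notin> {2::4, 3, 4}" by auto
  have f2: "finite {3::4, 4}" "2 \<notin> {3::4, 4}" by auto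
  have f3: "finite {4::4}" "3 \<notin> {4::4}" by auto
  show ?thesis
    unfolding det_def UNIV_4
    unfolding sum_over_permutations_insert[OF f1]
    unfolding sum_over_permutations_insert[OF f2]
    unfolding sum_over_permutations_insert[OF f3]
    unfolding permutes_sing
    by (simp add: sign_swap_id permutation_swap_id sign_compose sign_id swap_id_eq
        permutation_compose algebra_simps)
qed

text \<open>
  Since \<open>x\<close> and \<open>mult_i x\<close> are orthogonal of the same length, the eigenvalues of the metric are
  \<open>1 / rho\<close> and \<open>1 / rho\<^sup>2\<close>, each with multiplicity two.
\<close>
lemma det_fubini_study: "det (fubini_study j x) = 1 / (rho x)^6"
proof -
  define M :: "real^4^4" where
    "M = (\<chi> a b. (if a = b then rho x else 0) - x $ a * x $ b - mult_i x $ a * mult_i x $ b)"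
  have "det M = (rho x)^2"
    unfolding det_4 by (simp add: M_def mult_i_def rho_expand) algebra
  moreover have "fubini_study j x = (\<chi> a b. inverse ((rho x)^2) * (M $ a $ b))"
    by (simp add: vec_eq_iff fubini_study_eq M_def divide_inverse mult.commute)
  then have "det (fubini_study j x) = inverse ((rho x)^2) ^ 4 * det M"
    unfolding det_4 by (simp add: algebra_simps power4_eq_xxxx)
  ultimately show ?thesis
    using rho_pos[of x] by (simp add: field_simps eval_nat_numeral)
qed

lemma sqrt_det_fubini_study: "sqrt (det (fubini_study j x)) = 1 / (rho x)^3"
proof -
  have "1 / (rho x)^6 = (1 / (rho x)^3)^2" by (simp add: power_divide flip: power_mult)
  then show ?thesis
    using rho_pos[of x] by (simp add: det_fubini_study real_sqrt_unique)
qed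

text \<open>
  Both rank-one terms are multiples of projections onto orthogonal lines, so the inverse has the
  same form.
\<close>
lemma matrix_inv_fubini_study:
  "matrix_inv (fubini_study j x) =
     (\<chi> a b. rho x * ((if a = b then 1 else 0) + x $ a * x $ b + mult_i x $ a * mult_i x $ b))"
    (is "_ = ?B")
proof -
  define M :: "real^4^4" where
    "M = (\<chi> a b. (if a = b then rho x else 0) - x $ a * x $ b - mult_i x $ a * mult_i x $ b)"
  define N :: "real^4^4" where
    "N = (\<chi> a b. (if a = b then 1 else 0) + x $ a * x $ b + mult_i x $ a * mult_i x $ b)"
  have MN: "(M ** N) $ a $ b = (if a = b then rho x else 0)" for a b
    using exhaust_4[of a] exhaust_4[of b]
    by (elim disjE) (simp_all add: M_def N_def matrix_matrix_mult_def sum_4 mult_i_def rho_expand power2_eq_square algebra_simps)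
  have "fubini_study j x ** ?B = mat 1"
  proof -
    have "(fubini_study j x ** ?B) $ a $ b = (1 / rho x) * (M ** N) $ a $ b" for a b
      using rho_pos[of x]
      by (simp add: matrix_matrix_mult_def sum_distrib_left M_def N_def fubini_study_eq)
         (rule sum.cong; simp add: field_simps power2_eq_square)
    then show ?thesis
      unfolding MN using rho_pos[of x] by (auto simp: vec_eq_iff mat_def)
  qed
  then have inv: "?B ** fubini_study j x = mat 1" "fubini_study j x ** ?B = mat 1"
    using matrix_left_right_inverse by blast+
  have "fubini_study j x ** matrix_inv (fubini_study j x) = mat 1 \<and>
      matrix_inv (fubini_study j x) ** fubini_study j x = mat 1"
    unfolding matrix_inv_def by (rule someI[of _ ?B]) (use inv in blast)
  then have "?B ** (fubini_study j x ** matrix_inv (fubini_study j x)) = ?B" 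
    by (simp only: matrix_mul_rid)
  then show ?thesis
    by (simp only: matrix_mul_assoc inv(1) matrix_mul_lid)
qed

section \<open>The Laplacian of functions of the quadric ratio\<close>

lemmas power_expand = power_numeral_even power_numeral_odd Let_def

lemma axis_component: "(axis i c :: 'a::zero^'n) $ k = (if k = i then c else 0)"
  by (simp add: axis_def)

text \<open>
  Real and imaginary part of the quadratic form \<open>z\<^sub>1\<^sup>2 + z\<^sub>2\<^sup>2 + z\<^sub>3\<^sup>2\<close> at \<open>affine_vec j x\<close>.
\<close>
definition form_re :: "real^4 \<Rightarrow> real" where
  "form_re x = 1 + (x$1)^2 - (x$2)^2 + (x$3)^2 - (x$4)^2"

definition form_im :: "real^4 \<Rightarrow> real" where
  "form_im x = 2 * (x$1 * x$2 + x$3 * x$4)"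

text \<open>
  The parameter of the cohomogeneity one action: it is \<open>0\<close> on the quadric \<open>z\<^sub>1\<^sup>2 + z\<^sub>2\<^sup>2 + z\<^sub>3\<^sup>2 = 0\<close> and
  \<open>1\<close> on the real projective plane.
\<close>
definition quadric_ratio :: "complex^3 \<Rightarrow> real" where
  "quadric_ratio z = (cmod (\<Sum>i\<in>UNIV. (z $ i)^2))^2 / (norm z)^4"

lemma sum_squares_affine_vec: "(\<Sum>i\<in>UNIV. (affine_vec j x $ i)^2) = Complex (form_re x) (form_im x)"
proof -
  have "(\<Sum>i\<in>UNIV. (affine_vec j x $ i)^2) = 1 + (Complex (x $ 1) (x $ 2))^2 + (Complex (x $ 3) (x $ 4))^2"
    using exhaust_3[of j] by (auto simp: sum_3 affine_vec_def)
  then show ?thesis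
    by (simp add: complex_eq_iff form_re_def form_im_def power2_eq_square)
qed

lemma quadric_ratio_affine: "quadric_ratio (affine_vec j x) = ((form_re x)^2 + (form_im x)^2) / (rho x)^2"
proof -
  have "(norm (affine_vec j x))^4 = ((norm (affine_vec j x))^2)^2" by (simp flip: power_mult)
  also have "\<dots> = (rho x)^2" using rho_pos[of x] by (simp add: norm_affine_vec)
  finally show ?thesis
    by (simp add: quadric_ratio_def sum_squares_affine_vec cmod_def)
qed

lemma quadric_ratio_range: "quadric_ratio z \<in> {0..1}"
proof -
  have "cmod (\<Sum>i\<in>UNIV. (z $ i)^2) \<le> (\<Sum>i\<in>UNIV. (cmod (z $ i))^2)"
    by (rule order_trans[OF norm_sum]) (simp add: norm_power)
  also have "\<dots> = (norm z)^2"
    by (simp add: norm_vec_def L2_set_def sum_nonneg)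
  finally have "(cmod (\<Sum>i\<in>UNIV. (z $ i)^2))^2 \<le> ((norm z)^2)^2"
    by (intro power_mono) auto
  then show ?thesis
    by (auto simp: quadric_ratio_def divide_le_eq_1 simp flip: power_mult)
qed

lemma C2_ratio: "C2 (\<lambda>x. quadric_ratio (affine_vec j x))"
proof -
  have diff: "C2 (\<lambda>x. f x - g x)" if "C2 f" "C2 g" for f g :: "real^4 \<Rightarrow> real"
    using C2_add[OF that(1) C2_mult[OF C2_const[of "-1"] that(2)]] by simp
  have sq: "C2 (\<lambda>x. (f x)^2)" if "C2 f" for f :: "real^4 \<Rightarrow> real"
    using C2_mult[OF that that] by (simp add: power2_eq_square)
  have rho: "C2 rho"
    unfolding rho_expand[abs_def] by (intro C2_add C2_const sq C2_nth)
  have inv: "C2 (\<lambda>x. inverse (rho x))"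
  proof (rule C2_compose[OF rho, where S="{0<..}" and U=inverse and U'="\<lambda>y. - ((inverse y)^2)" and U''="\<lambda>y. 2 * (inverse y)^3"])
    show "range rho \<subseteq> {0<..}" using rho_pos by auto
  qed (auto intro!: derivative_eq_intros continuous_intros simp: power2_eq_square power3_eq_cube)
  have "C2 form_re" "C2 form_im"
    unfolding form_re_def[abs_def] form_im_def[abs_def]
    by (intro diff C2_add C2_mult C2_const sq C2_nth)+
  then have "C2 (\<lambda>x. ((form_re x)^2 + (form_im x)^2) * (inverse (rho x))^2)"
    by (intro C2_add C2_mult sq inv)
  then show ?thesis
    by (simp add: quadric_ratio_affine divide_inverse power_inverse)
qed

text \<open>
  The Euclidean gradient of the quadric ratio in an affine chart; see \<open>partial_ratio\<close>.
\<close>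
definition ratio_grad :: "real^4 \<Rightarrow> real^4" where
  "ratio_grad x = (\<chi> i. (4 * rho x *
       (if i = 1 then form_re x * x$1 + form_im x * x$2 else if i = 2 then form_im x * x$1 - form_re x * x$2
        else if i = 3 then form_re x * x$3 + form_im x * x$4 else form_im x * x$3 - form_re x * x$4)
      - 4 * ((form_re x)^2 + (form_im x)^2) * x $ i) / (rho x)^3)"

text \<open>
  The vector field \<open>sqrt (det g) g\<^sup>-\<^sup>1 \<nabla>h\<close>; see \<open>flux_eq\<close>.  In each component one of the two parts of the
  form cancels, which makes its divergence easy to compute.
\<close>
definition ratio_flux :: "real^4 \<Rightarrow> real^4" where
  "ratio_flux x = (\<chi> i. 8 * (if i = 1 then form_im x * x$2 else if i = 2 then - form_re x * x$2
        else if i = 3 then form_im x * x$4 else - form_re x * x$4) / (rho x)^4)"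

lemma has_derivative_nth: "((\<lambda>x::real^'n. x $ k) has_derivative (\<lambda>h. h $ k)) (at x)"
  by (rule bounded_linear_imp_has_derivative, rule bounded_linear_vec_nth)

lemma has_derivative_form_re:
  "(form_re has_derivative (\<lambda>h. 2 * (x$1 * h$1 - x$2 * h$2 + x$3 * h$3 - x$4 * h$4))) (at x)"
  unfolding form_re_def[abs_def]
  by (auto intro!: derivative_eq_intros has_derivative_nth simp: algebra_simps)

lemma has_derivative_form_im:
  "(form_im has_derivative (\<lambda>h. 2 * (x$1 * h$2 + x$2 * h$1 + x$3 * h$4 + x$4 * h$3))) (at x)"
  unfolding form_im_def[abs_def]
  by (auto intro!: derivative_eq_intros has_derivative_nth simp: algebra_simps)

lemma has_derivative_rho: "(rho has_derivative (\<lambda>h. 2 * (x \<bullet> h))) (at x)"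
  unfolding rho_def[abs_def] by (auto intro!: derivative_eq_intros simp: inner_commute)

lemma partial_ratio: "partial_deriv i (\<lambda>x. quadric_ratio (affine_vec j x)) x = ratio_grad x $ i"
proof -
  have r: "rho x \<noteq> 0" using rho_pos[of x] by simp
  have "((\<lambda>x. ((form_re x)^2 + (form_im x)^2) / (rho x)^2) has_derivative
     (\<lambda>h. ((2 * form_re x * (2 * (x$1 * h$1 - x$2 * h$2 + x$3 * h$3 - x$4 * h$4))
          + 2 * form_im x * (2 * (x$1 * h$2 + x$2 * h$1 + x$3 * h$4 + x$4 * h$3))) * rho x
          - ((form_re x)^2 + (form_im x)^2) * 2 * (2 * (x \<bullet> h))) / (rho x)^3)) (at x)"
    apply (rule has_derivative_eq_rhs)
     apply (rule derivative_intros has_derivative_form_re has_derivative_form_im has_derivative_rho | simp add: r)+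
    using r by (intro ext) (simp add: divide_simps, simp add: power_expand algebra_simps)
  from partial_deriv_eq[OF this] show ?thesis
    unfolding quadric_ratio_affine ratio_grad_def
    using exhaust_4[of i] by (auto simp: inner_axis axis_component algebra_simps)
qed

text \<open>
  The inverse metric sees the gradient only through itself and through its components along \<open>x\<close> and
  \<open>mult_i x\<close>.  These are the Euler derivative and the derivative of the rotation
  \<open>w \<mapsto> e\<^sup>i\<^sup>t w\<close>, both of which are simple on the quadratic form.
\<close>
lemma sums_ratio_grad:
  "(\<Sum>i\<in>UNIV. x $ i * ratio_grad x $ i) = 4 * ((form_re x)^2 + (form_im x)^2 - form_re x * rho x) / (rho x)^3"
  "(\<Sum>i\<in>UNIV. mult_i x $ i * ratio_grad x $ i) = - 4 * form_im x / (rho x)^2"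
proof -
  have r: "rho x \<noteq> 0" using rho_pos[of x] by simp
  define n where "n = (form_re x)^2 + (form_im x)^2"
  have c: "(x$1)^2 - (x$2)^2 + (x$3)^2 - (x$4)^2 = form_re x - 1" 
    "x$1 * x$2 + x$3 * x$4 = form_im x / 2" 
    "(x$1)^2 + (x$2)^2 + (x$3)^2 + (x$4)^2 = rho x - 1"
    by (simp_all add: form_re_def form_im_def rho_expand)
  have "(\<Sum>i\<in>UNIV. x $ i * ratio_grad x $ i) =
    (4 * rho x * (form_re x * ((x$1)^2 - (x$2)^2 + (x$3)^2 - (x$4)^2) + 2 * form_im x * (x$1 * x$2 + x$3 * x$4))
     - 4 * n * ((x$1)^2 + (x$2)^2 + (x$3)^2 + (x$4)^2)) / (rho x)^3"
    unfolding n_def[symmetric] ratio_grad_def sum_4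
    by (simp add: power2_eq_square algebra_simps diff_divide_distrib add_divide_distrib)
  also have "\<dots> = 4 * (n - form_re x * rho x) / (rho x)^3"
    unfolding c n_def by (simp add: power2_eq_square algebra_simps)
  finally show "(\<Sum>i\<in>UNIV. x $ i * ratio_grad x $ i) = 4 * ((form_re x)^2 + (form_im x)^2 - form_re x * rho x) / (rho x)^3"
    by (simp add: n_def)
  have "(\<Sum>i\<in>UNIV. mult_i x $ i * ratio_grad x $ i) =
    4 * rho x * (form_im x * ((x$1)^2 - (x$2)^2 + (x$3)^2 - (x$4)^2) - 2 * form_re x * (x$1 * x$2 + x$3 * x$4)) / (rho x)^3"
    unfolding n_def[symmetric] ratio_grad_def sum_4 mult_i_def
    by (simp add: power2_eq_square algebra_simps diff_divide_distrib add_divide_distrib)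
  also have "\<dots> = - 4 * form_im x / (rho x)^2"
    unfolding c using r by (simp add: power2_eq_square power3_eq_cube algebra_simps)
  finally show "(\<Sum>i\<in>UNIV. mult_i x $ i * ratio_grad x $ i) = - 4 * form_im x / (rho x)^2" .
qed

lemma flux_eq:
  "sqrt (det (fubini_study j x)) * (\<Sum>k\<in>UNIV. matrix_inv (fubini_study j x) $ i $ k * ratio_grad x $ k)
   = ratio_flux x $ i"
proof -
  have r: "rho x \<noteq> 0" using rho_pos[of x] by simp
  have "(\<Sum>k\<in>UNIV. matrix_inv (fubini_study j x) $ i $ k * ratio_grad x $ k)
     = (\<Sum>k\<in>UNIV. rho x * ((if i = k then ratio_grad x $ k else 0) + x $ i * (x $ k * ratio_grad x $ k)
          + mult_i x $ i * (mult_i x $ k * ratio_grad x $ k)))"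
    unfolding matrix_inv_fubini_study by (intro sum.cong) (auto simp: algebra_simps)
  also have "\<dots> = rho x * (ratio_grad x $ i + x $ i * (\<Sum>k\<in>UNIV. x $ k * ratio_grad x $ k)
         + mult_i x $ i * (\<Sum>k\<in>UNIV. mult_i x $ k * ratio_grad x $ k))"
    by (simp add: sum.distrib sum_distrib_left[symmetric])
  finally have *: "(\<Sum>k\<in>UNIV. matrix_inv (fubini_study j x) $ i $ k * ratio_grad x $ k) = \<dots>" .
  show ?thesis
    unfolding * sums_ratio_grad sqrt_det_fubini_study
    using exhaust_4[of i] r
    by (elim disjE) (simp_all add: ratio_grad_def ratio_flux_def mult_i_def divide_simps,
       simp_all add: power_expand algebra_simps)
qed

lemma flux_differentiable: "(\<lambda>x. ratio_flux x $ i) differentiable (at x)"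
  and div_flux: "(\<Sum>i\<in>UNIV. partial_deriv i (\<lambda>x. ratio_flux x $ i) x) =
     16 * (1 - 2 * quadric_ratio (affine_vec j x)) / (rho x)^3"
proof -
  have r: "rho x \<noteq> 0" using rho_pos[of x] by simp
  have gen: "((\<lambda>x. 8 * (f x * x $ k) / (rho x)^4) has_derivative
     (\<lambda>h. 8 * (f' h * x$k + f x * h$k) / (rho x)^4 - 64 * (x \<bullet> h) * f x * x$k / (rho x)^5)) (at x)"
    if "(f has_derivative f') (at x)" for f f' k
    apply (rule has_derivative_eq_rhs)
     apply (rule derivative_intros that has_derivative_nth has_derivative_rho | simp add: r)+
    using r by (intro ext) (simp add: divide_simps, simp add: power_expand algebra_simps)
  note g_im = gen[OF has_derivative_form_im] and g_re = gen[OF has_derivative_minus[OF has_derivative_form_re]]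
  have fl: "(\<lambda>x. ratio_flux x $ 1) = (\<lambda>x. 8 * (form_im x * x $ 2) / (rho x)^4)"
    "(\<lambda>x. ratio_flux x $ 2) = (\<lambda>x. 8 * (- form_re x * x $ 2) / (rho x)^4)"
    "(\<lambda>x. ratio_flux x $ 3) = (\<lambda>x. 8 * (form_im x * x $ 4) / (rho x)^4)"
    "(\<lambda>x. ratio_flux x $ 4) = (\<lambda>x. 8 * (- form_re x * x $ 4) / (rho x)^4)"
    by (simp_all add: ratio_flux_def fun_eq_iff)
  have "(\<lambda>x. ratio_flux x $ 1) differentiable (at x)" "(\<lambda>x. ratio_flux x $ 3) differentiable (at x)"
    unfolding fl differentiable_def by (rule exI, rule g_im)+
  moreover have "(\<lambda>x. ratio_flux x $ 2) differentiable (at x)" "(\<lambda>x. ratio_flux x $ 4) differentiable (at x)"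
    unfolding fl differentiable_def by (rule exI, rule g_re)+
  ultimately show "(\<lambda>x. ratio_flux x $ i) differentiable (at x)"
    using exhaust_4[of i] by auto
  have dv: "(\<Sum>i\<in>UNIV. partial_deriv i (\<lambda>x. ratio_flux x $ i) x) =
      8 * (4 * ((x$2)^2 + (x$4)^2) - 2 * form_re x) / (rho x)^4
     - 64 * (form_im x * (x$1 * x$2 + x$3 * x$4) - form_re x * ((x$2)^2 + (x$4)^2)) / (rho x)^5"
    unfolding sum_4 fl partial_deriv_eq[OF g_im] partial_deriv_eq[OF g_re]
    by (simp add: inner_axis axis_component) (simp add: power2_eq_square algebra_simps diff_divide_distrib add_divide_distrib)
  have c: "x$1 * x$2 + x$3 * x$4 = form_im x / 2" "(x$2)^2 + (x$4)^2 = (rho x - form_re x) / 2"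
    by (simp_all add: form_re_def form_im_def rho_expand)
  show "(\<Sum>i\<in>UNIV. partial_deriv i (\<lambda>x. ratio_flux x $ i) x) =
     16 * (1 - 2 * quadric_ratio (affine_vec j x)) / (rho x)^3"
    unfolding dv c quadric_ratio_affine using r
    by (simp add: divide_simps) (simp add: power_expand algebra_simps)
qed

lemma grad_flux:
  "(\<Sum>i\<in>UNIV. ratio_grad x $ i * ratio_flux x $ i) =
     16 * quadric_ratio (affine_vec j x) * (1 - quadric_ratio (affine_vec j x)) / (rho x)^3"
proof -
  have r: "rho x \<noteq> 0" using rho_pos[of x] by simp
  define n where "n = (form_re x)^2 + (form_im x)^2"
  have c: "x$1 * x$2 + x$3 * x$4 = form_im x / 2" "(x$2)^2 + (x$4)^2 = (rho x - form_re x) / 2"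
    by (simp_all add: form_re_def form_im_def rho_expand)
  have "(\<Sum>i\<in>UNIV. ratio_grad x $ i * ratio_flux x $ i) =
     8 * (4 * rho x * ((form_im x)^2 + (form_re x)^2) * ((x$2)^2 + (x$4)^2)
        - 4 * n * (form_im x * (x$1 * x$2 + x$3 * x$4) - form_re x * ((x$2)^2 + (x$4)^2))) / (rho x)^7"
    unfolding n_def[symmetric] ratio_grad_def ratio_flux_def sum_4 using r
    by (simp add: divide_simps) (simp add: power_expand algebra_simps)
  also have "\<dots> = 16 * (n / (rho x)^2) * (1 - n / (rho x)^2) / (rho x)^3"
    unfolding c n_def using r
    by (simp add: divide_simps) (simp add: power_expand algebra_simps)
  finally show ?thesis by (simp add: n_def quadric_ratio_affine)
qed

text \<open>
  By the product rule the Laplacian of \<open>U \<circ> h\<close> is \<open>U'' \<bar>\<nabla>h\<bar>\<^sup>2 + U' \<Delta>h\<close>; here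
  \<open>\<bar>\<nabla>h\<bar>\<^sup>2 = 16 h (1 - h)\<close> (\<open>grad_flux\<close>) and \<open>\<Delta>h = 16 (1 - 2 h)\<close> (\<open>div_flux\<close>).
\<close>
lemma laplace_beltrami_ratio:
  assumes U: "\<And>y. y \<in> {0..1} \<Longrightarrow> (U has_real_derivative U1 y) (at y within {0..1})"
    and U1: "\<And>y. y \<in> {0..1} \<Longrightarrow> (U1 has_real_derivative U2 y) (at y within {0..1})"
  shows "laplace_beltrami (fubini_study j) (\<lambda>x. U (quadric_ratio (affine_vec j x))) x =
    (let h = quadric_ratio (affine_vec j x) in 16 * (h * (1 - h) * U2 h + (1 - 2 * h) * U1 h))"
proof -
  let ?H = "\<lambda>x. quadric_ratio (affine_vec j x)"
  have r: "rho x \<noteq> 0" using rho_pos[of x] by simp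
  have rng: "range ?H \<subseteq> {0..1}" using quadric_ratio_range by auto
  have dH: "?H differentiable (at y)" for y using C2_D(1)[OF C2_ratio] .
  have p1: "partial_deriv k (\<lambda>x. U (?H x)) y = U1 (?H y) * ratio_grad y $ k" for k y
    by (simp only: partial_deriv_compose[OF dH rng U[OF quadric_ratio_range]] partial_ratio)
  have flux: "(\<lambda>y. sqrt (det (fubini_study j y)) *
       (\<Sum>k\<in>UNIV. matrix_inv (fubini_study j y) $ i $ k * partial_deriv k (\<lambda>x. U (?H x)) y))
     = (\<lambda>y. U1 (?H y) * ratio_flux y $ i)" for i
    
    unfolding p1 flux_eq[of j, symmetric] by (rule ext) (simp add: sum_distrib_left mult_ac)
  have d1: "(\<lambda>x. U1 (?H x)) differentiable (at x)"
    unfolding differentiable_def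
    using has_derivative_compose_real_within[OF dH rng U1[OF quadric_ratio_range]] by blast
  have p2: "partial_deriv i (\<lambda>y. U1 (?H y) * ratio_flux y $ i) x =
      U1 (?H x) * partial_deriv i (\<lambda>y. ratio_flux y $ i) x + U2 (?H x) * (ratio_grad x $ i * ratio_flux x $ i)" for i
    by (simp add: partial_deriv_mult[OF d1 flux_differentiable] partial_ratio
        partial_deriv_compose[OF dH rng U1[OF quadric_ratio_range]])
  have "laplace_beltrami (fubini_study j) (\<lambda>x. U (?H x)) x =
     (U1 (?H x) * (\<Sum>i\<in>UNIV. partial_deriv i (\<lambda>y. ratio_flux y $ i) x)
      + U2 (?H x) * (\<Sum>i\<in>UNIV. ratio_grad x $ i * ratio_flux x $ i)) * (rho x)^3"
  proof -
    have "laplace_beltrami (fubini_study j) (\<lambda>x. U (?H x)) x =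
        (\<Sum>i\<in>UNIV. partial_deriv i (\<lambda>y. U1 (?H y) * ratio_flux y $ i) x) / sqrt (det (fubini_study j x))"
      by (simp only: laplace_beltrami_def flux)
    then show ?thesis
      unfolding p2 sqrt_det_fubini_study by (simp add: sum.distrib sum_distrib_left)
  qed
  moreover have gen: "(u1 * (16 * (1 - 2 * h) / c ^ 3) + u2 * (16 * h * (1 - h) / c ^ 3)) * c ^ 3
      = 16 * (h * (1 - h) * u2 + (1 - 2 * h) * u1)" if "c \<noteq> 0" for u1 u2 h c :: real
  proof -
    have "(u1 * (16 * (1 - 2 * h) / c ^ 3) + u2 * (16 * h * (1 - h) / c ^ 3)) * c ^ 3
      = u1 * (16 * (1 - 2 * h)) + u2 * (16 * h * (1 - h))" using that by (simp add: distrib_right)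
    then show ?thesis by (simp add: algebra_simps)
  qed
  ultimately show ?thesis
    unfolding div_flux[of x j] grad_flux[of x j] Let_def by (simp only: gen[OF r])
qed

section \<open>Regular solutions of the Legendre-type equation\<close>

text \<open>
  Half of the range of the quadric ratio; the other half is reached by reflection.
\<close>
abbreviation I :: "real set" where "I \<equiv> {0..1/2}"

text \<open>
  A solution \<open>v\<close> of \<open>(x (1 - x) v')' = - g\<close> with its derivative \<open>d\<close>.  Continuity of \<open>d\<close> up to \<open>0\<close>
  excludes the logarithmic solutions at the singular endpoint.  Keeping the right-hand side as an
  arbitrary function allows linear and nonlinear equations, and their differences, to be treated
  together.
\<close>
definition legendre_pair :: "(real \<Rightarrow> real) \<Rightarrow> (real \<Rightarrow> real) \<Rightarrow> (real \<Rightarrow> real) \<Rightarrow> bool" where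
  "legendre_pair v d g \<longleftrightarrow> continuous_on I d \<and> continuous_on I g \<and>
     (\<forall>x\<in>I. (v has_real_derivative d x) (at x within I)) \<and>
     (\<forall>x\<in>I. ((\<lambda>x. x * (1 - x) * d x) has_real_derivative - g x) (at x within I))"

lemma legendre_pairD:
  assumes "legendre_pair v d g"
  shows "continuous_on I d" "continuous_on I g" "continuous_on I v" "continuous_on I (\<lambda>x. x * (1 - x) * d x)"
    "\<And>x. x \<in> I \<Longrightarrow> (v has_real_derivative d x) (at x within I)"
    "\<And>x. x \<in> I \<Longrightarrow> ((\<lambda>x. x * (1 - x) * d x) has_real_derivative - g x) (at x within I)"
proof -
  show *: "continuous_on I d" "continuous_on I g" 
    "\<And>x. x \<in> I \<Longrightarrow> (v has_real_derivative d x) (at x within I)"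
    "\<And>x. x \<in> I \<Longrightarrow> ((\<lambda>x. x * (1 - x) * d x) has_real_derivative - g x) (at x within I)"
    using assms by (auto simp: legendre_pair_def)
  show "continuous_on I v"
    unfolding continuous_on_eq_continuous_within using *(3) DERIV_continuous by blast
  show "continuous_on I (\<lambda>x. x * (1 - x) * d x)"
    by (intro continuous_intros *)
qed

lemma legendre_pair_diff:
  assumes "legendre_pair v d g" "legendre_pair w e h"
  shows "legendre_pair (\<lambda>x. v x - w x) (\<lambda>x. d x - e x) (\<lambda>x. g x - h x)"
  unfolding legendre_pair_def
proof (intro conjI ballI)
  note D = legendre_pairD[OF assms(1)] and E = legendre_pairD[OF assms(2)]
  show "continuous_on I (\<lambda>x. d x - e x)" "continuous_on I (\<lambda>x. g x - h x)"
    by (intro continuous_intros D E)+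
  fix x assume x: "x \<in> I"
  show "((\<lambda>x. v x - w x) has_real_derivative d x - e x) (at x within I)"
    by (intro DERIV_diff D E x)
  have "((\<lambda>x. x * (1 - x) * d x - x * (1 - x) * e x) has_real_derivative - g x - (- h x)) (at x within I)"
    by (intro DERIV_diff D E x)
  then show "((\<lambda>x. x * (1 - x) * (d x - e x)) has_real_derivative - (g x - h x)) (at x within I)"
    by (simp add: right_diff_distrib)
qed

lemma legendre_pair_scale:
  assumes "legendre_pair v d g"
  shows "legendre_pair (\<lambda>x. c * v x) (\<lambda>x. c * d x) (\<lambda>x. c * g x)"
  unfolding legendre_pair_def
proof (intro conjI ballI)
  note D = legendre_pairD[OF assms(1)]
  show "continuous_on I (\<lambda>x. c * d x)" "continuous_on I (\<lambda>x. c * g x)"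
    by (intro continuous_intros D)+
  fix x assume x: "x \<in> I"
  show "((\<lambda>x. c * v x) has_real_derivative c * d x) (at x within I)"
    by (intro DERIV_cmult D x)
  have "((\<lambda>x. c * (x * (1 - x) * d x)) has_real_derivative c * - g x) (at x within I)"
    by (intro DERIV_cmult D x)
  then show "((\<lambda>x. x * (1 - x) * (c * d x)) has_real_derivative - (c * g x)) (at x within I)"
    by (simp add: mult_ac)
qed

lemma legendre_pair_const: "legendre_pair (\<lambda>x. c) (\<lambda>x. 0) (\<lambda>x. 0)"
  by (auto simp: legendre_pair_def)

lemma legendre_pair_cong:
  assumes "legendre_pair v d g" "\<And>x. x \<in> I \<Longrightarrow> g x = h x"
  shows "legendre_pair v d h"
proof -
  have "continuous_on I h" by (rule continuous_on_eq[OF legendre_pairD(2)[OF assms(1)] assms(2)])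
  then show ?thesis using assms by (simp add: legendre_pair_def)
qed

lemma continuous_bounded_I:
  fixes c :: "real \<Rightarrow> real"
  assumes "continuous_on I c"
  shows "\<exists>B. \<forall>y\<in>I. \<bar>c y\<bar> \<le> B"
  using compact_imp_bounded[OF compact_continuous_image[OF assms compact_Icc]]
  by (auto simp: bounded_iff)

lemma mvt_I:
  assumes "\<And>x. x \<in> I \<Longrightarrow> (\<phi> has_real_derivative \<phi>' x) (at x within I)"
    and "0 \<le> a" "a < b" "b \<le> 1/2"
  shows "\<exists>x. a < x \<and> x < b \<and> \<phi> b - \<phi> a = (b - a) * \<phi>' x"
proof -
  have "\<exists>x\<in>{a<..<b}. \<phi> b - \<phi> a = (\<lambda>h. \<phi>' x * h) (b - a)"
  proof (rule mvt_simple[OF \<open>a < b\<close>])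
    fix x assume x: "a \<le> x" "x \<le> b"
    then have "(\<phi> has_real_derivative \<phi>' x) (at x within {a..b})"
      using assms by (intro DERIV_subset[OF assms(1)]) auto
    then show "(\<phi> has_derivative (\<lambda>h. \<phi>' x * h)) (at x within {a..b})"
      by (simp add: has_field_derivative_def)
  qed
  then show ?thesis by (auto simp: mult.commute)
qed

lemma antimono_I:
  assumes "\<And>x. x \<in> I \<Longrightarrow> (\<phi> has_real_derivative \<phi>' x) (at x within I)"
    and "0 \<le> a" "a \<le> b" "b \<le> 1/2"
    and "\<And>x. a < x \<Longrightarrow> x < b \<Longrightarrow> \<phi>' x \<le> 0"
  shows "\<phi> b \<le> \<phi> a"
proof (cases "a = b")
  case False
  with mvt_I[OF assms(1), of a b] assms(2-4)
  obtain x where "a < x" "x < b" "\<phi> b - \<phi> a = (b - a) * \<phi>' x" by auto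
  with assms(5)[of x] False assms(3) show ?thesis
    using mult_nonneg_nonpos[of "b - a" "\<phi>' x"] by linarith
qed simp

lemma mono_I:
  assumes "\<And>x. x \<in> I \<Longrightarrow> (\<phi> has_real_derivative \<phi>' x) (at x within I)"
    and "0 \<le> a" "a \<le> b" "b \<le> 1/2"
    and "\<And>x. a < x \<Longrightarrow> x < b \<Longrightarrow> \<phi>' x \<ge> 0"
  shows "\<phi> a \<le> \<phi> b"
  using antimono_I[of "\<lambda>x. - \<phi> x" "\<lambda>x. - \<phi>' x" a b] assms by (auto intro: DERIV_minus)

text \<open>
  The flux \<open>x (1 - x) d x\<close> vanishes at \<open>0\<close>, hence is of order \<open>x\<close>; dividing by \<open>x (1 - x) \<ge> x / 2\<close>
  shows that the singular coefficient does no harm.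
\<close>
lemma legendre_flux_bound:
  assumes P: "legendre_pair v d g" and x: "x \<in> I"
    and g: "\<And>y. 0 < y \<Longrightarrow> y < x \<Longrightarrow> \<bar>g y\<bar> \<le> M"
  shows "\<bar>x * (1 - x) * d x\<bar> \<le> M * x" "x > 0 \<Longrightarrow> \<bar>d x\<bar> \<le> 2 * M"
proof -
  show *: "\<bar>x * (1 - x) * d x\<bar> \<le> M * x"
  proof (cases "x = 0")
    case False
    then obtain y where y: "0 < y" "y < x" "x * (1 - x) * d x = x * - g y"
      using mvt_I[OF legendre_pairD(6)[OF P], of 0 x] x by auto
    show ?thesis using mult_left_mono[OF g[OF y(1,2)], of x] x unfolding y(3) by (simp add: abs_mult mult.commute)
  qed simp
  assume x0: "x > 0"
  have "\<bar>(1 - x) * d x\<bar> \<le> M"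
    using * x0 by (simp add: abs_mult mult_ac)
  moreover have "\<bar>d x\<bar> * (1/2) \<le> \<bar>d x\<bar> * (1 - x)"
    using x by (intro mult_left_mono) auto
  ultimately show "\<bar>d x\<bar> \<le> 2 * M" using x by (simp add: abs_mult mult.commute)
qed

text \<open>
  The weight \<open>exp (K x)\<close> reproduces itself under integration with the small factor \<open>1 / K\<close>.  This
  provides both the a priori estimate and the contraction below.
\<close>
lemma legendre_growth:
  assumes P: "legendre_pair y d G" and K: "K > 0"
    and G: "\<And>x. x \<in> I \<Longrightarrow> \<bar>G x\<bar> \<le> N * exp (K * x)" and x: "x \<in> I"
  shows "\<bar>y x - y 0\<bar> \<le> 2 * N / K * exp (K * x)"
proof -
  have N: "N \<ge> 0" using G[of 0] by simp
  have d: "\<bar>d x\<bar> \<le> 2 * (N * exp (K * x))" if "0 < x" "x \<le> 1/2" for x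
  proof (rule legendre_flux_bound(2)[OF P])
    fix z assume z: "0 < z" "z < x"
    have "N * exp (K * z) \<le> N * exp (K * x)"
      using z K N by (intro mult_left_mono) auto
    then show "\<bar>G z\<bar> \<le> N * exp (K * x)" using G[of z] that z by auto
  qed (use that in auto)
  have D: "((\<lambda>x. y x + c * exp (K * x)) has_real_derivative d x + c * (K * exp (K * x))) (at x within I)"
    if "x \<in> I" for x c
    by (auto intro!: derivative_eq_intros legendre_pairD(5)[OF P that])
  let ?c = "2 * N / K"
  have "y x + (- ?c) * exp (K * x) \<le> y 0 + (- ?c) * exp (K * 0)"
    by (rule antimono_I[OF D]) (use x K d in \<open>auto simp: abs_le_iff\<close>)
  moreover have "y 0 + ?c * exp (K * 0) \<le> y x + ?c * exp (K * x)"
  proof (rule mono_I[OF D])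
    fix z assume "0 < z" "z < x"
    then show "0 \<le> d z + ?c * (K * exp (K * z))"
      using d[of z] x K by (auto simp: abs_le_iff)
  qed (use x in auto)
  moreover have "?c \<ge> 0" using N K by simp
  ultimately show ?thesis by (simp add: abs_le_iff)
qed

text \<open>
  With \<open>K = 4 L\<close> the growth estimate bounds the maximum of \<open>exp (- K x) \<bar>y x\<bar>\<close> by \<open>\<bar>y 0\<bar>\<close> plus half of
  itself.
\<close>
lemma legendre_stability:
  assumes P: "legendre_pair y d G" and L: "L > 0"
    and G: "\<And>x. x \<in> I \<Longrightarrow> \<bar>G x\<bar> \<le> L * \<bar>y x\<bar>" and x: "x \<in> I"
  shows "\<bar>y x\<bar> \<le> 2 * exp (2 * L) * \<bar>y 0\<bar>"
proof -
  let ?K = "4 * L"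
  have "continuous_on I (\<lambda>x. exp (- ?K * x) * \<bar>y x\<bar>)"
    by (intro continuous_intros legendre_pairD(3)[OF P])
  then obtain z where z: "z \<in> I" and max: "\<And>x. x \<in> I \<Longrightarrow> exp (- ?K * x) * \<bar>y x\<bar> \<le> exp (- ?K * z) * \<bar>y z\<bar>"
    using continuous_attains_sup[of I "\<lambda>x. exp (- ?K * x) * \<bar>y x\<bar>"] by auto
  define M where "M = exp (- ?K * z) * \<bar>y z\<bar>"
  have y: "\<bar>y x\<bar> \<le> M * exp (?K * x)" if "x \<in> I" for x
    using max[OF that] by (simp add: M_def exp_minus field_simps)
  have "\<bar>y z - y 0\<bar> \<le> 2 * (L * M) / ?K * exp (?K * z)"
  proof (rule legendre_growth[OF P _ _ z])
    show "\<bar>G x\<bar> \<le> L * M * exp (?K * x)" if "x \<in> I" for x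
      using order_trans[OF G[OF that] mult_left_mono[OF y[OF that], of L]] L by (simp add: mult.assoc)
  qed (use L in auto)
  also have "2 * (L * M) / ?K * exp (?K * z) = M / 2 * exp (?K * z)" using L by simp
  finally have "\<bar>y z\<bar> \<le> \<bar>y 0\<bar> + M / 2 * exp (?K * z)"
    using abs_triangle_ineq2[of "y z" "y 0"] by linarith
  moreover have yz: "\<bar>y z\<bar> = M * exp (?K * z)" by (simp add: M_def exp_minus)
  ultimately have "M * exp (?K * z) \<le> 2 * \<bar>y 0\<bar>" by simp
  moreover have "M * 1 \<le> M * exp (?K * z)"
    using z L by (intro mult_left_mono) (auto simp: M_def)
  ultimately have M: "M \<le> 2 * \<bar>y 0\<bar>" by simp
  have "\<bar>y x\<bar> \<le> M * exp (?K * x)" by (rule y[OF x])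
  also have "\<dots> \<le> 2 * \<bar>y 0\<bar> * exp (2 * L)"
    using x L M by (intro mult_mono) auto
  finally show ?thesis by (simp add: mult_ac)
qed

text \<open>
  Mean of \<open>g\<close> over \<open>[0, x]\<close>, written as an integral over a fixed interval so that it is defined and
  smooth at \<open>x = 0\<close> as well.
\<close>
definition radial_average :: "(real \<Rightarrow> real) \<Rightarrow> real \<Rightarrow> real" where
  "radial_average g x = integral {0..1} (\<lambda>t. g (x * t))"

lemma continuous_on_dilation:
  assumes "continuous_on I g"
  shows "continuous_on (I \<times> {0..1}) (\<lambda>(x, t). g (x * t))"
proof -
  have "continuous_on (I \<times> {0..1}) (\<lambda>p. g (fst p * snd p))"
  proof (rule continuous_on_compose2[OF assms])
    show "(\<lambda>p. fst p * snd p) ` (I \<times> {0..1}) \<subseteq> I"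
    proof safe
      fix a b :: real assume "a \<in> I" "b \<in> {0..1}"
      then show "fst (a, b) * snd (a, b) \<in> I" using mult_mono[of a "1/2" b 1] by simp
    qed
  qed (intro continuous_intros)
  then show ?thesis by (simp add: case_prod_unfold)
qed

lemma continuous_radial_average:
  assumes "continuous_on I g"
  shows "continuous_on I (radial_average g)"
  unfolding radial_average_def[abs_def]
  using integral_continuous_on_param[of I 0 1 "\<lambda>x t. g (x * t)"] continuous_on_dilation[OF assms] by simp

text \<open>
  Substitution in the integral, via the fundamental theorem of calculus for \<open>t \<mapsto> \<integral>\<^sub>0\<^sup>x\<^sup>t g\<close>.
\<close>
lemma radial_average_eq:
  assumes g: "continuous_on I g" and x: "x \<in> I"
  shows "x * radial_average g x = integral {0..x} g"
proof -
  define A where "A = (\<lambda>x. integral {0..x} g)"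
  have A: "(A has_real_derivative g y) (at y within I)" if "y \<in> I" for y
    unfolding A_def by (rule integral_has_real_derivative[OF g that])
  have sub: "(\<lambda>t. x * t) ` {0..1} \<subseteq> I"
  proof safe
    fix t :: real assume "t \<in> {0..1}"
    then show "x * t \<in> I" using x mult_mono[of x "1/2" t 1] by simp
  qed
  have "((\<lambda>t. A (x * t)) has_real_derivative (x * g (x * t))) (at t within {0..1})" if "t \<in> {0..1}" for t
  proof -
    have A': "(A has_real_derivative g (x * t)) (at (x * t) within (\<lambda>t. x * t) ` {0..1})"
      using sub that by (intro DERIV_subset[OF A]) blast+
    have "((\<lambda>t. x * t) has_real_derivative x) (at t within {0..1})"
      by (auto intro!: derivative_eq_intros)
    from DERIV_image_chain[OF A' this] show ?thesis by (simp add: o_def mult.commute)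
  qed
  then have "((\<lambda>t. x * g (x * t)) has_integral (A (x * 1) - A (x * 0))) {0..1}"
    unfolding has_real_derivative_iff_has_vector_derivative by (intro fundamental_theorem_of_calculus) simp_all
  then have "integral {0..1} (\<lambda>t. x * g (x * t)) = A (x * 1) - A (x * 0)"
    by (rule integral_unique)
  then show ?thesis by (simp add: radial_average_def A_def)
qed

text \<open>
  Integrating the equation once gives \<open>x (1 - x) d x = - \<integral>\<^sub>0\<^sup>x g\<close>; dividing by \<open>x\<close> turns the
  integral into the mean of \<open>g\<close>, which is continuous at \<open>0\<close>.
\<close>
lemma legendre_solve:
  assumes g: "continuous_on I g"
  shows "\<exists>v d. legendre_pair v d g \<and> v 0 = a \<and> (\<forall>x\<in>I. d x = - radial_average g x / (1 - x))"
proof -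
  define d where "d = (\<lambda>x. - radial_average g x / (1 - x))"
  define v where "v = (\<lambda>x. a + integral {0..x} d)"
  have d: "continuous_on I d"
    unfolding d_def by (intro continuous_intros continuous_radial_average g) auto
  have "(v has_real_derivative d x) (at x within I)" if "x \<in> I" for x
    unfolding v_def using DERIV_add[OF DERIV_const integral_has_real_derivative[OF d that]] by simp
  moreover have "((\<lambda>x. x * (1 - x) * d x) has_real_derivative - g x) (at x within I)" if "x \<in> I" for x
  proof (rule has_field_derivative_transform_within[OF _ zero_less_one that])
    show "((\<lambda>x. - integral {0..x} g) has_real_derivative - g x) (at x within I)"
      by (intro DERIV_minus integral_has_real_derivative[OF g that])
    show "- integral {0..y} g = y * (1 - y) * d y" if "y \<in> I" for y
      unfolding radial_average_eq[OF g that, symmetric] using that by (simp add: d_def)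
  qed
  ultimately have "legendre_pair v d g" using d g by (simp add: legendre_pair_def)
  moreover have "v 0 = a" by (simp add: v_def)
  ultimately show ?thesis unfolding d_def by auto
qed

text \<open>
  Banach's fixed point theorem for \<open>w x = exp (- 4 L x) u x\<close>: in this weighted variable the integral
  operator of \<open>legendre_solve\<close> is a contraction with factor \<open>1/2\<close>, by \<open>legendre_growth\<close>.
\<close>
lemma legendre_ivp:
  assumes f: "\<And>s t. \<bar>f s - f t\<bar> \<le> L * \<bar>s - t\<bar>" and L: "L > 0"
  shows "\<exists>u d. legendre_pair u d (\<lambda>x. f (u x)) \<and> u 0 = a"
proof -
  let ?K = "4 * L"
  have fc: "continuous_on S f" for S
  proof (rule lipschitz_on_continuous_on[of L])
    show "L-lipschitz_on S f" using f L by (auto simp: lipschitz_on_def dist_real_def)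
  qed
  define Q where "Q = (\<lambda>(w::real \<Rightarrow>\<^sub>C real) (w'::real \<Rightarrow>\<^sub>C real) y d. legendre_pair y d (\<lambda>x. f (exp (?K * x) * w x)) \<and> y 0 = a \<and>
      (\<forall>x. w' x = exp (- ?K * clamp 0 (1/2) x) * y (clamp 0 (1/2) x)))"
  have "\<exists>w' y d. Q w w' y d" for w
  proof -
    have "continuous_on I (\<lambda>x. f (exp (?K * x) * w x))"
      by (intro continuous_on_compose2[OF fc[of UNIV]] continuous_intros) auto
    from legendre_solve[OF this, of a] obtain y d where
      yd: "legendre_pair y d (\<lambda>x. f (exp (?K * x) * w x))" "y 0 = a" by blast
    have "continuous_on (cbox 0 (1/2)) (\<lambda>x. exp (- ?K * x) * y x)"
      using legendre_pairD(3)[OF yd(1)] by (auto intro!: continuous_intros)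
    then obtain w' :: "real \<Rightarrow>\<^sub>C real"
      where "\<And>x. x \<in> cbox 0 (1/2) \<Longrightarrow> w' x = exp (- ?K * x) * y x"
        "\<And>x. w' x = exp (- ?K * clamp 0 (1/2) x) * y (clamp 0 (1/2) x)"
      by (rule continuous_on_cbox_bcontfunE) (rule that)
    with yd show ?thesis unfolding Q_def by blast
  qed
  then have "\<forall>w. \<exists>w'. \<exists>y d. Q w w' y d" by blast
  from choice[OF this] obtain T where T: "\<And>w. \<exists>y d. Q w (T w) y d" by blast
  have "\<forall>w1 w2. dist (T w1) (T w2) \<le> 1/2 * dist w1 w2"
  proof (intro allI dist_bound)
    fix w1 w2 :: "real \<Rightarrow>\<^sub>C real" and x :: real
    obtain y1 d1 y2 d2 where Q: "Q w1 (T w1) y1 d1" "Q w2 (T w2) y2 d2"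
      using T[of w1] T[of w2] by blast
    let ?D = "dist w1 w2" and ?c = "clamp 0 (1/2) x"
    have c: "?c \<in> I" using clamp_in_interval[of 0 "1/2" x] by auto
    have P: "legendre_pair (\<lambda>x. y1 x - y2 x) (\<lambda>x. d1 x - d2 x) (\<lambda>x. f (exp (?K * x) * w1 x) - f (exp (?K * x) * w2 x))"
      using Q unfolding Q_def by (intro legendre_pair_diff) auto
    have "\<bar>(y1 ?c - y2 ?c) - (y1 0 - y2 0)\<bar> \<le> 2 * (L * ?D) / ?K * exp (?K * ?c)"
    proof (rule legendre_growth[OF P _ _ c])
      fix x
      have "\<bar>f (exp (?K * x) * w1 x) - f (exp (?K * x) * w2 x)\<bar> \<le> L * \<bar>exp (?K * x) * w1 x - exp (?K * x) * w2 x\<bar>"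
        by (rule f)
      also have "\<dots> = L * exp (?K * x) * dist (w1 x) (w2 x)"
        by (simp add: dist_real_def abs_mult flip: right_diff_distrib)
      also have "\<dots> \<le> L * exp (?K * x) * ?D"
        using L by (intro mult_left_mono dist_bounded) auto
      finally show "\<bar>f (exp (?K * x) * w1 x) - f (exp (?K * x) * w2 x)\<bar> \<le> L * ?D * exp (?K * x)"
        by (simp add: mult_ac)
    qed (use L in auto)
    then have "\<bar>y1 ?c - y2 ?c\<bar> \<le> ?D / 2 * exp (?K * ?c)" using Q L by (simp add: Q_def)
    then have "exp (- ?K * ?c) * \<bar>y1 ?c - y2 ?c\<bar> \<le> ?D / 2"
      by (simp add: exp_minus field_simps)
    moreover have "dist (T w1 x) (T w2 x) = exp (- ?K * ?c) * \<bar>y1 ?c - y2 ?c\<bar>"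
      using Q by (simp add: Q_def dist_real_def abs_mult flip: right_diff_distrib)
    ultimately show "dist (T w1 x) (T w2 x) \<le> 1/2 * ?D" by simp
  qed
  then have "\<exists>!w. T w = w" by (intro banach_fix_type[of "1/2"]) auto
  then obtain w where w: "T w = w" by blast
  with T[of w] obtain y d where Q: "Q w w y d" by auto
  have eq: "exp (?K * x) * w x = y x" if "x \<in> I" for x
  proof -
    have "clamp 0 (1/2) x = x" using that by (intro clamp_cancel_cbox) auto
    moreover have "w x = exp (- ?K * clamp 0 (1/2) x) * y (clamp 0 (1/2) x)"
      using Q unfolding Q_def by blast
    ultimately have "w x = exp (- ?K * x) * y x" by simp
    then show ?thesis by (simp add: exp_minus)
  qed
  have P: "legendre_pair y d (\<lambda>x. f (exp (?K * x) * w x))" and y0: "y 0 = a"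
    using Q unfolding Q_def by blast+
  have "legendre_pair y d (\<lambda>x. f (y x))"
    by (rule legendre_pair_cong[OF P]) (simp only: eq)
  with y0 show ?thesis by blast
qed

section \<open>The angle of a solution in the phase plane\<close>

definition amplitude2 :: "(real \<Rightarrow> real) \<Rightarrow> (real \<Rightarrow> real) \<Rightarrow> real \<Rightarrow> real" where
  "amplitude2 v d x = (v x)^2 + (x * (1 - x) * d x)^2"

text \<open>
  The integral of \<open>Im (z' / z)\<close> for \<open>z = v + \<i> p\<close> with \<open>p x = x (1 - x) d x\<close>, i.e. the continuous polar
  angle of \<open>z\<close> that vanishes at \<open>0\<close>.  As an explicit integral it depends continuously on parameters.
\<close>
definition prufer_angle :: "(real \<Rightarrow> real) \<Rightarrow> (real \<Rightarrow> real) \<Rightarrow> (real \<Rightarrow> real) \<Rightarrow> real \<Rightarrow> real" where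
  "prufer_angle v d g x = - integral {0..x} (\<lambda>y. (g y * v y + y * (1 - y) * (d y)^2) / amplitude2 v d y)"

text \<open>
  Uniqueness for the initial value problem at \<open>x\<close>.  Away from \<open>0\<close> the logarithmic derivative of the
  amplitude is bounded, so a zero at \<open>x\<close> propagates to all smaller positive arguments and, by
  continuity of \<open>v\<close>, to \<open>0\<close>.
\<close>
lemma amplitude2_pos:
  assumes P: "legendre_pair v d g" and g: "\<And>x. x \<in> I \<Longrightarrow> \<bar>g x\<bar> \<le> L * \<bar>v x\<bar>"
    and v0: "v 0 \<noteq> 0" and x: "x \<in> I"
  shows "amplitude2 v d x > 0"
proof (rule ccontr)
  let ?E = "amplitude2 v d"
  define p where "p = (\<lambda>y. y * (1 - y) * d y)"
  have E: "?E y = (v y)^2 + (p y)^2" for y by (simp add: amplitude2_def p_def)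
  have Dp: "(p has_real_derivative - g y) (at y within I)" if "y \<in> I" for y
    unfolding p_def by (rule legendre_pairD(6)[OF P that])
  have E0: "?E y \<ge> 0" for y by (simp add: amplitude2_def)
  assume "\<not> ?E x > 0"
  with E0[of x] have Ex: "?E x = 0" by simp
  have "L \<ge> 0" using g[of 0] v0 by (auto simp: zero_le_mult_iff dest: order_trans[OF abs_ge_zero])
  have "x \<noteq> 0" using Ex v0 by (auto simp: amplitude2_def)
  then have x0: "x > 0" using x by simp
  have zero: "v s = 0" if s: "0 < s" "s < x" for s
  proof -
    define C where "C = 2 / s + L"
    let ?E' = "\<lambda>y. 2 * v y * d y - 2 * p y * g y"
    have "((\<lambda>y. ?E y * exp (C * y)) has_real_derivative (?E' y + C * ?E y) * exp (C * y)) (at y within I)"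
      if "y \<in> I" for y
      unfolding E by (auto intro!: derivative_eq_intros legendre_pairD(5)[OF P that] Dp[OF that]) (simp add: algebra_simps)
    then have "?E s * exp (C * s) \<le> ?E x * exp (C * x)"
    proof (rule mono_I)
      fix y assume y: "s < y" "y < x"
      with x s have yI: "y \<in> I" by auto
      have am: "2 * (\<bar>a\<bar> * \<bar>b\<bar>) \<le> a^2 + b^2" for a b :: real
        using zero_le_power2[of "\<bar>a\<bar> - \<bar>b\<bar>"] by (simp add: power2_diff)
      have y1: "y * (1 - y) \<ge> s / 2" using mult_mono[of s y "1/2" "1 - y"] y s x by auto
      have "s / 2 * \<bar>d y\<bar> \<le> y * (1 - y) * \<bar>d y\<bar>"
        using y1 by (intro mult_right_mono) auto
      also have "\<dots> = \<bar>p y\<bar>" using y s x by (simp add: p_def abs_mult)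
      finally have "\<bar>d y\<bar> \<le> 2 / s * \<bar>p y\<bar>" using s by (simp add: field_simps)
      then have "2 * (\<bar>v y\<bar> * \<bar>d y\<bar>) \<le> 2 * (\<bar>v y\<bar> * (2 / s * \<bar>p y\<bar>))"
        by (intro mult_left_mono) auto
      also have "\<dots> = 2 / s * (2 * (\<bar>v y\<bar> * \<bar>p y\<bar>))" by simp
      also have "\<dots> \<le> 2 / s * ?E y"
        unfolding E using s by (intro mult_left_mono am) auto
      finally have 1: "2 * (\<bar>v y\<bar> * \<bar>d y\<bar>) \<le> 2 / s * ?E y" .
      have "2 * (\<bar>p y\<bar> * \<bar>g y\<bar>) \<le> 2 * (\<bar>p y\<bar> * (L * \<bar>v y\<bar>))"
        by (intro mult_left_mono g yI) auto
      also have "\<dots> = L * (2 * (\<bar>v y\<bar> * \<bar>p y\<bar>))" by simp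
      also have "\<dots> \<le> L * ?E y"
        unfolding E using \<open>L \<ge> 0\<close> by (intro mult_left_mono am) auto
      finally have 2: "2 * (\<bar>p y\<bar> * \<bar>g y\<bar>) \<le> L * ?E y" .
      have "- (2 * v y * d y) \<le> 2 * (\<bar>v y\<bar> * \<bar>d y\<bar>)"
        using abs_ge_minus_self[of "v y * d y"] unfolding abs_mult by linarith
      moreover have "2 * p y * g y \<le> 2 * (\<bar>p y\<bar> * \<bar>g y\<bar>)"
        using abs_ge_self[of "p y * g y"] unfolding abs_mult by linarith
      moreover have "?E' y + C * ?E y = 2 * v y * d y - 2 * p y * g y + (2 / s * ?E y + L * ?E y)"
        by (simp add: C_def distrib_right)
      ultimately have "0 \<le> ?E' y + C * ?E y" using 1 2 by linarith
      then show "0 \<le> (?E' y + C * ?E y) * exp (C * y)" by simp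
    qed (use s x in auto)
    then have "?E s \<le> 0" by (simp add: Ex mult_le_0_iff)
    then show "v s = 0" using sum_power2_le_zero_iff by (auto simp: E)
  qed
  obtain \<delta> where \<delta>: "\<delta> > 0" "\<And>y. y \<in> I \<Longrightarrow> dist y 0 < \<delta> \<Longrightarrow> dist (v y) (v 0) < \<bar>v 0\<bar>"
    using legendre_pairD(3)[OF P] v0 unfolding continuous_on_iff
    by (elim ballE[of _ _ 0] allE[of _ "\<bar>v 0\<bar>"]) auto
  define s where "s = min (\<delta> / 2) (x / 2)"
  have "0 < s" "s < x" "s \<in> I" "dist s 0 < \<delta>" using x0 \<delta>(1) x by (auto simp: s_def)
  then show False using \<delta>(2)[of s] zero[of s] by (simp add: dist_real_def)
qed

definition nondegenerate :: "(real \<Rightarrow> real) \<Rightarrow> (real \<Rightarrow> real) \<Rightarrow> (real \<Rightarrow> real) \<Rightarrow> bool" where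
  "nondegenerate v d g \<longleftrightarrow> legendre_pair v d g \<and> v 0 > 0 \<and> (\<forall>x\<in>I. amplitude2 v d x > 0)"

lemma nondegenerateD:
  assumes "nondegenerate v d g"
  shows "legendre_pair v d g" "v 0 > 0" "\<And>x. x \<in> I \<Longrightarrow> amplitude2 v d x > 0"
    "\<And>x. x \<in> I \<Longrightarrow> amplitude2 v d x \<noteq> 0"
  using assms unfolding nondegenerate_def by (blast, blast, blast, metis less_irrefl)

lemma prufer_rate_continuous:
  assumes "nondegenerate v d g"
  shows "continuous_on I (\<lambda>y. (g y * v y + y * (1 - y) * (d y)^2) / amplitude2 v d y)"
proof -
  note N = nondegenerateD[OF assms]
  show ?thesis using N(4) unfolding amplitude2_def
    by (intro continuous_intros legendre_pairD(1,2,3)[OF N(1)]) blast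
qed

lemma prufer_angle_deriv:
  assumes "nondegenerate v d g" "x \<in> I"
  shows "(prufer_angle v d g has_real_derivative
     - ((g x * v x + x * (1 - x) * (d x)^2) / amplitude2 v d x)) (at x within I)"
  unfolding prufer_angle_def[abs_def]
  by (intro DERIV_minus integral_has_real_derivative prufer_rate_continuous assms)

lemma prufer_angle_0 [simp]: "prufer_angle v d g 0 = 0"
  by (simp add: prufer_angle_def)

lemma linear_ode_zero:
  assumes S: "\<And>x. x \<in> I \<Longrightarrow> (S has_real_derivative c x * S x) (at x within I)"
    and c: "continuous_on I c" and S0: "S 0 = 0" and x: "x \<in> I"
  shows "S x = 0"
proof -
  obtain B where B: "\<And>y. y \<in> I \<Longrightarrow> \<bar>c y\<bar> \<le> B"
    using continuous_bounded_I[OF c] by blast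
  have "((\<lambda>x. (S x)^2 * exp (- 2 * B * x)) has_real_derivative
      (2 * (c y - B) * (S y)^2 * exp (- 2 * B * y))) (at y within I)" if "y \<in> I" for y
    by (auto intro!: derivative_eq_intros S[OF that]) (simp add: power2_eq_square algebra_simps)
  then have "(S x)^2 * exp (- 2 * B * x) \<le> (S 0)^2 * exp (- 2 * B * 0)"
  proof (rule antimono_I)
    fix y assume "0 < y" "y < x"
    then have "c y - B \<le> 0" using B[of y] x by auto
    then show "2 * (c y - B) * (S y)\<^sup>2 * exp (- 2 * B * y) \<le> 0"
      by (simp add: mult_le_0_iff)
  qed (use x in auto)
  then show ?thesis by (simp add: S0 mult_le_0_iff)
qed

text \<open>
  Let \<open>z = v + \<i> p\<close> and \<open>\<Theta>\<close> its angle.  The imaginary part of \<open>z exp (- \<i> \<Theta>)\<close> satisfies the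
  homogeneous linear equation with coefficient \<open>Re (z' / z)\<close> and vanishes at \<open>0\<close>, hence everywhere.
  The real part then has no zeros and is positive because \<open>v 0 > 0\<close>.
\<close>
lemma prufer_polar:
  assumes N: "nondegenerate v d g" and x: "x \<in> I"
  defines "\<Theta> \<equiv> prufer_angle v d g"
  shows "v x = sqrt (amplitude2 v d x) * cos (\<Theta> x)"
    "x * (1 - x) * d x = sqrt (amplitude2 v d x) * sin (\<Theta> x)"
proof -
  let ?R = "amplitude2 v d"
  define p where "p = (\<lambda>y. y * (1 - y) * d y)"
  note P = nondegenerateD(1)[OF N] and R = nondegenerateD(3)[OF N] and v0 = nondegenerateD(2)[OF N]
  have amp: "?R y = (v y)^2 + (p y)^2" for y by (simp add: amplitude2_def p_def)
  have Dp: "(p has_real_derivative - g y) (at y within I)" if "y \<in> I" for y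
    unfolding p_def by (rule legendre_pairD(6)[OF P that])
  have pc: "continuous_on I p" unfolding p_def by (rule legendre_pairD(4)[OF P])
  define S where "S = (\<lambda>x. v x * sin (\<Theta> x) - p x * cos (\<Theta> x))"
  define C where "C = (\<lambda>x. v x * cos (\<Theta> x) + p x * sin (\<Theta> x))"
  define c where "c = (\<lambda>x. (v x * d x - g x * p x) / ?R x)"
  have T: "(\<Theta> has_real_derivative - ((g x * v x + p x * d x) / ?R x)) (at x within I)" if "x \<in> I" for x
    using prufer_angle_deriv[OF N that] by (simp add: \<Theta>_def p_def power2_eq_square mult.assoc)
  have Sz: "S x = 0" if "x \<in> I" for x
  proof (rule linear_ode_zero[OF _ _ _ that])
    show "continuous_on I c"
      unfolding c_def amp
      by (intro continuous_intros legendre_pairD(1,2,3)[OF P] pc) (use nondegenerateD(4)[OF N] in \<open>simp add: amp\<close>)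
    show "S 0 = 0" by (simp add: S_def p_def \<Theta>_def)
    fix x assume x: "x \<in> I"
    let ?t = "- ((g x * v x + p x * d x) / ?R x)"
    have "(S has_real_derivative (d x * sin (\<Theta> x) + v x * (?t * cos (\<Theta> x))
         - (- g x * cos (\<Theta> x) + p x * - (?t * sin (\<Theta> x))))) (at x within I)"
      unfolding S_def
      by (auto intro!: derivative_eq_intros legendre_pairD(5)[OF P x] Dp[OF x] T[OF x]) (simp add: algebra_simps)
    moreover have "d x * sin (\<Theta> x) + v x * (?t * cos (\<Theta> x))
         - (- g x * cos (\<Theta> x) + p x * - (?t * sin (\<Theta> x))) = c x * S x"
    proof -
      have "?R x * (d x * sin (\<Theta> x) + g x * cos (\<Theta> x)) - (g x * v x + p x * d x) * C x = (v x * d x - g x * p x) * S x"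
        unfolding amp C_def S_def by algebra
      moreover have "a - b / r = n / r" if "r * a - b = n" "r > 0" for a b n r :: real
        using that by (simp add: field_simps)
      ultimately have "d x * sin (\<Theta> x) + g x * cos (\<Theta> x) - (g x * v x + p x * d x) * C x / ?R x
          = (v x * d x - g x * p x) * S x / ?R x"
        using R[OF x] by blast
      then show ?thesis unfolding c_def by (simp add: C_def algebra_simps add_divide_distrib)
    qed
    ultimately show "(S has_real_derivative c x * S x) (at x within I)" by simp
  qed
  have eq: "v y = C y * cos (\<Theta> y)" "p y = C y * sin (\<Theta> y)" "?R y = (C y)^2" if "y \<in> I" for y
  proof -
    have sc: "(sin (\<Theta> y))^2 + (cos (\<Theta> y))^2 = 1" by simp
    show "v y = C y * cos (\<Theta> y)" "p y = C y * sin (\<Theta> y)"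
      using Sz[OF that] sc unfolding S_def C_def by algebra+
    show "?R y = (C y)^2"
      using Sz[OF that] sc unfolding S_def C_def amp by algebra
  qed
  have Cc: "continuous_on I C"
  proof -
    have "continuous_on I \<Theta>"
      unfolding continuous_on_eq_continuous_within using T DERIV_continuous by blast
    then show ?thesis unfolding C_def by (intro continuous_intros legendre_pairD(3)[OF P] pc)
  qed
  have "C x > 0"
  proof (rule ccontr)
    assume "\<not> C x > 0"
    moreover have "C 0 > 0" using v0 by (simp add: C_def p_def \<Theta>_def)
    moreover have "continuous_on {0..x} C" using Cc x by (auto intro: continuous_on_subset)
    ultimately obtain z where "0 \<le> z" "z \<le> x" "C z = 0"
      using IVT2'[of C x 0 0] x by auto
    then show False using R[of z] eq(3)[of z] x by auto
  qed
  then have "sqrt (?R x) = C x" using eq(3)[OF x] by simp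
  then show "v x = sqrt (?R x) * cos (\<Theta> x)" "x * (1 - x) * d x = sqrt (?R x) * sin (\<Theta> x)"
    using eq(1,2)[OF x] by (simp_all add: p_def)
qed

section \<open>Sturm comparison\<close>

text \<open>
  As long as \<open>D\<close> is positive it grows at most exponentially, so it cannot leave \<open>0\<close> upwards.  Once
  \<open>D \<le> 0\<close> is known, \<open>exp (C x) D x\<close> decreases, strictly near \<open>0\<close>.
\<close>
lemma gronwall_negative:
  assumes D: "\<And>x. x \<in> I \<Longrightarrow> (D has_real_derivative D' x) (at x within I)"
    and D0: "D 0 = 0" and C: "C \<ge> 0"
    and le: "\<And>x. 0 < x \<Longrightarrow> x \<le> 1/2 \<Longrightarrow> D' x \<le> C * \<bar>D x\<bar> - e x"
    and e: "\<And>x. 0 < x \<Longrightarrow> x \<le> 1/2 \<Longrightarrow> e x \<ge> 0"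
    and \<eta>: "0 < \<eta>" "\<eta> \<le> 1/2" "\<And>x. 0 < x \<Longrightarrow> x < \<eta> \<Longrightarrow> e x > 0"
  shows "D (1/2) < 0"
proof -
  have cont: "continuous_on I D"
    unfolding continuous_on_eq_continuous_within using D DERIV_continuous by blast
  have E: "((\<lambda>y. exp (c * y) * D y) has_real_derivative exp (c * y) * (D' y + c * D y)) (at y within I)"
    if "y \<in> I" for y c
    by (auto intro!: derivative_eq_intros D[OF that]) (simp add: algebra_simps)
  have nonpos: "D b \<le> 0" if b: "b \<in> I" for b
  proof (rule ccontr)
    assume pos: "\<not> D b \<le> 0"
    let ?Z = "{x\<in>{0..b}. D x \<le> 0}"
    have "compact ?Z"
    proof -
      have "continuous_on {0..b} D" using cont b by (auto intro: continuous_on_subset)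
      then have "closed ?Z" using continuous_closed_preimage_constant
        by (intro continuous_on_closed_Collect_le) (auto intro!: continuous_intros)
      moreover have "bounded ?Z" by (rule bounded_subset[of "{0..b}"]) auto
      ultimately show ?thesis by (simp add: compact_eq_bounded_closed)
    qed
    moreover have "0 \<in> ?Z" using b D0 by auto
    ultimately obtain a where a: "a \<in> ?Z" "\<And>x. x \<in> ?Z \<Longrightarrow> x \<le> a"
      using compact_attains_sup[of ?Z] by blast
    have "exp (- C * b) * D b \<le> exp (- C * a) * D a"
    proof (rule antimono_I[OF E])
      fix x assume x: "a < x" "x < b"
      then have "D x > 0" using a(1) a(2)[of x] by force
      moreover have "e x \<ge> 0" "D' x \<le> C * \<bar>D x\<bar> - e x" using x a(1) b by (auto intro!: e le)
      ultimately have "D' x + (- C) * D x \<le> 0" by simp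
      then show "exp (- C * x) * (D' x + - C * D x) \<le> 0" by (simp add: mult_le_0_iff)
    qed (use a b in auto)
    moreover have "exp (- C * a) * D a \<le> 0" using a(1) by (simp add: mult_le_0_iff)
    moreover have "exp (- C * b) * D b > 0" using pos by simp
    ultimately show False by linarith
  qed
  have dec: "D' x + C * D x \<le> - e x" if "0 < x" "x \<le> 1/2" for x
    using nonpos[of x] le[of x] that by (simp add: abs_if split: if_splits)
  obtain y where y: "0 < y" "y < \<eta>"
    "exp (C * \<eta>) * D \<eta> - exp (C * 0) * D 0 = (\<eta> - 0) * (exp (C * y) * (D' y + C * D y))"
    using mvt_I[OF E, of 0 \<eta> C] \<eta> by auto
  have "D' y + C * D y \<le> - e y" using dec[of y] \<eta>(2) y(1,2) by simp
  with \<eta>(3)[OF y(1,2)] have "D' y + C * D y < 0" by linarith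
  then have "exp (C * \<eta>) * D \<eta> < 0" using y(3) \<eta>(1) by (simp add: D0 mult_less_0_iff)
  moreover have "exp (C * (1/2)) * D (1/2) \<le> exp (C * \<eta>) * D \<eta>"
  proof (rule antimono_I[OF E])
    fix x assume "\<eta> < x" "x < 1/2"
    then have "D' x + C * D x \<le> 0" using dec[of x] e[of x] \<eta> by auto
    then show "exp (C * x) * (D' x + C * D x) \<le> 0" by (simp add: mult_le_0_iff)
  qed (use \<eta> in auto)
  ultimately have "exp (C * (1/2)) * D (1/2) < 0" by linarith
  then show ?thesis by (simp add: mult_less_0_iff)
qed

lemma prufer_angle_Lipschitz:
  assumes N: "nondegenerate v d g"
  shows "\<exists>K\<ge>0. \<forall>x\<in>I. \<bar>prufer_angle v d g x\<bar> \<le> K * x"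
proof -
  let ?f = "\<lambda>y. (g y * v y + y * (1 - y) * (d y)^2) / amplitude2 v d y"
  obtain B where B: "\<And>y. y \<in> I \<Longrightarrow> \<bar>?f y\<bar> \<le> B"
    using continuous_bounded_I[OF prufer_rate_continuous[OF N]] by blast
  have "\<bar>prufer_angle v d g x\<bar> \<le> B * x" if x: "x \<in> I" for x
  proof (cases "x = 0")
    case False
    then obtain y where y: "0 < y" "y < x" "prufer_angle v d g x = x * - ?f y"
      using mvt_I[OF prufer_angle_deriv[OF N], of 0 x] x by auto
    show ?thesis
      using mult_left_mono[OF B[of y], of x] x y(1,2) unfolding y(3) abs_mult by (simp add: mult.commute)
  qed simp
  moreover have "B \<ge> 0" using order_trans[OF abs_ge_zero B[of 0]] by simp
  ultimately show ?thesis by blast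
qed

text \<open>
  Along the polar representation the rate of the angle separates into the potential, weighted with
  \<open>cos\<^sup>2\<close>, and the singular coefficient, weighted with \<open>sin\<^sup>2\<close>.
\<close>
lemma prufer_rate_polar:
  assumes N: "nondegenerate v d g" and x: "0 < x" "x \<le> 1/2"
  defines "\<Theta> \<equiv> prufer_angle v d g"
  shows "(g x * v x + x * (1 - x) * (d x)^2) / amplitude2 v d x
     = g x * v x / amplitude2 v d x + (sin (\<Theta> x))^2 / (x * (1 - x))"
    "(v x)^2 / amplitude2 v d x = (cos (\<Theta> x))^2"
proof -
  have xI: "x \<in> I" using x by auto
  have R: "amplitude2 v d x > 0" by (rule nondegenerateD(3)[OF N xI])
  note pol = prufer_polar[OF N xI, folded \<Theta>_def]
  have "(v x)^2 = amplitude2 v d x * (cos (\<Theta> x))^2"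
    using R by (subst pol(1)) (simp add: power_mult_distrib)
  then show "(v x)^2 / amplitude2 v d x = (cos (\<Theta> x))^2" using R by simp
  have "(x * (1 - x) * d x)^2 = amplitude2 v d x * (sin (\<Theta> x))^2"
    using R by (subst pol(2)) (simp add: power_mult_distrib)
  moreover have "(x * (1 - x) * d x)^2 = (x * (1 - x)) * (x * (1 - x) * (d x)^2)"
    by (simp add: power2_eq_square)
  ultimately have "x * (1 - x) * (d x)^2 = amplitude2 v d x * ((sin (\<Theta> x))^2 / (x * (1 - x)))"
    using x by (simp add: field_simps)
  then show "(g x * v x + x * (1 - x) * (d x)^2) / amplitude2 v d x
     = g x * v x / amplitude2 v d x + (sin (\<Theta> x))^2 / (x * (1 - x))"
    using R by (simp add: add_divide_distrib)
qed

text \<open>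
  Subtract the two angular equations.  The larger potential contributes a negative term, strictly
  negative near \<open>0\<close>.  The remaining term is
  \<open>(\<nu> - 1 / (x (1 - x))) sin (A - B) sin (A + B)\<close> for the angles \<open>A\<close> and \<open>B\<close>; both are of order \<open>x\<close>,
  so \<open>sin (A + B)\<close> compensates the singularity and Gronwall's inequality applies.
\<close>
lemma sturm_comparison:
  assumes V: "nondegenerate v d g" and W: "nondegenerate w e (\<lambda>x. \<nu> * w x)"
    and g: "\<And>x. x \<in> I \<Longrightarrow> \<kappa> * (v x)^2 \<le> g x * v x" and \<nu>: "0 \<le> \<nu>" "\<nu> < \<kappa>"
  shows "prufer_angle v d g (1/2) < prufer_angle w e (\<lambda>x. \<nu> * w x) (1/2)"
proof -
  let ?A = "prufer_angle v d g" and ?B = "prufer_angle w e (\<lambda>x. \<nu> * w x)"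
  let ?A' = "\<lambda>x. - ((g x * v x + x * (1 - x) * (d x)^2) / amplitude2 v d x)"
  let ?B' = "\<lambda>x. - ((\<nu> * w x * w x + x * (1 - x) * (e x)^2) / amplitude2 w e x)"
  obtain K1 where K1: "K1 \<ge> 0" "\<And>x. x \<in> I \<Longrightarrow> \<bar>?A x\<bar> \<le> K1 * x"
    using prufer_angle_Lipschitz[OF V] by blast
  obtain K2 where K2: "K2 \<ge> 0" "\<And>x. x \<in> I \<Longrightarrow> \<bar>?B x\<bar> \<le> K2 * x"
    using prufer_angle_Lipschitz[OF W] by blast
  define K where "K = K1 + K2"
  define C where "C = (\<nu> + 2) * K"
  define \<eta> where "\<eta> = min (1/2) (1 / (K1 + 1))"
  have "?A (1/2) - ?B (1/2) < 0"
  proof (rule gronwall_negative[where D = "\<lambda>x. ?A x - ?B x" and D' = "\<lambda>x. ?A' x - ?B' x" and C = C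
        and e = "\<lambda>x. (\<kappa> - \<nu>) * (cos (?A x))^2" and \<eta> = \<eta>])
    show "((\<lambda>x. ?A x - ?B x) has_real_derivative ?A' x - ?B' x) (at x within I)" if "x \<in> I" for x
      by (intro DERIV_diff prufer_angle_deriv V W that)
    show "C \<ge> 0" using K1 K2 \<nu> by (simp add: C_def K_def)
    show "0 < \<eta>" "\<eta> \<le> 1/2" using K1(1) by (auto simp: \<eta>_def)
    show "(\<kappa> - \<nu>) * (cos (?A x))^2 \<ge> 0" for x using \<nu> by simp
    show "(\<kappa> - \<nu>) * (cos (?A x))^2 > 0" if "0 < x" "x < \<eta>" for x
    proof -
      have "\<bar>?A x\<bar> \<le> K1 * x" using that by (intro K1) (auto simp: \<eta>_def)
      also have "\<dots> \<le> K1 * (1 / (K1 + 1))" using that K1(1) by (intro mult_left_mono) (auto simp: \<eta>_def)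
      also have "\<dots> < 1" using K1(1) by (simp add: field_simps)
      finally have "\<bar>?A x\<bar> < pi / 2" using pi_gt3 by linarith
      then have "cos (?A x) > 0" by (intro cos_gt_zero_pi) (auto simp: abs_less_iff)
      then show ?thesis using \<nu> by simp
    qed
    fix x :: real assume x: "0 < x" "x \<le> 1/2"
    then have xI: "x \<in> I" by auto
    let ?s = "1 / (x * (1 - x))"
    have Rv: "amplitude2 v d x > 0" by (rule nondegenerateD(3)[OF V xI])
    have "\<kappa> * (cos (?A x))^2 \<le> g x * v x / amplitude2 v d x"
      unfolding prufer_rate_polar(2)[OF V x, symmetric]
      using divide_right_mono[OF g[OF xI], of "amplitude2 v d x"] Rv by simp
    then have A': "?A' x \<le> - (\<kappa> * (cos (?A x))^2 + ?s * (sin (?A x))^2)"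
      unfolding prufer_rate_polar(1)[OF V x] by simp
    have B': "?B' x = - (\<nu> * (cos (?B x))^2 + ?s * (sin (?B x))^2)"
      unfolding prufer_rate_polar(1)[OF W x] prufer_rate_polar(2)[OF W x, symmetric]
      by (simp add: power2_eq_square)
    have "\<bar>(sin (?A x))^2 - (sin (?B x))^2\<bar> = \<bar>sin (?A x + ?B x)\<bar> * \<bar>sin (?A x - ?B x)\<bar>"
    proof -
      have "(sin a)^2 - (sin b)^2 = sin (a + b) * sin (a - b)" for a b :: real
        unfolding sin_add sin_diff using sin_cos_squared_add[of a] sin_cos_squared_add[of b] by algebra
      then show ?thesis by (simp add: abs_mult)
    qed
    also have "\<dots> \<le> (K * x) * \<bar>?A x - ?B x\<bar>"
    proof (rule mult_mono)
      have "\<bar>sin (?A x + ?B x)\<bar> \<le> \<bar>?A x + ?B x\<bar>" by (rule abs_sin_x_le_abs_x)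
      also have "\<dots> \<le> K * x" using K1(2)[OF xI] K2(2)[OF xI] by (simp add: K_def distrib_right)
      finally show "\<bar>sin (?A x + ?B x)\<bar> \<le> K * x" .
    qed (use x K1 K2 in \<open>auto intro: abs_sin_x_le_abs_x simp: K_def\<close>)
    finally have sin2: "\<bar>(sin (?A x))^2 - (sin (?B x))^2\<bar> \<le> (K * x) * \<bar>?A x - ?B x\<bar>" .
    have "?s \<le> 2 / x" using x by (simp add: field_simps)
    moreover have "?s \<ge> 0" using x by simp
    ultimately have coef: "\<bar>\<nu> - ?s\<bar> \<le> \<nu> + 2 / x" using \<nu> by linarith
    have "(\<nu> - ?s) * ((sin (?A x))^2 - (sin (?B x))^2) \<le> \<bar>\<nu> - ?s\<bar> * \<bar>(sin (?A x))^2 - (sin (?B x))^2\<bar>"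
      using abs_ge_self[of "(\<nu> - ?s) * ((sin (?A x))^2 - (sin (?B x))^2)"] by (simp only: abs_mult)
    also have "\<dots> \<le> (\<nu> + 2 / x) * ((K * x) * \<bar>?A x - ?B x\<bar>)"
      by (intro mult_mono coef sin2) (use x \<nu> in auto)
    also have "\<dots> = (\<nu> * x + 2) * (K * \<bar>?A x - ?B x\<bar>)"
      using x by (simp add: field_simps)
    also have "\<dots> \<le> (\<nu> + 2) * (K * \<bar>?A x - ?B x\<bar>)"
      using x \<nu> K1(1) K2(1) mult_left_mono[of x 1 \<nu>] by (intro mult_right_mono) (auto simp: K_def)
    finally have main: "(\<nu> - ?s) * ((sin (?A x))^2 - (sin (?B x))^2) \<le> C * \<bar>?A x - ?B x\<bar>"
      by (simp add: C_def mult.assoc)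
    have "?A' x - ?B' x \<le> - (\<kappa> * (cos (?A x))^2 + ?s * (sin (?A x))^2) + (\<nu> * (cos (?B x))^2 + ?s * (sin (?B x))^2)"
      using A' unfolding B' by linarith
    also have "\<dots> = (\<nu> - ?s) * ((sin (?A x))^2 - (sin (?B x))^2) - (\<kappa> - \<nu>) * (cos (?A x))^2"
      unfolding sin_squared_eq by (simp add: algebra_simps)
    finally show "?A' x - ?B' x \<le> C * \<bar>?A x - ?B x\<bar> - (\<kappa> - \<nu>) * (cos (?A x))^2"
      using main by linarith
  qed simp
  then show ?thesis by simp
qed

section \<open>Even Legendre polynomials\<close>

text \<open>
  Coefficients of the even power series solution of \<open>((1 - s\<^sup>2) Q')' = - \<nu> Q\<close>.  For
  \<open>\<nu> = 2 n (2 n + 1)\<close> the series stops at degree \<open>2 n\<close>.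
\<close>
primrec even_coeff :: "real \<Rightarrow> nat \<Rightarrow> real" where
  "even_coeff \<nu> 0 = 1"
| "even_coeff \<nu> (Suc m) =
     (2 * real m * (2 * real m + 1) - \<nu>) / ((2 * real m + 2) * (2 * real m + 1)) * even_coeff \<nu> m"

text \<open>
  The summands of \<open>((1 - s\<^sup>2) Q')'\<close> telescope by the recursion; only the boundary term remains, and its
  factor vanishes when \<open>\<nu> = 2 N (2 N + 1)\<close>.
\<close>
lemma even_coeff_telescope:
  "(\<Sum>m\<le>N. even_coeff \<nu> m * (2 * real m) * ((2 * real m - 1) * s ^ (2 * m - 2) - (2 * real m + 1) * s ^ (2 * m)))
   = - (2 * real N * (2 * real N + 1) - \<nu>) * even_coeff \<nu> N * s ^ (2 * N)
     - \<nu> * (\<Sum>m\<le>N. even_coeff \<nu> m * s ^ (2 * m))"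
proof (induction N)
  case (Suc N)
  let ?c = "even_coeff \<nu>"
  have "(2 * real N + 2) * (2 * real N + 1) \<noteq> 0"
    by (auto simp: add_nonneg_eq_0_iff)
  then have c: "?c (Suc N) * ((2 * real N + 2) * (2 * real N + 1)) = (2 * real N * (2 * real N + 1) - \<nu>) * ?c N"
    by simp
  have "?c (Suc N) * (2 * real (Suc N)) * ((2 * real (Suc N) - 1) * s ^ (2 * Suc N - 2) - (2 * real (Suc N) + 1) * s ^ (2 * Suc N))
      = (?c (Suc N) * ((2 * real N + 2) * (2 * real N + 1))) * s ^ (2 * N)
        - (2 * real (Suc N) * (2 * real (Suc N) + 1)) * ?c (Suc N) * s ^ (2 * Suc N)"
    by (simp add: algebra_simps del: even_coeff.simps)
  then show ?case
    unfolding sum.atMost_Suc Suc.IH c by (simp add: algebra_simps del: even_coeff.simps)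
qed simp

lemma nondegenerateI:
  assumes "legendre_pair v d g" "v 0 > 0" "\<And>x. x \<in> I \<Longrightarrow> \<bar>g x\<bar> \<le> L * \<bar>v x\<bar>"
  shows "nondegenerate v d g"
  unfolding nondegenerate_def using assms(1,2) amplitude2_pos[OF assms(1,3)] by auto

lemma prufer_angle_at_node:
  assumes "nondegenerate v d g"
  shows "d (1/2) = 0 \<longleftrightarrow> (\<exists>i::int. prufer_angle v d g (1/2) = of_int i * pi)"
proof -
  have x: "(1/2::real) \<in> I" by simp
  have "(1/2) * (1 - 1/2) * d (1/2) = sqrt (amplitude2 v d (1/2)) * sin (prufer_angle v d g (1/2))"
    by (rule prufer_polar(2)[OF assms x])
  moreover have "sqrt (amplitude2 v d (1/2)) \<noteq> 0"
    using nondegenerateD(3)[OF assms x] by simp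
  ultimately have "d (1/2) = 0 \<longleftrightarrow> sin (prufer_angle v d g (1/2)) = 0" by auto
  then show ?thesis by (simp add: sin_zero_iff_int2)
qed

text \<open>
  The substitution \<open>s = 1 - 2 x\<close> turns the Legendre equation into the one considered here and the
  parity of the polynomial into \<open>e (1/2) = 0\<close>.  The polynomial is normalized by its value at \<open>x = 0\<close>,
  which is nonzero: otherwise stability would force the solution to vanish, but its value at
  \<open>x = 1/2\<close> is \<open>1\<close>.
\<close>
lemma even_legendre_pair:
  fixes n :: nat
  defines "\<nu> \<equiv> 2 * real n * (2 * real n + 1)"
  shows "\<exists>w e. nondegenerate w e (\<lambda>x. \<nu> * w x) \<and> e (1/2) = 0"
proof -
  let ?c = "even_coeff \<nu>"
  define Q where "Q = (\<lambda>s. \<Sum>m\<le>n. ?c m * s ^ (2 * m))"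
  define Q' where "Q' = (\<lambda>s. \<Sum>m\<le>n. ?c m * (2 * real m) * s ^ (2 * m - 1))"
  define F where "F = (\<lambda>s. \<Sum>m\<le>n. ?c m * (2 * real m) * (s ^ (2 * m - 1) - s ^ (2 * m + 1)))"
  have DQ: "(Q has_real_derivative Q' s) (at s)" for s
    unfolding Q_def Q'_def by (auto intro!: derivative_eq_intros sum.cong)
  have FQ: "(1 - s^2) * Q' s = F s" for s
    unfolding F_def Q'_def sum_distrib_left
  proof (rule sum.cong)
    fix m show "(1 - s\<^sup>2) * (?c m * (2 * real m) * s ^ (2 * m - 1)) =
         ?c m * (2 * real m) * (s ^ (2 * m - 1) - s ^ (2 * m + 1))"
      by (cases m) (simp_all add: power2_eq_square algebra_simps del: even_coeff.simps)
  qed simp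
  have DF: "(F has_real_derivative - \<nu> * Q s) (at s)" for s
  proof -
    have summand: "((\<lambda>s. ?c m * (2 * real m) * (s ^ (2 * m - 1) - s ^ (2 * m + 1))) has_real_derivative
        ?c m * (2 * real m) * ((2 * real m - 1) * s ^ (2 * m - 2) - (2 * real m + 1) * s ^ (2 * m))) (at s)" for m
    proof (cases m)
      case (Suc k)
      have e: "2 * m - 1 = 2 * k + 1" "2 * m + 1 = 2 * k + 3" "2 * m - 2 = 2 * k + 1 - Suc 0"
        "2 * m = 2 * k + 3 - Suc 0" "2 * real m - 1 = real (2 * k + 1)" "2 * real m + 1 = real (2 * k + 3)"
        by (simp_all add: Suc)
      have "((\<lambda>s. ?c m * (2 * real m) * (s ^ (2 * k + 1) - s ^ (2 * k + 3))) has_real_derivative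
          ?c m * (2 * real m) * (real (2 * k + 1) * s ^ (2 * k + 1 - Suc 0) - real (2 * k + 3) * s ^ (2 * k + 3 - Suc 0))) (at s)"
        by (intro DERIV_cmult DERIV_diff DERIV_pow)
      then show ?thesis unfolding e(1,2,3,5,6) unfolding e(4) .
    qed simp
    have "(F has_real_derivative (\<Sum>m\<le>n. ?c m * (2 * real m) * ((2 * real m - 1) * s ^ (2 * m - 2) - (2 * real m + 1) * s ^ (2 * m)))) (at s)"
      unfolding F_def by (rule DERIV_sum, rule summand)
    then show ?thesis
      unfolding even_coeff_telescope by (simp add: Q_def \<nu>_def)
  qed
  define w where "w = (\<lambda>x. Q (1 - 2 * x))"
  define e where "e = (\<lambda>x. -2 * Q' (1 - 2 * x))"
  have P: "legendre_pair w e (\<lambda>x. \<nu> * w x)"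
    unfolding legendre_pair_def
  proof (intro conjI ballI)
    show "continuous_on I e" unfolding e_def Q'_def by (intro continuous_intros)
    show "continuous_on I (\<lambda>x. \<nu> * w x)" unfolding w_def Q_def by (intro continuous_intros)
    fix x assume "x \<in> I"
    have s: "((\<lambda>x. 1 - 2 * x) has_real_derivative -2) (at x within I)"
      by (auto intro!: derivative_eq_intros)
    show "(w has_real_derivative e x) (at x within I)"
      using DERIV_chain2[OF DQ s] by (simp add: w_def e_def mult.commute)
    have "((\<lambda>x. - (1/2) * F (1 - 2 * x)) has_real_derivative - (1/2) * ((- \<nu> * Q (1 - 2 * x)) * -2)) (at x within I)"
      by (intro DERIV_cmult DERIV_chain2[OF DF s])
    moreover have "- (1/2) * F (1 - 2 * x) = x * (1 - x) * e x" for x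
      unfolding FQ[symmetric] e_def by (simp add: power2_eq_square algebra_simps)
    ultimately show "((\<lambda>x. x * (1 - x) * e x) has_real_derivative - (\<nu> * w x)) (at x within I)"
      by (simp add: w_def)
  qed
  have \<nu>0: "\<nu> \<ge> 0" by (simp add: \<nu>_def)
  have w1: "w (1/2) = 1"
  proof -
    have "Q 0 = (\<Sum>m\<le>n. if m = 0 then 1 else 0)"
      unfolding Q_def by (rule sum.cong) (auto simp: power_0_left)
    then show ?thesis by (simp add: w_def)
  qed
  have "w 0 \<noteq> 0"
  proof
    assume "w 0 = 0"
    moreover have "\<bar>w (1/2)\<bar> \<le> 2 * exp (2 * (\<nu> + 1)) * \<bar>w 0\<bar>"
      by (rule legendre_stability[OF P]) (use \<nu>0 in \<open>auto simp: abs_mult intro!: mult_right_mono\<close>)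
    ultimately show False by (simp add: w1)
  qed
  then have "nondegenerate (\<lambda>x. 1 / w 0 * w x) (\<lambda>x. 1 / w 0 * e x) (\<lambda>x. \<nu> * (1 / w 0 * w x))"
  proof (intro nondegenerateI[where L = \<nu>])
    show "legendre_pair (\<lambda>x. 1 / w 0 * w x) (\<lambda>x. 1 / w 0 * e x) (\<lambda>x. \<nu> * (1 / w 0 * w x))"
      using legendre_pair_scale[OF P, of "1 / w 0"] by (simp add: mult.left_commute)
  qed (use \<nu>0 in \<open>auto simp: abs_mult\<close>)
  moreover have "1 / w 0 * e (1/2) = 0"
  proof -
    have "?c m * (2 * real m) * 0 ^ (2 * m - 1) = 0" for m by (cases m) simp_all
    then have "Q' 0 = 0" unfolding Q'_def by (simp only: sum.neutral_const)
    then show ?thesis by (simp add: e_def)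
  qed
  ultimately show ?thesis by blast
qed

text \<open>
  At \<open>1/2\<close> each angle is a multiple of \<open>\<pi>\<close>, and by Sturm comparison these multiples strictly
  decrease from one even degree to the next; this replaces a count of the zeros.
\<close>
lemma even_legendre_angle:
  "\<exists>w e. nondegenerate w e (\<lambda>x. 2 * real n * (2 * real n + 1) * w x) \<and>
     prufer_angle w e (\<lambda>x. 2 * real n * (2 * real n + 1) * w x) (1/2) \<le> - real n * pi"
proof (induction n)
  case 0
  have "nondegenerate (\<lambda>x. 1) (\<lambda>x. 0) (\<lambda>x. 2 * real 0 * (2 * real 0 + 1) * 1)"
    using legendre_pair_const[of 1] by (intro nondegenerateI[where L = 0]) auto
  moreover have "prufer_angle (\<lambda>x. 1) (\<lambda>x. 0) (\<lambda>x. 2 * real 0 * (2 * real 0 + 1) * 1) (1/2) \<le> - real 0 * pi"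
    by (simp add: prufer_angle_def)
  ultimately show ?case by blast
next
  case (Suc n)
  let ?\<nu> = "\<lambda>n. 2 * real n * (2 * real n + 1)"
  obtain w e where w: "nondegenerate w e (\<lambda>x. ?\<nu> n * w x)"
    "prufer_angle w e (\<lambda>x. ?\<nu> n * w x) (1/2) \<le> - real n * pi" using Suc.IH by blast
  obtain v d where v: "nondegenerate v d (\<lambda>x. ?\<nu> (Suc n) * v x)" "d (1/2) = 0"
    using even_legendre_pair[of "Suc n"] by blast
  let ?\<Theta> = "prufer_angle v d (\<lambda>x. ?\<nu> (Suc n) * v x) (1/2)"
  have "?\<Theta> < prufer_angle w e (\<lambda>x. ?\<nu> n * w x) (1/2)"
  proof (rule sturm_comparison[OF v(1) w(1)])
    show "?\<nu> (Suc n) * (v x)^2 \<le> ?\<nu> (Suc n) * v x * v x" for x by (simp add: power2_eq_square)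
    show "?\<nu> n < ?\<nu> (Suc n)" by (simp add: algebra_simps)
  qed simp
  then have lt: "?\<Theta> < - real n * pi" using w(2) by linarith
  obtain i :: int where i: "?\<Theta> = of_int i * pi" using prufer_angle_at_node[OF v(1)] v(2) by blast
  have "of_int i * pi < of_int (- int n) * pi" using lt unfolding i by simp
  then have "real_of_int i < of_int (- int n)" using pi_gt_zero by (simp only: mult_less_cancel_right_pos)
  then have "i \<le> - int (Suc n)" by simp
  then have "of_int i * pi \<le> of_int (- int (Suc n)) * pi" by (intro mult_right_mono) (simp_all del: of_nat_Suc)
  then have "?\<Theta> \<le> - real (Suc n) * pi" unfolding i by (simp add: algebra_simps)
  with v(1) show ?case by blast
qed

section \<open>Shooting from the singular endpoint\<close>

text \<open>
  The bound of \<open>legendre_flux_bound\<close> extends to the endpoint \<open>0\<close> by continuity of \<open>d\<close>.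
\<close>
lemma legendre_deriv_bound:
  assumes P: "legendre_pair v d g" and g: "\<And>x. x \<in> I \<Longrightarrow> \<bar>g x\<bar> \<le> M" and x: "x \<in> I"
  shows "\<bar>d x\<bar> \<le> 2 * M"
proof (rule continuous_le_on_closure[where S = "{0<..<1/2}" and f = "\<lambda>x. \<bar>d x\<bar>"])
  have cl: "closure {0<..<1/2::real} = I" by simp
  show "continuous_on (closure {0<..<1/2}) (\<lambda>x. \<bar>d x\<bar>)"
    unfolding cl by (intro continuous_intros legendre_pairD(1)[OF P])
  show "x \<in> closure {0<..<1/2}" using x unfolding cl .
  fix y :: real assume "y \<in> {0<..<1/2}"
  then show "\<bar>d y\<bar> \<le> 2 * M" by (intro legendre_flux_bound(2)[OF P] g) auto
qed

text \<open>
  Where the angle equals \<open>- \<pi>\<close>, its sine vanishes and with it the flux.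
\<close>
lemma prufer_angle_gt_minus_pi:
  assumes N: "nondegenerate v d g" and neg: "\<And>x. 0 < x \<Longrightarrow> x \<le> 1/2 \<Longrightarrow> d x < 0"
  shows "prufer_angle v d g (1/2) > - pi"
proof (rule ccontr)
  assume "\<not> ?thesis"
  moreover have "continuous_on I (prufer_angle v d g)"
    unfolding continuous_on_eq_continuous_within using prufer_angle_deriv[OF N] DERIV_continuous by blast
  ultimately obtain x where x: "0 \<le> x" "x \<le> 1/2" "prufer_angle v d g x = - pi"
    using IVT2'[of "prufer_angle v d g" "1/2" "- pi" 0] by auto
  then have "x \<noteq> 0" by auto
  then have "x * (1 - x) * d x < 0" using x neg[of x] by (simp add: mult_less_0_iff)
  moreover have "x * (1 - x) * d x = sqrt (amplitude2 v d x) * sin (prufer_angle v d g x)"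
    using x by (intro prufer_polar(2)[OF N]) auto
  ultimately show False using x(3) by simp
qed

lemma continuous_on_lipschitz_family:
  fixes F :: "real \<Rightarrow> real \<Rightarrow> real"
  assumes lip: "\<And>a b x. x \<in> I \<Longrightarrow> \<bar>F a x - F b x\<bar> \<le> C * \<bar>a - b\<bar>" and C: "C \<ge> 0"
    and cont: "\<And>a. continuous_on I (F a)"
  shows "continuous_on (UNIV \<times> I) (\<lambda>p. F (fst p) (snd p))"
  unfolding continuous_on_iff
proof (intro ballI allI impI)
  fix p :: "real \<times> real" and \<epsilon> :: real assume p: "p \<in> UNIV \<times> I" and \<epsilon>: "\<epsilon> > 0"
  obtain a x where ax: "p = (a, x)" "x \<in> I" using p by (cases p) auto
  obtain \<delta> where \<delta>: "\<delta> > 0" "\<And>y. y \<in> I \<Longrightarrow> dist y x < \<delta> \<Longrightarrow> dist (F a y) (F a x) < \<epsilon> / 2"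
    using cont[of a, unfolded continuous_on_iff, rule_format, OF ax(2), of "\<epsilon> / 2"] \<epsilon> by auto
  have "dist (F (fst r) (snd r)) (F (fst p) (snd p)) < \<epsilon>"
    if r: "r \<in> UNIV \<times> I" "dist r p < min \<delta> (\<epsilon> / (2 * (C + 1)))" for r
  proof -
    obtain b y where bY: "r = (b, y)" "y \<in> I" using r by (cases r) auto
    have d1: "dist y x < \<delta>" using dist_snd_le[of r p] r(2) by (simp add: bY ax)
    have "dist b a < \<epsilon> / (2 * (C + 1))" using dist_fst_le[of r p] r(2) by (simp add: bY ax)
    then have "(C + 1) * \<bar>b - a\<bar> < \<epsilon> / 2" using C by (simp add: dist_real_def field_simps)
    moreover have "C * \<bar>b - a\<bar> \<le> (C + 1) * \<bar>b - a\<bar>" by (intro mult_right_mono) auto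
    ultimately have "\<bar>F b y - F a y\<bar> < \<epsilon> / 2" using lip[OF bY(2), of b a] by linarith
    moreover have "\<bar>F a y - F a x\<bar> < \<epsilon> / 2" using \<delta>(2)[OF bY(2) d1] by (simp add: dist_real_def)
    ultimately have "\<bar>F b y - F a x\<bar> < \<epsilon>" by linarith
    then show ?thesis by (simp add: bY ax dist_real_def)
  qed
  moreover have "min \<delta> (\<epsilon> / (2 * (C + 1))) > 0" using \<delta> \<epsilon> C by simp
  ultimately show "\<exists>d>0. \<forall>x'\<in>UNIV \<times> I. dist x' p < d \<longrightarrow> dist (F (fst x') (snd x')) (F (fst p) (snd p)) < \<epsilon>"
    by blast
qed

text \<open>
  All values \<open>- \<pi>, \<dots>, - m \<pi>\<close> are attained; choose one preimage for each of them.
\<close>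
lemma angle_levels:
  fixes \<Phi> :: "real \<Rightarrow> real" and m :: nat
  assumes c: "continuous_on {a..b} \<Phi>" and ab: "a \<le> b"
    and lim: "\<Phi> b \<le> - real m * pi \<and> - pi \<le> \<Phi> a \<or> \<Phi> a \<le> - real m * pi \<and> - pi \<le> \<Phi> b"
  obtains X where "X \<subseteq> {a..b}" "finite X" "card X = m" "\<And>x. x \<in> X \<Longrightarrow> \<exists>i. \<Phi> x = - real i * pi"
proof -
  let ?V = "(\<lambda>i. - real i * pi) ` {1..m}"
  have "?V \<subseteq> \<Phi> ` {a..b}"
  proof safe
    fix i assume "i \<in> {1..m}"
    then have i: "real m * pi \<ge> real i * pi" "real i * pi \<ge> 1 * pi"
      by (auto intro!: mult_right_mono)
    have "\<exists>x. a \<le> x \<and> x \<le> b \<and> \<Phi> x = - real i * pi"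
      using lim
    proof
      assume "\<Phi> b \<le> - real m * pi \<and> - pi \<le> \<Phi> a"
      then show ?thesis using i by (intro IVT2'[OF _ _ ab c]) linarith+
    next
      assume "\<Phi> a \<le> - real m * pi \<and> - pi \<le> \<Phi> b"
      then show ?thesis using i by (intro IVT'[OF _ _ ab c]) linarith+
    qed
    then obtain x where "x \<in> {a..b}" "\<Phi> x = - real i * pi" by auto
    then show "- real i * pi \<in> \<Phi> ` {a..b}" by (metis imageI)
  qed
  then obtain X where X: "X \<subseteq> {a..b}" "inj_on \<Phi> X" "?V = \<Phi> ` X"
    unfolding subset_image_inj by blast
  have "card ?V = m" by (subst card_image) (auto simp: inj_on_def)
  then have "card X = m" using X(2,3) by (simp add: card_image)
  moreover have "finite (\<Phi> ` X)" using X(3) by (metis finite_imageI finite_atLeastAtMost)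
  then have "finite X" using X(2) finite_imageD by blast
  moreover have "\<exists>i. \<Phi> x = - real i * pi" if "x \<in> X" for x
    using imageI[OF that, of \<Phi>] unfolding X(3)[symmetric] by blast
  ultimately show ?thesis using that X(1) by blast
qed

text \<open>
  A nonlinearity with the sign pattern of \<open>u\<^sup>q - u\<close>, cut off at \<open>0\<close>, together with the family of its
  regular solutions, indexed by the initial value.
\<close>
locale shooting =
  fixes f :: "real \<Rightarrow> real" and L :: real and u d :: "real \<Rightarrow> real \<Rightarrow> real"
  assumes lip: "\<bar>f s - f t\<bar> \<le> L * \<bar>s - t\<bar>" and L: "L > 0"
    and f_nonpos: "t \<le> 0 \<Longrightarrow> f t = 0" and f_1: "f 1 = 0"
    and f_neg: "0 < t \<Longrightarrow> t < 1 \<Longrightarrow> f t < 0"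
    and pair: "legendre_pair (u a) (d a) (\<lambda>x. f (u a x))" and init: "u a 0 = a"
begin

definition M where "M = 2 * exp (2 * L)"

lemma M_pos: "M > 0" by (simp add: M_def)

lemma pair_diff: "legendre_pair (\<lambda>x. u a x - u b x) (\<lambda>x. d a x - d b x) (\<lambda>x. f (u a x) - f (u b x))"
  by (intro legendre_pair_diff pair)

lemma u_lip: "x \<in> I \<Longrightarrow> \<bar>u a x - u b x\<bar> \<le> M * \<bar>a - b\<bar>"
  using legendre_stability[OF pair_diff L lip, of x a b] by (simp add: M_def init)

lemma d_lip: 
  assumes "x \<in> I"
  shows "\<bar>d a x - d b x\<bar> \<le> 2 * L * M * \<bar>a - b\<bar>"
proof -
  have "\<bar>d a x - d b x\<bar> \<le> 2 * (L * (M * \<bar>a - b\<bar>))"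
  proof (rule legendre_deriv_bound[OF pair_diff _ assms])
    fix y assume "y \<in> I"
    show "\<bar>f (u a y) - f (u b y)\<bar> \<le> L * (M * \<bar>a - b\<bar>)"
      using order_trans[OF lip mult_left_mono[OF u_lip[OF \<open>y \<in> I\<close>, of a b], of L]] L by simp
  qed
  then show ?thesis by simp
qed

lemma constant_solution:
  assumes "f c = 0" "x \<in> I"
  shows "u c x = c" "d c x = 0"
proof -
  have P: "legendre_pair (\<lambda>x. u c x - c) (\<lambda>x. d c x - 0) (\<lambda>x. f (u c x) - 0)"
    by (intro legendre_pair_diff pair legendre_pair_const)
  have f: "\<bar>f (u c x) - 0\<bar> \<le> L * \<bar>u c x - c\<bar>" for x using lip[of "u c x" c] assms(1) by simp
  have eq: "u c x = c" if "x \<in> I" for x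
    using legendre_stability[OF P L f that] by (simp add: init)
  then show "u c x = c" using assms by blast
  have "\<bar>d c x - 0\<bar> \<le> 2 * 0"
    by (rule legendre_deriv_bound[OF P _ assms(2)]) (simp add: eq assms)
  then show "d c x = 0" by simp
qed

text \<open>
  The angle at \<open>1/2\<close> of the difference quotient \<open>(u a - 1) / (a - 1)\<close>.  The integrand is invariant under
  scaling, so the factor \<open>1 / (a - 1)\<close> has been dropped; the difference quotient itself starts at \<open>1\<close>
  on either side of \<open>a = 1\<close>.
\<close>
definition quotient_angle :: "real \<Rightarrow> real" where
  "quotient_angle a = - integral I (\<lambda>y. (f (u a y) * (u a y - 1) + y * (1 - y) * (d a y)^2)
      / ((u a y - 1)^2 + (y * (1 - y) * d a y)^2))"

abbreviation "qu a \<equiv> (\<lambda>x. 1 / (a - 1) * (u a x - 1))"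
abbreviation "qd a \<equiv> (\<lambda>x. 1 / (a - 1) * d a x)"
abbreviation "qf a \<equiv> (\<lambda>x. 1 / (a - 1) * f (u a x))"

lemma quotient_nondegenerate:
  assumes "a \<noteq> 1"
  shows "nondegenerate (qu a) (qd a) (qf a)"
proof (rule nondegenerateI[where L = L])
  have "legendre_pair (\<lambda>x. u a x - 1) (\<lambda>x. d a x - 0) (\<lambda>x. f (u a x) - 0)"
    by (intro legendre_pair_diff pair legendre_pair_const)
  from legendre_pair_scale[OF this, of "1 / (a - 1)"]
  show "legendre_pair (qu a) (qd a) (qf a)" by simp
  show "qu a 0 > 0" using assms by (simp add: init)
  fix x
  have "\<bar>1 / (a - 1)\<bar> * \<bar>f (u a x) - f 1\<bar> \<le> \<bar>1 / (a - 1)\<bar> * (L * \<bar>u a x - 1\<bar>)"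
    by (intro mult_left_mono lip) simp
  then show "\<bar>qf a x\<bar> \<le> L * \<bar>qu a x\<bar>" unfolding abs_mult f_1 by (simp add: mult_ac)
qed

lemma quotient_angle_eq:
  assumes "a \<noteq> 1"
  shows "prufer_angle (qu a) (qd a) (qf a) (1/2) = quotient_angle a"
proof -
  define c where "c = 1 / (a - 1)"
  have c: "c \<noteq> 0" using assms by (simp add: c_def)
  have "(c * f (u a y) * (c * (u a y - 1)) + y * (1 - y) * (c * d a y)^2)
      / ((c * (u a y - 1))^2 + (y * (1 - y) * (c * d a y))^2)
      = (f (u a y) * (u a y - 1) + y * (1 - y) * (d a y)^2) / ((u a y - 1)^2 + (y * (1 - y) * d a y)^2)" for y
  proof -
    have "(c * f (u a y) * (c * (u a y - 1)) + y * (1 - y) * (c * d a y)^2)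
      / ((c * (u a y - 1))^2 + (y * (1 - y) * (c * d a y))^2)
      = (c^2 * (f (u a y) * (u a y - 1) + y * (1 - y) * (d a y)^2)) / (c^2 * ((u a y - 1)^2 + (y * (1 - y) * d a y)^2))"
      by (rule arg_cong2[where f = "(/)"]) (simp_all add: power2_eq_square algebra_simps)
    then show ?thesis using c by simp
  qed
  then show ?thesis
    by (simp add: prufer_angle_def amplitude2_def quotient_angle_def flip: c_def)
qed

lemma quotient_angle_continuous:
  assumes "1 \<notin> S"
  shows "continuous_on S quotient_angle"
proof -
  have M: "2 * L * M \<ge> 0" "M \<ge> 0" using M_pos L by auto
  have uc: "continuous_on (S \<times> I) (\<lambda>p. u (fst p) (snd p))"
    by (rule continuous_on_subset[OF continuous_on_lipschitz_family[OF u_lip M(2) legendre_pairD(3)[OF pair]]]) auto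
  have dc: "continuous_on (S \<times> I) (\<lambda>p. d (fst p) (snd p))"
    by (rule continuous_on_subset[OF continuous_on_lipschitz_family[OF d_lip M(1) legendre_pairD(1)[OF pair]]]) auto
  have fc: "continuous_on UNIV f"
    by (rule lipschitz_on_continuous_on[of L]) (use lip L in \<open>auto simp: lipschitz_on_def dist_real_def\<close>)
  have fu: "continuous_on (S \<times> I) (\<lambda>p. f (u (fst p) (snd p)))"
    by (rule continuous_on_compose2[OF fc uc]) simp
  have nz: "(u a y - 1)^2 + (y * (1 - y) * d a y)^2 \<noteq> 0" if "a \<in> S" "y \<in> I" for a y
  proof -
    have a: "a \<noteq> 1" using that assms by auto
    have "amplitude2 (qu a) (qd a) y \<noteq> 0"
      using nondegenerateD(4)[OF quotient_nondegenerate[OF a] that(2)] .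
    then show ?thesis by (auto simp: amplitude2_def)
  qed
  have "continuous_on (S \<times> I) (\<lambda>p. (f (u (fst p) (snd p)) * (u (fst p) (snd p) - 1) + snd p * (1 - snd p) * (d (fst p) (snd p))^2)
      / ((u (fst p) (snd p) - 1)^2 + (snd p * (1 - snd p) * d (fst p) (snd p))^2))"
    by (intro continuous_intros uc dc fu) (use nz in \<open>auto simp: mem_Times_iff\<close>)
  then have "continuous_on (S \<times> cbox 0 (1/2)) (\<lambda>(a, y). (f (u a y) * (u a y - 1) + y * (1 - y) * (d a y)^2)
      / ((u a y - 1)^2 + (y * (1 - y) * d a y)^2))"
    by (simp add: case_prod_unfold)
  from integral_continuous_on_param[OF this]
  show ?thesis unfolding quotient_angle_def by (intro continuous_intros) simp
qed

text \<open>
  For small \<open>a\<close> the solution stays below \<open>1\<close>, by comparison with the zero solution.  There the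
  nonlinearity is negative, so the solution increases on the whole interval, and the difference
  quotient decreases because \<open>a - 1 < 0\<close>.
\<close>
lemma quotient_angle_small:
  assumes a: "0 < a" "M * a < 1" "a < 1"
  shows "quotient_angle a > - pi"
proof -
  have lt1: "u a x < 1" if "x \<in> I" for x
    using u_lip[OF that, of a 0] constant_solution(1)[OF f_nonpos that, of 0] a by auto
  have f_le: "f t \<le> 0" if "t < 1" for t
    using f_nonpos[of t] f_neg[of t] that by (cases "t \<le> 0") auto
  note D = legendre_pairD[OF pair]
  have d0: "d a x \<ge> 0" if x: "0 < x" "x \<le> 1/2" for x
  proof -
    have "0 * (1 - 0) * d a 0 \<le> x * (1 - x) * d a x"
      by (rule mono_I[OF D(6)]) (use x f_le lt1 in auto)
    moreover have "x * (1 - x) > 0" using x by simp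
    ultimately show ?thesis by (simp add: zero_le_mult_iff)
  qed
  have ua: "u a x \<ge> a" if x: "x \<in> I" for x
  proof -
    have "u a 0 \<le> u a x" by (rule mono_I[OF D(5)]) (use x d0 in auto)
    then show ?thesis by (simp add: init)
  qed
  have dpos: "d a x > 0" if x: "0 < x" "x \<le> 1/2" for x
  proof -
    obtain y where y: "0 < y" "y < x" "x * (1 - x) * d a x - 0 * (1 - 0) * d a 0 = (x - 0) * - f (u a y)"
      using mvt_I[OF D(6), of 0 x a] x by blast
    have "f (u a y) < 0" using y x ua[of y] lt1[of y] a by (intro f_neg) auto
    then have "x * (1 - x) * d a x > 0" using y(3) x by (simp add: mult_pos_neg)
    moreover have "x * (1 - x) > 0" using x by simp
    ultimately show ?thesis by (simp add: zero_less_mult_iff)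
  qed
  have a1: "a \<noteq> 1" using a by simp
  have "prufer_angle (qu a) (qd a) (qf a) (1/2) > - pi"
  proof (rule prufer_angle_gt_minus_pi[OF quotient_nondegenerate[OF a1]])
    fix x :: real assume "0 < x" "x \<le> 1/2"
    then show "1 / (a - 1) * d a x < 0" using dpos[of x] a(3) by (simp add: divide_less_0_iff)
  qed
  then show ?thesis by (simp only: quotient_angle_eq[OF a1])
qed

lemma quotient_angle_large:
  assumes "1 < a" "\<And>x. 0 < x \<Longrightarrow> x \<le> 1/2 \<Longrightarrow> d a x < 0"
  shows "quotient_angle a > - pi"
proof -
  have a1: "a \<noteq> 1" using assms by simp
  have "prufer_angle (qu a) (qd a) (qf a) (1/2) > - pi"
  proof (rule prufer_angle_gt_minus_pi[OF quotient_nondegenerate[OF a1]])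
    fix x :: real assume "0 < x" "x \<le> 1/2"
    then show "1 / (a - 1) * d a x < 0" using assms by (simp add: divide_less_0_iff)
  qed
  then show ?thesis by (simp only: quotient_angle_eq[OF a1])
qed

text \<open>
  The solution stays close to \<open>1\<close>, where the nonlinearity exceeds \<open>\<kappa> (u - 1)\<close> in absolute value.  So the
  difference quotient turns faster than the Legendre polynomial of degree \<open>2 m\<close>.
\<close>
lemma quotient_angle_near_1:
  assumes \<kappa>: "2 * real m * (2 * real m + 1) < \<kappa>"
    and f: "\<And>t. \<bar>t - 1\<bar> < \<eta> \<Longrightarrow> \<kappa> * (t - 1)^2 \<le> f t * (t - 1)"
    and a: "a \<noteq> 1" "M * \<bar>a - 1\<bar> < \<eta>"
  shows "quotient_angle a < - real m * pi"
proof -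
  obtain w e where w: "nondegenerate w e (\<lambda>x. 2 * real m * (2 * real m + 1) * w x)"
    "prufer_angle w e (\<lambda>x. 2 * real m * (2 * real m + 1) * w x) (1/2) \<le> - real m * pi"
    using even_legendre_angle by blast
  have "prufer_angle (qu a) (qd a) (qf a) (1/2) < prufer_angle w e (\<lambda>x. 2 * real m * (2 * real m + 1) * w x) (1/2)"
  proof (rule sturm_comparison[OF quotient_nondegenerate[OF a(1)] w(1) _ _ \<kappa>])
    fix x assume x: "x \<in> I"
    have "\<bar>u a x - 1\<bar> < \<eta>"
      using u_lip[OF x, of a 1] constant_solution(1)[OF f_1 x] a(2) by simp
    then have "(1 / (a - 1))^2 * (\<kappa> * (u a x - 1)^2) \<le> (1 / (a - 1))^2 * (f (u a x) * (u a x - 1))"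
      by (intro mult_left_mono f) simp_all
    then show "\<kappa> * (qu a x)^2 \<le> qf a x * qu a x"
      by (simp only: power_mult_distrib) (simp add: power2_eq_square mult_ac)
  qed simp
  then show ?thesis using w(2) unfolding quotient_angle_eq[OF a(1)] by linarith
qed

lemma node_of_quotient_angle:
  assumes "a \<noteq> 1" "quotient_angle a = - real i * pi"
  shows "d a (1/2) = 0"
proof -
  have "prufer_angle (qu a) (qd a) (qf a) (1/2) = of_int (- int i) * pi"
    unfolding quotient_angle_eq[OF assms(1)] using assms(2) by simp
  then have "1 / (a - 1) * d a (1/2) = 0"
    using prufer_angle_at_node[OF quotient_nondegenerate[OF assms(1)]] by blast
  then show ?thesis using assms(1) by simp
qed

text \<open>
  The quotient angle is below \<open>- m \<pi>\<close> on both sides of \<open>1\<close> and above \<open>- \<pi>\<close> near \<open>0\<close> and at \<open>A\<close>.  Hence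
  each of the \<open>m\<close> levels is attained on both sides, and the constant solution \<open>1\<close> makes the count odd.
\<close>
lemma many_nodes:
  assumes \<kappa>: "2 * real m * (2 * real m + 1) < \<kappa>" and \<eta>: "\<eta> > 0"
    and f: "\<And>t. \<bar>t - 1\<bar> < \<eta> \<Longrightarrow> \<kappa> * (t - 1)^2 \<le> f t * (t - 1)"
    and A: "1 < A" "\<And>x. 0 < x \<Longrightarrow> x \<le> 1/2 \<Longrightarrow> d A x < 0"
  shows "\<exists>T. finite T \<and> card T = 2 * m + 1 \<and> T \<subseteq> {0<..A} \<and> (\<forall>a\<in>T. d a (1/2) = 0)"
proof -
  define \<delta> where "\<delta> = min (min (1/4) ((A - 1) / 2)) (\<eta> / (2 * M))"
  have "\<delta> \<le> (A - 1) / 2" unfolding \<delta>_def by linarith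
  then have \<delta>: "\<delta> > 0" "\<delta> \<le> 1/4" "\<delta> < A - 1" using M_pos \<eta> A(1) by (simp_all add: \<delta>_def)
  have "M * \<delta> \<le> M * (\<eta> / (2 * M))" using M_pos by (intro mult_left_mono) (auto simp: \<delta>_def)
  then have M\<delta>: "M * \<delta> < \<eta>" using M_pos \<eta> by (simp add: field_simps)
  (* Below s the solution stays below 1; delta keeps the solutions from 1 - delta and 1 + delta
     within eta of 1. *)
  define s where "s = min (1/4) (1 / (2 * M))"
  have "M * s \<le> M * (1 / (2 * M))" using M_pos by (intro mult_left_mono) (auto simp: s_def)
  then have s: "0 < s" "s \<le> 1/4" "M * s < 1" using M_pos by (auto simp: s_def)
  have lo: "quotient_angle (1 - \<delta>) < - real m * pi"
    by (rule quotient_angle_near_1[OF \<kappa> f]) (use \<delta> M\<delta> in auto)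
  have hi: "quotient_angle (1 + \<delta>) < - real m * pi"
    by (rule quotient_angle_near_1[OF \<kappa> f]) (use \<delta> M\<delta> in auto)
  have small: "quotient_angle s > - pi" using s by (intro quotient_angle_small) auto
  have large: "quotient_angle A > - pi" using A by (intro quotient_angle_large) auto
  obtain X where X: "X \<subseteq> {s..1 - \<delta>}" "finite X" "card X = m" "\<And>a. a \<in> X \<Longrightarrow> \<exists>i. quotient_angle a = - real i * pi"
  proof (rule angle_levels)
    show "continuous_on {s..1 - \<delta>} quotient_angle" using \<delta> by (intro quotient_angle_continuous) auto
    show "s \<le> 1 - \<delta>" using s \<delta> by simp
    show "quotient_angle (1 - \<delta>) \<le> - real m * pi \<and> - pi \<le> quotient_angle s \<or>
        quotient_angle s \<le> - real m * pi \<and> - pi \<le> quotient_angle (1 - \<delta>)" using lo small by auto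
  qed blast
  obtain Y where Y: "Y \<subseteq> {1 + \<delta>..A}" "finite Y" "card Y = m" "\<And>a. a \<in> Y \<Longrightarrow> \<exists>i. quotient_angle a = - real i * pi"
  proof (rule angle_levels)
    show "continuous_on {1 + \<delta>..A} quotient_angle" using \<delta> by (intro quotient_angle_continuous) auto
    show "1 + \<delta> \<le> A" using \<delta> by simp
    show "quotient_angle A \<le> - real m * pi \<and> - pi \<le> quotient_angle (1 + \<delta>) \<or>
        quotient_angle (1 + \<delta>) \<le> - real m * pi \<and> - pi \<le> quotient_angle A" using hi large by auto
  qed blast
  let ?T = "insert 1 (X \<union> Y)"
  have Xb: "s \<le> a \<and> a \<le> 1 - \<delta>" if "a \<in> X" for a using X(1) that by auto
  have Yb: "1 + \<delta> \<le> a \<and> a \<le> A" if "a \<in> Y" for a using Y(1) that by auto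
  have "X \<inter> Y = {}"
  proof (rule ccontr)
    assume "X \<inter> Y \<noteq> {}"
    then obtain a where "a \<in> X" "a \<in> Y" by blast
    then show False using Xb[of a] Yb[of a] \<delta>(1) by linarith
  qed
  moreover have "1 \<notin> X \<union> Y" using Xb[of 1] Yb[of 1] \<delta>(1) by auto
  ultimately have "card ?T = 2 * m + 1" using X(2,3) Y(2,3) by (simp add: card_Un_disjoint)
  moreover have "?T \<subseteq> {0<..A}"
  proof
    fix a assume "a \<in> ?T"
    then show "a \<in> {0<..A}" using Xb[of a] Yb[of a] s(1) \<delta>(1,2) A(1) by auto
  qed
  moreover have "d a (1/2) = 0" if "a \<in> ?T" for a
  proof (cases "a = 1")
    case True then show ?thesis using constant_solution(2)[OF f_1, of "1/2"] by simp
  next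
    case False
    then obtain i where "quotient_angle a = - real i * pi" using \<open>a \<in> ?T\<close> \<open>a \<noteq> 1\<close> X(4) Y(4) by blast
    then show ?thesis using node_of_quotient_angle False by blast
  qed
  moreover have "finite ?T" using X(2) Y(2) by simp
  ultimately show ?thesis by blast
qed

text \<open>
  At a minimum the derivative vanishes: in the interior by Fermat, at \<open>1/2\<close> by hypothesis.  If the
  minimal value \<open>c\<close> were nonpositive, then \<open>f c = 0\<close> and the constant \<open>c\<close> would solve the same
  initial value problem at that point, so \<open>u a\<close> would be constant, contrary to \<open>u a 0 = a > 0\<close>.
\<close>
lemma positive:
  assumes a: "a > 0" and node: "d a (1/2) = 0" and x: "x \<in> I"
  shows "u a x > 0"
proof -
  note D = legendre_pairD[OF pair]
  obtain z where z: "z \<in> I" and min: "\<And>y. y \<in> I \<Longrightarrow> u a z \<le> u a y"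
    using continuous_attains_inf[of I "u a"] D(3) by auto
  have "u a z > 0"
  proof (rule ccontr)
    assume neg: "\<not> u a z > 0"
    then have z0: "0 < z" using a z init[of a] by (cases "z = 0") auto
    have dz: "d a z = 0"
    proof (cases "z = 1/2")
      case False
      then have zi: "z \<in> interior I" using z z0 by auto
      have 1: "(u a has_real_derivative d a z) (at z)"
        using D(5)[OF z, of a] at_within_interior[OF zi] by simp
      have 2: "\<forall>y. \<bar>z - y\<bar> < min z (1/2 - z) \<longrightarrow> u a z \<le> u a y"
        by (intro allI impI min) (auto simp: min_def abs_less_iff split: if_splits)
      show ?thesis by (rule DERIV_local_min[OF 1 _ 2]) (use z z0 False in auto)
    next
      case True
      show ?thesis unfolding True by (rule node)
    qed
    define c where "c = u a z"
    have c: "f c = 0" using neg by (simp add: c_def f_nonpos)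
    have P: "legendre_pair (\<lambda>x. u a x - c) (\<lambda>x. d a x - 0) (\<lambda>x. f (u a x) - 0)"
      by (intro legendre_pair_diff pair legendre_pair_const)
    have "amplitude2 (\<lambda>x. u a x - c) (\<lambda>x. d a x - 0) z > 0"
    proof (rule amplitude2_pos[OF P _ _ z])
      show "\<bar>f (u a x) - 0\<bar> \<le> L * \<bar>u a x - c\<bar>" for x using lip[of "u a x" c] c by simp
      show "u a 0 - c \<noteq> 0" using neg a by (simp add: init c_def)
    qed
    then show False by (simp add: amplitude2_def dz c_def)
  qed
  then show ?thesis using min[OF x] by linarith
qed

end

section \<open>The power nonlinearity\<close>

lemma powr_diff_bound:
  fixes q s t B :: real
  assumes q: "q > 1" and st: "0 \<le> s" "s \<le> t" "t \<le> B"
  shows "\<bar>t powr q - s powr q\<bar> \<le> q * B powr (q - 1) * (t - s)"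
proof -
  show ?thesis
  proof (cases "s = 0")
    case True
    have "t powr q = t powr (q - 1) * t" using powr_mult_base[of t "q - 1"] st by (simp add: mult.commute)
    also have "\<dots> \<le> B powr (q - 1) * t" using st q by (intro mult_right_mono powr_mono2) auto
    also have "\<dots> \<le> q * (B powr (q - 1) * t)" using q st mult_right_mono[of 1 q "B powr (q - 1) * t"] by simp
    finally show ?thesis using True by simp
  next
    case s0: False
    show ?thesis
    proof (cases "s = t")
      case False
      have "\<exists>z>s. z < t \<and> t powr q - s powr q = (t - s) * (q * z powr (q - 1))"
        using False s0 st by (intro MVT2 has_real_derivative_powr) auto
      then obtain z where z: "s < z" "z < t" "t powr q - s powr q = (t - s) * (q * z powr (q - 1))" by blast
      have "q * z powr (q - 1) \<le> q * B powr (q - 1)"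
        using z st q by (intro mult_left_mono powr_mono2) auto
      then have "(t - s) * (q * z powr (q - 1)) \<le> (t - s) * (q * B powr (q - 1))"
        by (rule mult_left_mono) (use st in simp)
      moreover have "0 \<le> (t - s) * (q * z powr (q - 1))"
        using st q by (intro mult_nonneg_nonneg) auto
      then have "\<bar>t powr q - s powr q\<bar> = (t - s) * (q * z powr (q - 1))"
        unfolding z(3) by (rule abs_of_nonneg)
      ultimately show ?thesis by (simp only: mult.commute)
    qed simp
  qed
qed

text \<open>
  The nonlinearity \<open>\<mu> (u\<^sup>q - u)\<close>, made globally Lipschitz by restricting its argument to \<open>[0, B]\<close>.
\<close>
definition truncated_power :: "real \<Rightarrow> real \<Rightarrow> real \<Rightarrow> real \<Rightarrow> real" where
  "truncated_power \<mu> q B t = \<mu> * (max 0 (min B t) powr q - max 0 (min B t))"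

lemma truncated_power_lipschitz:
  assumes "q > 1" "\<mu> > 0" "B > 0"
  shows "\<bar>truncated_power \<mu> q B s - truncated_power \<mu> q B t\<bar> \<le> \<mu> * (q * B powr (q - 1) + 1) * \<bar>s - t\<bar>"
proof -
  have *: "\<bar>truncated_power \<mu> q B t - truncated_power \<mu> q B s\<bar> \<le> \<mu> * (q * B powr (q - 1) + 1) * (t - s)"
    if st: "s \<le> t" for s t
  proof -
    define s' where "s' = max 0 (min B s)"
    define t' where "t' = max 0 (min B t)"
    have c: "0 \<le> s'" "s' \<le> t'" "t' \<le> B" "t' - s' \<le> t - s" 
      unfolding s'_def t'_def using st assms(3) by linarith+
    let ?C = "q * B powr (q - 1)"
    have C: "?C \<ge> 0" using assms by simp
    have "\<bar>t' powr q - s' powr q\<bar> \<le> ?C * (t' - s')"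
      by (rule powr_diff_bound[OF assms(1) c(1-3)])
    then have "\<bar>(t' powr q - t') - (s' powr q - s')\<bar> \<le> ?C * (t' - s') + (t' - s')"
      using c(2) by linarith
    also have "\<dots> = (?C + 1) * (t' - s')" by (simp add: distrib_right)
    also have "\<dots> \<le> (?C + 1) * (t - s)" using c(4) C by (intro mult_left_mono) auto
    finally have "\<mu> * \<bar>(t' powr q - t') - (s' powr q - s')\<bar> \<le> \<mu> * ((?C + 1) * (t - s))"
      using assms(2) by (intro mult_left_mono) auto
    moreover have "\<bar>truncated_power \<mu> q B t - truncated_power \<mu> q B s\<bar> = \<mu> * \<bar>(t' powr q - t') - (s' powr q - s')\<bar>"
      using assms(2) unfolding truncated_power_def s'_def[symmetric] t'_def[symmetric]
      by (simp add: abs_mult flip: right_diff_distrib)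
    ultimately show ?thesis by (simp add: mult.assoc)
  qed
  show ?thesis
  proof (cases "s \<le> t")
    case True then show ?thesis using *[OF True] by (simp add: abs_minus_commute)
  next
    case False then show ?thesis using *[of t s] by simp
  qed
qed

lemma truncated_power_eq: "0 \<le> t \<Longrightarrow> t \<le> B \<Longrightarrow> truncated_power \<mu> q B t = \<mu> * (t powr q - t)"
  by (simp add: truncated_power_def)

lemma truncated_power_bounds:
  assumes q: "q > 1" and \<mu>: "\<mu> > 0" and B: "B \<ge> 1"
  shows "- \<mu> \<le> truncated_power \<mu> q B t" "truncated_power \<mu> q B t \<le> \<mu> * B powr q"
proof -
  define s where "s = max 0 (min B t)"
  have s: "0 \<le> s" "s \<le> B" unfolding s_def using B by linarith+
  have "- 1 \<le> s powr q - s"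
  proof (cases "s \<le> 1")
    case False
    then have "s powr 1 \<le> s powr q" using q by (intro powr_mono) auto
    then show ?thesis using False by simp
  qed (use powr_ge_zero[of s q] in linarith)
  then have "\<mu> * (- 1) \<le> \<mu> * (s powr q - s)" using \<mu> by (intro mult_left_mono) auto
  then show "- \<mu> \<le> truncated_power \<mu> q B t" by (simp add: truncated_power_def s_def)
  have "s powr q \<le> B powr q" using s q by (intro powr_mono2) auto
  then have "s powr q - s \<le> B powr q" using s by linarith
  then show "truncated_power \<mu> q B t \<le> \<mu> * B powr q"
    unfolding truncated_power_def s_def[symmetric] using \<mu> by (intro mult_left_mono) auto
qed

text \<open>
  The derivative of \<open>t powr q - t\<close> at \<open>1\<close> is \<open>q - 1\<close>, so every smaller slope is exceeded nearby.
\<close>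
lemma truncated_power_near_1:
  assumes q: "q > 1" and \<mu>: "\<mu> > 0" and B: "B > 1" and \<kappa>: "\<kappa> < \<mu> * (q - 1)"
  shows "\<exists>\<eta>>0. \<forall>t. \<bar>t - 1\<bar> < \<eta> \<longrightarrow> \<kappa> * (t - 1)^2 \<le> truncated_power \<mu> q B t * (t - 1)"
proof -
  let ?h = "\<lambda>t. t powr q - t :: real"
  have "(?h has_real_derivative (q * 1 powr (q - 1) - 1)) (at 1)"
    by (intro DERIV_diff has_real_derivative_powr DERIV_ident) simp
  then have "((\<lambda>t. (?h t - ?h 1) / (t - 1)) \<longlongrightarrow> q - 1) (at 1)"
    unfolding has_field_derivative_iff by simp
  moreover have "\<kappa> / \<mu> < q - 1" using \<kappa> \<mu> by (simp add: field_simps)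
  ultimately have "\<forall>\<^sub>F t in at 1. \<kappa> / \<mu> < (?h t - ?h 1) / (t - 1)" by (rule order_tendstoD(1))
  then obtain e where e: "e > 0" "\<And>t. t \<noteq> 1 \<Longrightarrow> dist t 1 < e \<Longrightarrow> \<kappa> / \<mu> < (?h t - ?h 1) / (t - 1)"
    unfolding eventually_at by auto
  define \<eta> where "\<eta> = min e (min 1 (B - 1))"
  have "\<kappa> * (t - 1)^2 \<le> truncated_power \<mu> q B t * (t - 1)" if t: "\<bar>t - 1\<bar> < \<eta>" for t
  proof (cases "t = 1")
    case False
    have tB: "0 \<le> t" "t \<le> B" using t by (auto simp: \<eta>_def abs_less_iff)
    have "\<kappa> / \<mu> \<le> ?h t / (t - 1)" using e(2)[OF False] t by (simp add: \<eta>_def dist_real_def)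
    then have "\<mu> * (t - 1)^2 * (\<kappa> / \<mu>) \<le> \<mu> * (t - 1)^2 * (?h t / (t - 1))"
      using \<mu> by (intro mult_left_mono) auto
    also have "\<mu> * (t - 1)^2 * (\<kappa> / \<mu>) = \<kappa> * (t - 1)^2" using \<mu> by simp
    also have "\<mu> * (t - 1)^2 * (?h t / (t - 1)) = \<mu> * ?h t * (t - 1)"
      using False by (simp add: power2_eq_square)
    finally show ?thesis by (simp add: truncated_power_eq[OF tB])
  qed simp
  moreover have "\<eta> > 0" using e(1) B by (simp add: \<eta>_def)
  ultimately show ?thesis by blast
qed

text \<open>
  A lower bound on \<open>g\<close> bounds the flux by \<open>\<mu> x\<close> from above, hence the derivative by \<open>2 \<mu>\<close>.
\<close>
lemma legendre_upper_bound:
  assumes P: "legendre_pair u d g" and g: "\<And>x. x \<in> I \<Longrightarrow> - \<mu> \<le> g x" and x: "x \<in> I" and \<mu>: "\<mu> \<ge> 0"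
  shows "u x \<le> u 0 + \<mu>"
proof -
  note D = legendre_pairD[OF P]
  have dle: "d z \<le> 2 * \<mu>" if z: "0 < z" "z \<le> 1/2" for z
  proof -
    obtain w where w: "0 < w" "w < z" "z * (1 - z) * d z - 0 * (1 - 0) * d 0 = (z - 0) * - g w"
      using mvt_I[OF D(6), of 0 z] z by blast
    then have "z * ((1 - z) * d z) = z * (- g w)" by (simp add: mult.assoc)
    then have "(1 - z) * d z = - g w" using z by (simp only: mult_cancel_left) simp
    then have "(1 - z) * d z \<le> \<mu>" using z w g[of w] by auto
    moreover have "(1 - z) * (2 * \<mu>) \<ge> (1/2) * (2 * \<mu>)" using z \<mu> by (intro mult_right_mono) auto
    ultimately have "(1 - z) * d z \<le> (1 - z) * (2 * \<mu>)" by linarith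
    then show ?thesis using z by (simp add: mult_le_cancel_left_pos)
  qed
  have Dz: "((\<lambda>z. u z - 2 * \<mu> * z) has_real_derivative d z - 2 * \<mu>) (at z within I)" if "z \<in> I" for z
    by (intro DERIV_diff D(5) that DERIV_cmult_Id)
  have "u x - 2 * \<mu> * x \<le> u 0 - 2 * \<mu> * 0"
  proof (rule antimono_I[OF Dz])
    fix z assume "0 < z" "z < x"
    then show "d z - 2 * \<mu> \<le> 0" using dle[of z] x by simp
  qed (use x in simp_all)
  moreover have "2 * \<mu> * x \<le> 2 * \<mu> * (1/2)" using x \<mu> by (intro mult_left_mono) auto
  ultimately show ?thesis by simp
qed

text \<open>
  The bound on \<open>(A / 2) powr (q - 1)\<close> gives \<open>u\<^sup>q - u \<ge> u\<^sup>q / 2\<close> for \<open>u \<ge> A / 2\<close>.  Up to \<open>x0\<close> the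
  solution stays above \<open>A / 2\<close>, so the nonlinearity is at least \<open>c\<close> and the flux
  is at most \<open>- c x\<close>; moreover \<open>c x0 = A / (8 4\<^sup>q) \<ge> \<mu>\<close>.  Afterwards the flux can increase only at
  rate \<open>\<mu>\<close>, hence by at most \<open>\<mu> / 2\<close>, and remains negative.
\<close>
lemma large_start_decreasing:
  assumes q: "q > 1" and \<mu>: "\<mu> > 0"
    and A: "A \<ge> 8 * 4 powr q * \<mu>" "(A / 2) powr (q - 1) \<ge> 2" "A \<ge> 2" "A \<ge> \<mu>"
    and P: "legendre_pair u d (\<lambda>x. truncated_power \<mu> q (2 * A) (u x))" and u0: "u 0 = A"
    and x: "0 < x" "x \<le> 1/2"
  shows "d x < 0"
proof -
  let ?f = "truncated_power \<mu> q (2 * A)"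
  define K where "K = \<mu> * (2 * A) powr q"
  define c where "c = \<mu> * ((A / 2) powr q / 2)"
  define x0 where "x0 = A / (4 * K)"
  note D = legendre_pairD[OF P]
  have f: "- \<mu> \<le> ?f t" "?f t \<le> K" for t
    using truncated_power_bounds[OF q \<mu>, of "2 * A" t] A by (auto simp: K_def)
  have "(2 * A) powr 0 \<le> (2 * A) powr q" using A q by (intro powr_mono) auto
  then have K\<mu>: "\<mu> \<le> K" using \<mu> A mult_left_mono[of 1 "(2 * A) powr q" \<mu>] by (simp add: K_def)
  have K0: "K > 0" using K\<mu> \<mu> by linarith
  have c0: "c > 0" using \<mu> A by (simp add: c_def)
  have fc: "c \<le> ?f t" if t: "A / 2 \<le> t" "t \<le> 2 * A" for t
  proof -
    have "2 * t \<le> t powr (q - 1) * t"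
      using order_trans[OF A(2) powr_mono2[of "q - 1" "A / 2" t]] t A q by (intro mult_right_mono) auto
    also have "\<dots> = t powr q" using t A by (simp add: powr_diff)
    finally have "t powr q / 2 \<le> t powr q - t" by simp
    moreover have "(A / 2) powr q \<le> t powr q" using t A q by (intro powr_mono2) auto
    ultimately have "(A / 2) powr q / 2 \<le> t powr q - t" by linarith
    then show ?thesis using \<mu> t A by (simp add: truncated_power_eq c_def)
  qed
  have dK: "\<bar>d y\<bar> \<le> 2 * K" if "y \<in> I" for y
  proof (rule legendre_deriv_bound[OF P _ that])
    show "\<bar>?f (u z)\<bar> \<le> K" for z using f[of "u z"] K\<mu> by linarith
  qed
  have upper: "u y \<le> 2 * A" if y: "0 \<le> y" "y \<le> 1/2" for y
  proof -
    have "u y \<le> u 0 + \<mu>"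
      by (rule legendre_upper_bound[OF P f(1)]) (use y \<mu> in auto)
    then show ?thesis using u0 A by simp
  qed
  have lower: "A / 2 \<le> u y" if y: "0 \<le> y" "y \<le> 1/2" "y \<le> x0" for y
  proof -
    have Dz: "((\<lambda>z. u z + 2 * K * z) has_real_derivative d z + 2 * K) (at z within I)" if "z \<in> I" for z
      by (intro DERIV_add D(5) that DERIV_cmult_Id)
    have "u 0 + 2 * K * 0 \<le> u y + 2 * K * y"
    proof (rule mono_I[OF Dz])
      fix z assume "0 < z" "z < y"
      then show "0 \<le> d z + 2 * K" using dK[of z] y by (simp add: abs_le_iff)
    qed (use y in simp_all)
    moreover have "2 * K * y \<le> 2 * K * x0" using y K0 by (intro mult_left_mono) auto
    moreover have "2 * K * x0 = A / 2" using K0 by (simp add: x0_def)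
    ultimately show ?thesis using u0 by linarith
  qed
  have flux: "y * (1 - y) * d y \<le> - c * y" if y: "0 < y" "y \<le> 1/2" "y \<le> x0" for y
  proof -
    obtain w where w: "0 < w" "w < y" "y * (1 - y) * d y - 0 * (1 - 0) * d 0 = (y - 0) * - ?f (u w)"
      using mvt_I[OF D(6), of 0 y] y by blast
    have "c \<le> ?f (u w)" using w y by (intro fc lower upper) auto
    then have "y * c \<le> y * ?f (u w)" using y by (intro mult_left_mono) auto
    then show ?thesis using w(3) by (simp add: mult.commute)
  qed
  have x00: "x0 > 0" using A K0 by (simp add: x0_def)
  have "x * (1 - x) * d x < 0"
  proof (cases "x \<le> x0")
    case True
    have "c * x > 0" using c0 x by simp
    then show ?thesis using flux[OF x True] by linarith
  next
    case False
    have "x0 * (1 - x0) * d x0 \<le> - c * x0" using flux[of x0] False x x00 by auto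
    moreover have "c * x0 \<ge> \<mu>"
    proof -
      have A0: "A > 0" using A by linarith
      have "(2 * A) powr q = 4 powr q * (A / 2) powr q"
        using A0 by (simp flip: powr_mult)
      then have eq: "c * x0 = A / (8 * 4 powr q)"
        using A0 \<mu> by (simp add: c_def x0_def K_def field_simps)
      have "\<mu> \<le> A / (8 * 4 powr q)"
        using A(1) by (subst pos_le_divide_eq) (simp_all add: mult_ac)
      then show ?thesis unfolding eq .
    qed
    moreover obtain w where w: "x0 < w" "w < x" "x * (1 - x) * d x - x0 * (1 - x0) * d x0 = (x - x0) * - ?f (u w)"
      using mvt_I[OF D(6), of x0 x] False x x00 by (metis less_imp_le not_le)
    moreover have "(x - x0) * - ?f (u w) \<le> (x - x0) * \<mu>"
      using f(1)[of "u w"] False by (intro mult_left_mono) auto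
    moreover have "(x - x0) * \<mu> \<le> 1/2 * \<mu>" using x x00 \<mu> by (intro mult_right_mono) auto
    ultimately show ?thesis using \<mu> by linarith
  qed
  then show ?thesis using x by (simp add: mult_less_0_iff)
qed

section \<open>Regularity and reflection\<close>

text \<open>
  Differentiation under the integral sign.
\<close>
lemma radial_average_deriv:
  assumes g: "\<And>x. x \<in> I \<Longrightarrow> (g has_real_derivative g' x) (at x within I)" and g': "continuous_on I g'"
  shows "\<exists>h. continuous_on I h \<and> (\<forall>x\<in>I. (radial_average g has_real_derivative h x) (at x within I))"
proof -
  define h where "h = (\<lambda>x. integral {0..1} (\<lambda>t. t * g' (x * t)))"
  have gc: "continuous_on I g"
    unfolding continuous_on_eq_continuous_within using g DERIV_continuous by blast
  have cont: "continuous_on (I \<times> cbox 0 1) (\<lambda>(x, t). t * g' (x * t))"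
    using continuous_on_mult[OF continuous_on_snd[OF continuous_on_id] continuous_on_dilation[OF g'], of]
    by (simp add: case_prod_unfold)
  have inI: "x * t \<in> I" if "x \<in> I" "t \<in> {0..1}" for x t
    using that mult_mono[of x "1/2" t 1] by simp
  have "continuous_on I h"
    unfolding h_def using integral_continuous_on_param[OF cont] by simp
  moreover have "(radial_average g has_real_derivative h x) (at x within I)" if x: "x \<in> I" for x
  proof -
    have "((\<lambda>x. integral (cbox 0 1) (\<lambda>t. g (x * t))) has_real_derivative
        integral (cbox 0 1) (\<lambda>t. t * g' (x * t))) (at x within I)"
    proof (rule leibniz_rule_field_derivative[OF _ _ cont x])
      fix y t :: real assume y: "y \<in> I" and t: "t \<in> cbox 0 1"
      have "(g has_real_derivative g' (y * t)) (at (y * t) within (\<lambda>y. y * t) ` I)"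
        by (rule DERIV_subset[OF g]) (use inI y t in auto)
      moreover have "((\<lambda>y. y * t) has_real_derivative t) (at y within I)"
        by (auto intro!: derivative_eq_intros)
      ultimately show "((\<lambda>y. g (y * t)) has_real_derivative t * g' (y * t)) (at y within I)"
        using DERIV_image_chain[of g "g' (y * t)" "\<lambda>y. y * t" y I t] by (simp add: o_def mult.commute)
    next
      fix y :: real assume y: "y \<in> I"
      have "continuous_on {0..1} (\<lambda>t. g (y * t))"
        by (rule continuous_on_compose2[OF gc]) (use inI y in \<open>auto intro!: continuous_intros\<close>)
      then show "(\<lambda>t. g (y * t)) integrable_on cbox 0 1"
        using integrable_continuous_real by simp
    qed simp
    then show ?thesis by (simp add: h_def radial_average_def[abs_def])
  qed
  ultimately show ?thesis by blast
qed

text \<open>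
  The derivative of a solution is \<open>- radial_average g x / (1 - x)\<close>, which inherits differentiability
  from \<open>g\<close> also at \<open>x = 0\<close>.
\<close>
lemma legendre_regularity:
  assumes P: "legendre_pair v d g"
    and g: "\<And>x. x \<in> I \<Longrightarrow> (g has_real_derivative g' x) (at x within I)" and g': "continuous_on I g'"
  shows "\<exists>d'. continuous_on I d' \<and> (\<forall>x\<in>I. (d has_real_derivative d' x) (at x within I)) \<and>
     (\<forall>x\<in>I. x * (1 - x) * d' x + (1 - 2 * x) * d x = - g x)"
proof -
  obtain w e where w: "legendre_pair w e g" "\<And>x. x \<in> I \<Longrightarrow> e x = - radial_average g x / (1 - x)"
    using legendre_solve[OF legendre_pairD(2)[OF P], of 0] by blast
  have d: "d x = - radial_average g x / (1 - x)" if "x \<in> I" for x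
  proof -
    have "\<bar>d x - e x\<bar> \<le> 2 * 0"
      by (rule legendre_deriv_bound[OF legendre_pair_diff[OF P w(1)] _ that]) simp
    then show ?thesis using w(2)[OF that] by simp
  qed
  obtain h where h: "continuous_on I h" "\<And>x. x \<in> I \<Longrightarrow> (radial_average g has_real_derivative h x) (at x within I)"
    using radial_average_deriv[OF g g'] by blast
  define d' where "d' = (\<lambda>x. - (h x * (1 - x) + radial_average g x) / (1 - x)^2)"
  have "continuous_on I d'"
    unfolding d'_def by (intro continuous_intros h continuous_radial_average legendre_pairD(2)[OF P]) auto
  moreover have Dd: "(d has_real_derivative d' x) (at x within I)" if x: "x \<in> I" for x
  proof (rule has_field_derivative_transform_within[OF _ zero_less_one x])
    show "((\<lambda>x. - radial_average g x / (1 - x)) has_real_derivative d' x) (at x within I)"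
      using x unfolding d'_def
      by (auto intro!: derivative_eq_intros h(2)[OF x] simp: power2_eq_square divide_simps)
  qed (use d in simp)
  moreover have "x * (1 - x) * d' x + (1 - 2 * x) * d x = - g x" if x: "x \<in> I" for x
  proof (rule vector_derivative_unique_within_closed_interval[of 0 "1/2" x])
    have "((\<lambda>x. x * (1 - x) * d x) has_real_derivative x * (1 - x) * d' x + (1 - 2 * x) * d x) (at x within I)"
      by (auto intro!: derivative_eq_intros Dd[OF x])
    then show "((\<lambda>x. x * (1 - x) * d x) has_vector_derivative x * (1 - x) * d' x + (1 - 2 * x) * d x) (at x within cbox 0 (1/2))"
      by (simp add: has_real_derivative_iff_has_vector_derivative)
    show "((\<lambda>x. x * (1 - x) * d x) has_vector_derivative - g x) (at x within cbox 0 (1/2))"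
      using legendre_pairD(6)[OF P x] by (simp add: has_real_derivative_iff_has_vector_derivative)
  qed (use x in auto)
  ultimately show ?thesis by blast
qed

text \<open>
  Extension across \<open>1/2\<close>, even for \<open>\<sigma> = 1\<close> and odd for \<open>\<sigma> = - 1\<close>.  The matching conditions at \<open>1/2\<close>
  say that the one-sided values and derivatives agree.
\<close>
lemma reflect_deriv:
  fixes \<sigma> :: real
  assumes v: "\<And>x. x \<in> I \<Longrightarrow> (v has_real_derivative v' x) (at x within I)"
    and val: "v (1/2) = \<sigma> * v (1/2)" and der: "v' (1/2) = - \<sigma> * v' (1/2)" and x: "x \<in> {0..1}"
  shows "((\<lambda>x. if x \<in> I then v x else \<sigma> * v (1 - x)) has_real_derivative
     (if x \<in> I then v' x else - \<sigma> * v' (1 - x))) (at x within {0..1})"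
  unfolding has_real_derivative_iff_has_vector_derivative
proof (rule has_vector_derivative_If_within_closures[where T = "{1/2..1}"])
  have cl: "closure I \<inter> closure {1/2..1} = {1/2::real}" by auto
  show "x \<in> I \<union> {1/2..1}" "{0..1} = I \<union> {1/2..1::real}" using x by auto
  have I1: "I \<union> (closure I \<inter> closure {1/2..1}) = I" unfolding cl by auto
  have I2: "{1/2..1} \<union> (closure I \<inter> closure {1/2..1}) = {1/2..1::real}" unfolding cl by auto
  show "(v has_vector_derivative v' x) (at x within I \<union> (closure I \<inter> closure {1/2..1}))"
    if "x \<in> I \<union> (closure I \<inter> closure {1/2..1})"
    using that v[of x] unfolding I1 has_real_derivative_iff_has_vector_derivative by blast
  show "((\<lambda>x. \<sigma> * v (1 - x)) has_vector_derivative - \<sigma> * v' (1 - x)) (at x within {1/2..1} \<union> (closure I \<inter> closure {1/2..1}))"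
    if "x \<in> {1/2..1} \<union> (closure I \<inter> closure {1/2..1})"
  proof -
    have x: "x \<in> {1/2..1}" using that unfolding I2 .
    have im: "(\<lambda>x. 1 - x) ` {1/2..1} = I"
    proof
      show "I \<subseteq> (\<lambda>x. 1 - x) ` {1/2..1}"
      proof
        fix y :: real assume "y \<in> I"
        then show "y \<in> (\<lambda>x. 1 - x) ` {1/2..1}" by (intro image_eqI[of _ _ "1 - y"]) auto
      qed
    qed auto
    have "(v has_real_derivative v' (1 - x)) (at (1 - x) within (\<lambda>x. 1 - x) ` {1/2..1})"
      unfolding im using x by (intro v) auto
    moreover have "((\<lambda>x. 1 - x) has_real_derivative -1) (at x within {1/2..1})"
      by (auto intro!: derivative_eq_intros)
    ultimately have "((\<lambda>x. v (1 - x)) has_real_derivative v' (1 - x) * -1) (at x within {1/2..1})"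
      using DERIV_image_chain[of v "v' (1 - x)" "\<lambda>x. 1 - x" x "{1/2..1}" "-1"] by (simp add: o_def)
    from DERIV_cmult[OF this, of \<sigma>]
    show ?thesis unfolding I2 has_real_derivative_iff_has_vector_derivative by simp
  qed
  show "v x = \<sigma> * v (1 - x)" if "x \<in> closure I" "x \<in> closure {1/2..1}"
  proof -
    have "x = 1/2" using that cl by blast
    show ?thesis unfolding \<open>x = 1/2\<close> using val by simp
  qed
  show "v' x = - \<sigma> * v' (1 - x)" if "x \<in> closure I" "x \<in> closure {1/2..1}"
  proof -
    have "x = 1/2" using that cl by blast
    show ?thesis unfolding \<open>x = 1/2\<close> using der by simp
  qed
qed

text \<open>
  The ordinary differential equation for the profile of an invariant solution, with one-sided
  derivatives at the endpoints \<open>0\<close> and \<open>1\<close>.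
\<close>
definition axial_solution :: "real \<Rightarrow> real \<Rightarrow> (real \<Rightarrow> real) \<Rightarrow> bool" where
  "axial_solution \<mu> q U \<longleftrightarrow> (\<exists>U' U''. continuous_on {0..1} U'' \<and> (\<forall>x\<in>{0..1}. U x > 0 \<and>
     (U has_real_derivative U' x) (at x within {0..1}) \<and>
     (U' has_real_derivative U'' x) (at x within {0..1}) \<and>
     x * (1 - x) * U'' x + (1 - 2 * x) * U' x = - \<mu> * (U x powr q - U x)))"

text \<open>
  The even reflection of \<open>u\<close> is twice differentiable at \<open>1/2\<close> because \<open>d (1/2) = 0\<close>.  The factor
  \<open>1\<close> in the statement is the sign \<open>\<sigma>\<close> of \<open>reflect_deriv\<close>.
\<close>
lemma reflect_axial_solution:
  assumes P: "legendre_pair u d (\<lambda>x. \<mu> * (u x powr q - u x))"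
    and pos: "\<And>x. x \<in> I \<Longrightarrow> u x > 0" and node: "d (1/2) = 0"
  shows "axial_solution \<mu> q (\<lambda>x. if x \<in> I then u x else 1 * u (1 - x))"
proof -
  have g: "((\<lambda>x. \<mu> * (u x powr q - u x)) has_real_derivative \<mu> * (q * u x powr (q - 1) * d x - d x)) (at x within I)"
    if x: "x \<in> I" for x
    by (rule DERIV_cmult, rule DERIV_diff,
        rule DERIV_chain2[OF has_real_derivative_powr[OF pos[OF x]] legendre_pairD(5)[OF P x]],
        rule legendre_pairD(5)[OF P x])
  have nz: "\<forall>x\<in>I. u x \<noteq> 0" using pos by (metis less_irrefl)
  have "continuous_on I (\<lambda>x. \<mu> * (q * u x powr (q - 1) * d x - d x))"
    by (intro continuous_intros legendre_pairD(1,3)[OF P] nz)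
  from legendre_regularity[OF P g this] obtain d' where
    d': "continuous_on I d'" "\<And>x. x \<in> I \<Longrightarrow> (d has_real_derivative d' x) (at x within I)"
    "\<And>x. x \<in> I \<Longrightarrow> x * (1 - x) * d' x + (1 - 2 * x) * d x = - (\<mu> * (u x powr q - u x))" by blast
  let ?U = "\<lambda>x. if x \<in> I then u x else 1 * u (1 - x)"
  let ?U' = "\<lambda>x. if x \<in> I then d x else - 1 * d (1 - x)"
  let ?U'' = "\<lambda>x. if x \<in> I then d' x else - (- 1) * d' (1 - x)"
  have c: "continuous_on {0..1} (\<lambda>x. if x \<le> 1/2 then d' x else d' (1 - x))"
  proof (rule continuous_on_cases_le)
    have "{x \<in> {0..1}. x \<le> 1/2} = I" by auto
    then show "continuous_on {x \<in> {0..1}. x \<le> 1/2} d'" using d'(1) by simp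
    show "continuous_on {x \<in> {0..1}. 1/2 \<le> x} (\<lambda>x. d' (1 - x))"
      by (rule continuous_on_compose2[OF d'(1)]) (auto intro!: continuous_intros)
    show "d' x = d' (1 - x)" if "x = 1/2" for x
      unfolding that by simp
  qed (intro continuous_intros)
  have cont: "continuous_on {0..1} ?U''"
    by (rule continuous_on_eq[OF c]) auto
  have sol: "?U x > 0 \<and> (?U has_real_derivative ?U' x) (at x within {0..1}) \<and>
     (?U' has_real_derivative ?U'' x) (at x within {0..1}) \<and>
     x * (1 - x) * ?U'' x + (1 - 2 * x) * ?U' x = - \<mu> * (?U x powr q - ?U x)" if x: "x \<in> {0..1}" for x
  proof (intro conjI)
    have I': "1 - x \<in> I" if "x \<notin> I" using that x by auto
    show "?U x > 0" using pos[of x] pos[OF I'] by auto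
    show "(?U has_real_derivative ?U' x) (at x within {0..1})"
      using node by (intro reflect_deriv legendre_pairD(5)[OF P] x) auto
    show "(?U' has_real_derivative ?U'' x) (at x within {0..1})"
      using node by (intro reflect_deriv d'(2) x) auto
    show "x * (1 - x) * ?U'' x + (1 - 2 * x) * ?U' x = - \<mu> * (?U x powr q - ?U x)"
    proof (cases "x \<in> I")
      case True
      show ?thesis unfolding if_P[OF True] using d'(3)[OF True] by (simp only: mult_minus_left)
    next
      case False
      have "(1 - x) * x * d' (1 - x) + (2 * x - 1) * d (1 - x) = - (\<mu> * (u (1 - x) powr q - u (1 - x)))"
        using d'(3)[OF I'[OF False]] by simp
      then show ?thesis unfolding if_not_P[OF False] by (simp add: algebra_simps)
    qed
  qed
  show ?thesis
    unfolding axial_solution_def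
    by (rule exI[of _ ?U'], rule exI[of _ ?U''], rule conjI[OF cont], rule ballI, rule sol)
qed

text \<open>
  The constant \<open>A\<close> is chosen large enough for \<open>large_start_decreasing\<close>, and the truncation \<open>B = 2 A\<close>
  lies above all solutions with initial values up to \<open>A\<close>, since they rise by at most \<open>\<mu> \<le> A\<close>.
\<close>
lemma many_axial_solutions:
  fixes m :: nat
  assumes q: "q > 1" and \<mu>: "2 * real m * (2 * real m + 1) < \<mu> * (q - 1)" "\<mu> > 0"
  shows "\<exists>T. finite T \<and> card T = 2 * m + 1 \<and> (\<forall>a\<in>T. \<exists>U. U 0 = a \<and> axial_solution \<mu> q U)"
proof -
  (* This is the value with p powr (q - 1) = 2. *)
  define p where "p = 2 powr (1 / (q - 1))"
  define A where "A = 8 * 4 powr q * \<mu> + 2 * p + 2"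
  define B where "B = 2 * A"
  have p4: "4 powr q \<ge> 1" using q powr_mono[of 0 q 4] by simp
  then have "\<mu> \<le> 8 * 4 powr q * \<mu>"
    using \<mu> mult_right_mono[of 1 "8 * 4 powr q" \<mu>] by simp
  moreover have p0: "p \<ge> 0" by (simp add: p_def)
  ultimately have A: "A \<ge> 8 * 4 powr q * \<mu>" "A \<ge> 2" "A \<ge> \<mu>" "A \<ge> 2 * p"
    unfolding A_def using \<mu>(2) by linarith+
  have "p powr (q - 1) \<le> (A / 2) powr (q - 1)"
    using A(4) q p0 by (intro powr_mono2) auto
  then have A2: "(A / 2) powr (q - 1) \<ge> 2" using q by (simp add: p_def powr_powr)
  let ?f = "truncated_power \<mu> q B"
  define L where "L = \<mu> * (q * B powr (q - 1) + 1)"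
  have B1: "B > 1" "B > 0" "B \<ge> 1" using A by (auto simp: B_def)
  have L0: "L > 0" using \<mu> q by (auto simp: L_def intro!: mult_pos_pos add_nonneg_pos)
  have lip: "\<bar>?f s - ?f t\<bar> \<le> L * \<bar>s - t\<bar>" for s t
    unfolding L_def by (rule truncated_power_lipschitz[OF q \<mu>(2) B1(2)])
  have "\<forall>a. \<exists>u d. legendre_pair u d (\<lambda>x. ?f (u x)) \<and> u 0 = a"
    using legendre_ivp[OF lip L0] by blast
  then obtain u where "\<forall>a. \<exists>d. legendre_pair (u a) d (\<lambda>x. ?f (u a x)) \<and> u a 0 = a"
    using choice[of "\<lambda>a u. \<exists>d. legendre_pair u d (\<lambda>x. ?f (u x)) \<and> u 0 = a"] by blast
  then obtain d where ud: "\<And>a. legendre_pair (u a) (d a) (\<lambda>x. ?f (u a x))" "\<And>a. u a 0 = a"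
    using choice[of "\<lambda>a d. legendre_pair (u a) d (\<lambda>x. ?f (u a x)) \<and> u a 0 = a"] by blast
  interpret shooting ?f L u d
  proof
    show "?f t = 0" if "t \<le> 0" for t
    proof -
      have "max 0 (min B t) = 0" using that by (intro max_absorb1 min.coboundedI2)
      then show ?thesis by (simp add: truncated_power_def)
    qed
    show "?f 1 = 0" using B1 by (simp add: truncated_power_eq)
    show "?f t < 0" if "0 < t" "t < 1" for t
    proof -
      have "t powr q < t powr 1" using that q by (intro powr_less_mono') auto
      then show ?thesis using that B1 \<mu> by (simp add: truncated_power_eq mult_less_0_iff)
    qed
  qed (rule lip L0 ud)+
  define \<kappa> where "\<kappa> = (2 * real m * (2 * real m + 1) + \<mu> * (q - 1)) / 2"
  have \<kappa>: "2 * real m * (2 * real m + 1) < \<kappa>" "\<kappa> < \<mu> * (q - 1)" using \<mu> by (auto simp: \<kappa>_def)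
  obtain \<eta> where \<eta>: "\<eta> > 0" "\<And>t. \<bar>t - 1\<bar> < \<eta> \<Longrightarrow> \<kappa> * (t - 1)^2 \<le> ?f t * (t - 1)"
    using truncated_power_near_1[OF q \<mu>(2) B1(1) \<kappa>(2)] by blast
  have PA: "legendre_pair (u A) (d A) (\<lambda>x. truncated_power \<mu> q (2 * A) (u A x))"
    using ud(1)[of A] by (simp only: B_def)
  have dA: "d A x < 0" if "0 < x" "x \<le> 1/2" for x
    by (rule large_start_decreasing[OF q \<mu>(2) A(1) A2 A(2,3) PA ud(2) that])
  have A1: "A > 1" using A by simp
  obtain T where T: "finite T" "card T = 2 * m + 1" "T \<subseteq> {0<..A}" "\<forall>a\<in>T. d a (1/2) = 0"
    using many_nodes[OF \<kappa>(1) \<eta> A1 dA] by blast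
  have "\<exists>U. U 0 = a \<and> axial_solution \<mu> q U" if a: "a \<in> T" for a
  proof -
    have a0: "0 < a" "a \<le> A" and node: "d a (1/2) = 0" using T a by auto
    note pos = positive[OF a0(1) node]
    have uB: "u a x \<le> B" if "x \<in> I" for x
    proof -
      have "u a x \<le> u a 0 + \<mu>"
        by (rule legendre_upper_bound[OF ud(1) _ that])
           (use truncated_power_bounds(1)[OF q \<mu>(2) B1(3)] \<mu> in auto)
      then show ?thesis using a0 A by (simp add: ud(2) B_def)
    qed
    have "legendre_pair (u a) (d a) (\<lambda>x. \<mu> * (u a x powr q - u a x))"
    proof (rule legendre_pair_cong[OF ud(1)])
      show "?f (u a x) = \<mu> * (u a x powr q - u a x)" if "x \<in> I" for x
        by (rule truncated_power_eq[OF less_imp_le[OF pos[OF that]] uB[OF that]])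
    qed
    from reflect_axial_solution[OF this pos node]
    have ax: "axial_solution \<mu> q (\<lambda>x. if x \<in> I then u a x else 1 * u a (1 - x))" .
    have zero: "(\<lambda>x. if x \<in> I then u a x else 1 * u a (1 - x)) 0 = a" by (simp add: ud(2))
    show ?thesis
      by (rule exI[of _ "\<lambda>x. if x \<in> I then u a x else 1 * u a (1 - x)"], rule conjI[OF zero ax])
  qed
  then show ?thesis using T(1,2) by blast
qed

section \<open>Invariant solutions on the projective plane\<close>

lemma quadric_ratio_smult:
  assumes "c \<noteq> 0"
  shows "quadric_ratio (c *s z) = quadric_ratio z"
proof -
  have "(\<Sum>i\<in>UNIV. ((c *s z) $ i)^2) = c^2 * (\<Sum>i\<in>UNIV. (z $ i)^2)"
    by (simp add: power_mult_distrib sum_distrib_left)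
  moreover have "norm (c *s z) = cmod c * norm z"
    by (simp add: norm_vec_def L2_set_def norm_mult power_mult_distrib real_sqrt_mult flip: sum_distrib_left)
  ultimately have "quadric_ratio (c *s z)
     = (cmod c ^ 4 * (cmod (\<Sum>i\<in>UNIV. (z $ i)^2))^2) / (cmod c ^ 4 * (norm z)^4)"
    by (simp add: quadric_ratio_def norm_mult norm_power power_mult_distrib flip: power_mult)
  then show ?thesis using assms by (simp add: quadric_ratio_def)
qed

text \<open>
  The quadric ratio on the projective plane, read off from an arbitrary representative; by
  \<open>quadric_ratio_smult\<close> the choice does not matter.
\<close>
definition cp2_ratio :: "cp2 \<Rightarrow> real" where
  "cp2_ratio p = quadric_ratio (rep_cp2 p)"

lemma cp2_ratio_abs:
  assumes "z \<noteq> 0"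
  shows "cp2_ratio (abs_cp2 z) = quadric_ratio z"
proof -
  have "same_line z z" using assms by (auto simp: same_line_def intro: exI[of _ 1])
  then have "same_line (rep_cp2 (abs_cp2 z)) z" by (rule Quotient_rep_abs[OF Quotient_cp2])
  then obtain c where c: "z \<noteq> 0" "z = c *s rep_cp2 (abs_cp2 z)" by (auto simp: same_line_def)
  have "c \<noteq> 0"
  proof
    assume "c = 0"
    with c(2) have "z = 0" by simp
    with c(1) show False by contradiction
  qed
  have "quadric_ratio z = quadric_ratio (c *s rep_cp2 (abs_cp2 z))"
    using c(2) by (rule arg_cong)
  also have "\<dots> = cp2_ratio (abs_cp2 z)"
    unfolding cp2_ratio_def by (rule quadric_ratio_smult[OF \<open>c \<noteq> 0\<close>])
  finally show ?thesis by (rule sym)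
qed

lemma cp2_ratio_affine: "cp2_ratio (affine_param j x) = quadric_ratio (affine_vec j x)"
  unfolding affine_param_def by (rule cp2_ratio_abs[OF affine_vec_nonzero])

lemma cp2_ratio_range: "cp2_ratio p \<in> {0..1}"
  unfolding cp2_ratio_def by (rule quadric_ratio_range)

lemma cp2_ratio_zero: "\<exists>p. cp2_ratio p = 0"
proof
  show "cp2_ratio (affine_param 1 (axis 2 1)) = 0"
    by (simp add: cp2_ratio_affine quadric_ratio_affine form_re_def form_im_def axis_component)
qed

text \<open>
  A real orthogonal matrix preserves the complex bilinear form, hence the numerator of the quadric
  ratio; with a conjugated argument the same identity yields the norm.
\<close>
lemma orthogonal_bilinear:
  fixes A :: "real^'n^'n" and z w :: "complex^'n"
  assumes "orthogonal_matrix A"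
  shows "(\<Sum>i\<in>UNIV. (map_matrix complex_of_real A *v z) $ i * (map_matrix complex_of_real A *v w) $ i)
       = (\<Sum>i\<in>UNIV. z $ i * w $ i)"
proof -
  have "transpose A ** A = mat 1" using assms by (simp add: orthogonal_matrix)
  then have "(transpose A ** A) $ j $ k = mat 1 $ j $ k" for j k by simp
  then have A: "(\<Sum>i\<in>UNIV. A $ i $ j * A $ i $ k) = (if j = k then 1 else 0)" for j k
    by (simp add: matrix_matrix_mult_def transpose_def mat_def)
  have A': "(\<Sum>i\<in>UNIV. complex_of_real (A $ i $ j) * complex_of_real (A $ i $ k)) = (if j = k then 1 else 0)" for j k
  proof -
    have "(\<Sum>i\<in>UNIV. complex_of_real (A $ i $ j) * complex_of_real (A $ i $ k)) =
      complex_of_real (\<Sum>i\<in>UNIV. A $ i $ j * A $ i $ k)" by simp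
    then show ?thesis unfolding A by simp
  qed
  have "(\<Sum>i\<in>UNIV. (map_matrix complex_of_real A *v z) $ i * (map_matrix complex_of_real A *v w) $ i)
     = (\<Sum>i\<in>UNIV. \<Sum>j\<in>UNIV. \<Sum>k\<in>UNIV. (complex_of_real (A $ i $ j) * complex_of_real (A $ i $ k)) * (z $ j * w $ k))"
    unfolding matrix_vector_mult_def map_matrix_def
    by (simp add: sum_product) (intro sum.cong refl, simp add: mult_ac)
  also have "\<dots> = (\<Sum>j\<in>UNIV. \<Sum>i\<in>UNIV. \<Sum>k\<in>UNIV. (complex_of_real (A $ i $ j) * complex_of_real (A $ i $ k)) * (z $ j * w $ k))"
    by (rule sum.swap)
  also have "\<dots> = (\<Sum>j\<in>UNIV. \<Sum>k\<in>UNIV. \<Sum>i\<in>UNIV. (complex_of_real (A $ i $ j) * complex_of_real (A $ i $ k)) * (z $ j * w $ k))"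
    by (rule sum.cong[OF refl], rule sum.swap)
  also have "\<dots> = (\<Sum>j\<in>UNIV. \<Sum>k\<in>UNIV. (if j = k then 1 else 0) * (z $ j * w $ k))"
    by (simp only: sum_distrib_right[symmetric] A')
  also have "\<dots> = (\<Sum>i\<in>UNIV. z $ i * w $ i)"
    by (simp add: if_distrib[of "\<lambda>c. c * _"] cong: if_cong)
  finally show ?thesis .
qed

lemma orthogonal_norm:
  fixes A :: "real^'n^'n" and z :: "complex^'n"
  assumes "orthogonal_matrix A"
  shows "norm (map_matrix complex_of_real A *v z) = norm z"
proof -
  have n: "complex_of_real ((norm v)^2) = (\<Sum>i\<in>UNIV. v $ i * cnj (v $ i))" for v :: "complex^'n"
  proof -
    have "(norm v)^2 = (\<Sum>i\<in>UNIV. (cmod (v $ i))^2)"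
      by (simp add: norm_vec_def L2_set_def sum_nonneg)
    then show ?thesis by (simp only: of_real_sum complex_norm_square)
  qed
  define z' where "z' = (\<chi> i. cnj (z $ i))"
  have "cnj ((map_matrix complex_of_real A *v z) $ i) = (map_matrix complex_of_real A *v z') $ i" for i
    by (simp add: matrix_vector_mult_def map_matrix_def z'_def)
  then have "complex_of_real ((norm (map_matrix complex_of_real A *v z))^2) = complex_of_real ((norm z)^2)"
    unfolding n by (simp add: orthogonal_bilinear[OF assms]) (simp add: z'_def)
  then have "(norm (map_matrix complex_of_real A *v z))^2 = (norm z)^2" by (simp only: of_real_eq_iff)
  then show ?thesis by simp
qed

lemma SO3_invariant_cp2_ratio: "SO3_invariant (\<lambda>p. U (cp2_ratio p))"
  unfolding SO3_invariant_def
proof (intro allI impI)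
  fix A :: "real^3^3" and z :: "complex^3"
  assume "rotation_matrix A" and z: "z \<noteq> 0"
  then have A: "orthogonal_matrix A" by (simp add: rotation_matrix_def)
  let ?z = "map_matrix complex_of_real A *v z"
  have nz: "?z \<noteq> 0" using orthogonal_norm[OF A, of z] z by (metis norm_eq_zero)
  have "quadric_ratio ?z = quadric_ratio z"
    using orthogonal_bilinear[OF A, of z z] orthogonal_norm[OF A, of z]
    by (simp add: quadric_ratio_def power2_eq_square)
  then show "U (cp2_ratio (abs_cp2 ?z)) = U (cp2_ratio (abs_cp2 z))"
    using z nz by (simp add: cp2_ratio_abs)
qed

lemma axial_solution_yamabe:
  assumes "axial_solution (lam / 16) q U"
  shows "yamabe_type_solution q lam (\<lambda>p. U (cp2_ratio p))"
  unfolding yamabe_type_solution_def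
proof (intro allI conjI)
  fix j x
  obtain U1 U2 where c: "continuous_on {0..1} U2"
    and U: "\<And>y. y \<in> {0..1} \<Longrightarrow> (U has_real_derivative U1 y) (at y within {0..1})"
    and U1: "\<And>y. y \<in> {0..1} \<Longrightarrow> (U1 has_real_derivative U2 y) (at y within {0..1})"
    and ode: "\<And>y. y \<in> {0..1} \<Longrightarrow> y * (1 - y) * U2 y + (1 - 2 * y) * U1 y = - (lam / 16) * (U y powr q - U y)"
    using assms unfolding axial_solution_def by blast
  have comp: "(\<lambda>p. U (cp2_ratio p)) \<circ> affine_param j = (\<lambda>x. U (quadric_ratio (affine_vec j x)))"
    by (simp add: fun_eq_iff cp2_ratio_affine)
  show "C2 ((\<lambda>p. U (cp2_ratio p)) \<circ> affine_param j)"
    unfolding comp by (rule C2_compose[OF C2_ratio _ U U1 c]) (use quadric_ratio_range in auto)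
  let ?h = "quadric_ratio (affine_vec j x)"
  have "laplace_beltrami (fubini_study j) ((\<lambda>p. U (cp2_ratio p)) \<circ> affine_param j) x
      = 16 * (?h * (1 - ?h) * U2 ?h + (1 - 2 * ?h) * U1 ?h)"
    unfolding comp using laplace_beltrami_ratio[OF U U1, of j x] by (simp only: Let_def)
  also have "\<dots> = - lam * (U ?h powr q - U ?h)"
    unfolding ode[OF quadric_ratio_range] by simp
  finally show "- laplace_beltrami (fubini_study j) ((\<lambda>p. U (cp2_ratio p)) \<circ> affine_param j) x
      + lam * U (cp2_ratio (affine_param j x)) = lam * U (cp2_ratio (affine_param j x)) powr q"
    by (simp add: cp2_ratio_affine algebra_simps)
qed

theorem corollary1p6:
  fixes q lam :: real and k :: nat
  assumes "q > 1"
    and "k \<ge> 1"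
    and "lam \<in> {16 * real k * (real k + 1) / (q - 1) <.. 16 * (real k + 1) * (real k + 2) / (q - 1)}"
  shows "\<exists>S :: (cp2 \<Rightarrow> real) set. finite S \<and> card S = k \<and>
           (\<forall>u\<in>S. yamabe_type_solution q lam u \<and> (\<forall>p. u p > 0) \<and> SO3_invariant u)"
proof -
  (* Each of the m positive even degrees up to k accounts for two solutions, one on either side of 1. *)
  define m where "m = k div 2"
  have "2 * m \<le> k" "k \<le> 2 * m + 1" by (auto simp: m_def)
  then have mk: "2 * real m \<le> real k" by linarith
  have lam: "real k * (real k + 1) < lam / 16 * (q - 1)"
    using assms by (simp add: field_simps)
  have "2 * real m * (2 * real m + 1) \<le> real k * (real k + 1)"
    using mk by (intro mult_mono) auto
  then have \<mu>: "2 * real m * (2 * real m + 1) < lam / 16 * (q - 1)" using lam by linarith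
  have "0 < lam / 16 * (q - 1)" using lam by (smt (verit) mult_nonneg_nonneg of_nat_0_le_iff)
  then have "lam / 16 > 0" using assms(1) by (simp add: zero_less_mult_iff)
  from many_axial_solutions[OF assms(1) \<mu> this] obtain T
    where T: "finite T" "card T = 2 * m + 1" "\<forall>a\<in>T. \<exists>U. U 0 = a \<and> axial_solution (lam / 16) q U" by blast
  obtain X where X: "X \<subseteq> T" "card X = k" "finite X"
    using obtain_subset_with_card_n[of k T] \<open>k \<le> 2 * m + 1\<close> T(2) by metis
  from bchoice[OF T(3)] obtain U where U: "\<forall>a\<in>T. U a 0 = a \<and> axial_solution (lam / 16) q (U a)" by blast
  obtain p0 where p0: "cp2_ratio p0 = 0" using cp2_ratio_zero by blast
  let ?sol = "\<lambda>a p. U a (cp2_ratio p)"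
  have "inj_on ?sol X"
  proof (rule inj_onI)
    fix a b assume ab: "a \<in> X" "b \<in> X" "?sol a = ?sol b"
    then have "U a (cp2_ratio p0) = U b (cp2_ratio p0)" by meson
    moreover have "U a 0 = a" "U b 0 = b" using ab(1,2) X(1) U by blast+
    ultimately show "a = b" unfolding p0 by simp
  qed
  (* The profiles differ at ratio 0, where their values are the distinct initial values. *)
  then have "card (?sol ` X) = k" using X(2) by (simp add: card_image)
  moreover have "yamabe_type_solution q lam u \<and> (\<forall>p. u p > 0) \<and> SO3_invariant u" if u: "u \<in> ?sol ` X" for u
  proof -
    obtain a where a: "a \<in> X" "u = ?sol a" using u by blast
    then have ax: "axial_solution (lam / 16) q (U a)" using X(1) U by blast
    then have "U a (cp2_ratio p) > 0" for p
      using cp2_ratio_range[of p] unfolding axial_solution_def by blast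
    then show ?thesis
      unfolding a(2) using axial_solution_yamabe[OF ax] SO3_invariant_cp2_ratio by blast
  qed
  ultimately show ?thesis using X(3) by blast
qed

end
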